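(* Suppose $b>2$. Let $Z_1,Z_2,\ldots$ be i.i.d. exponential random variables with mean $1$ and, for each integer $n>b$, let $X=X^{(n)}=(X_1,\ldots,X_n)$ be uniformly distributed on $K=K_{n,b}$. Then the following hold. (a) For any fixed $k$, the random vector $(X_1,\ldots,X_k)$ converges in law to $(Z_1,\ldots,Z_k)$ as $n\to\infty$. (b) Convergence of moments does not happen: $\mathbb{E}(X_1^2)=b$ for every $n$, whereas $\mathbb{E}(Z_1^2)=2$. (c) Let $M=\max_{1\le i\le n}X_i$. Then, as $n\to\infty$, $$\frac{M^2}{(b-2)n}\to 1\quad\text{in probability.}$$ Consequently, the sum of squares of all other coordinates satisfies $\frac1n\bigl(\sum_{i=1}^nX_i^2-M^2\bigr)\to 2$ in probability. (d) Let $M_2$ be the value of the second largest coordinate of $X$. Then, as $n\to\infty$, $$\frac{M_2^2}{n}\to 0\quad\text{in probability.}$$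
   Context: $\mathbb{R}_+$ denotes the set of (strictly) positive real numbers. For real $b>1$ and an integer $n>b$ (which makes the set non-empty), $$K=K_{n,b}:=\Bigl\{x=(x_1,\ldots,x_n)\in\mathbb{R}_+^n:\ \sum_{i=1}^n x_i=n,\ \sum_{i=1}^n x_i^2=nb\Bigr\}.$$ The uniform distribution on $K$ is the limit of normalized Lebesgue measures on thin shells around $K$ as the thickness tends to zero; equivalently, the set $\{x\in\mathbb{R}^n:\sum x_i=n,\ \sum x_i^2=nb\}$ is a sphere centered at $(1,\ldots,1)$ in the hyperplane $\{\sum x_i=n\}$, $K$ is a relatively open non-empty subset of it, and the uniform distribution on $K$ is the rotation-invariant probability measure of this sphere conditioned on (restricted to and normalized on) $K$. The number $b$ is fixed and does not depend on $n$. *)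

theory Defs
  imports "HOL-Probability.Probability"
begin

text \<open>Points of \<open>\<real>\<^sup>n\<close> are the functions in \<open>{1..n} \<rightarrow>\<^sub>E UNIV\<close>, i.e. functions on \<open>nat\<close> that are
  \<open>undefined\<close> outside the index set.\<close>

abbreviation Rn :: "nat \<Rightarrow> (nat \<Rightarrow> real) set" where
  "Rn n \<equiv> {1..n} \<rightarrow>\<^sub>E UNIV"

abbreviation borel_n :: "nat \<Rightarrow> (nat \<Rightarrow> real) measure" where
  "borel_n n \<equiv> PiM {1..n} (\<lambda>_. borel)"

abbreviation lborel_n :: "nat \<Rightarrow> (nat \<Rightarrow> real) measure" where
  "lborel_n n \<equiv> PiM {1..n} (\<lambda>_. lborel)"

definition K_set :: "nat \<Rightarrow> real \<Rightarrow> (nat \<Rightarrow> real) set" where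
  "K_set n b = {x \<in> {1..n} \<rightarrow>\<^sub>E {0<..}.
      (\<Sum>i=1..n. x i) = real n \<and> (\<Sum>i=1..n. (x i)\<^sup>2) = real n * b}"

definition K_shell :: "nat \<Rightarrow> real \<Rightarrow> real \<Rightarrow> (nat \<Rightarrow> real) set" where
  "K_shell n b \<epsilon> = {x \<in> {1..n} \<rightarrow>\<^sub>E {0<..}.
      \<bar>(\<Sum>i=1..n. x i) - real n\<bar> < \<epsilon> \<and> \<bar>(\<Sum>i=1..n. (x i)\<^sup>2) - real n * b\<bar> < \<epsilon>}"

text \<open>Weak convergence of laws on \<open>\<real>\<^sup>k\<close> along a filter, tested on bounded continuous functions.
  The product topology on \<open>nat \<Rightarrow> real\<close> induces the Euclidean topology on \<^term>\<open>Rn k\<close>.\<close>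

definition weak_conv_n ::
  "nat \<Rightarrow> ('i \<Rightarrow> (nat \<Rightarrow> real) measure) \<Rightarrow> (nat \<Rightarrow> real) measure \<Rightarrow> 'i filter \<Rightarrow> bool" where
  "weak_conv_n k \<mu> \<nu> F \<longleftrightarrow>
     (\<forall>f :: (nat \<Rightarrow> real) \<Rightarrow> real. continuous_on (Rn k) f \<and> bounded (f ` Rn k) \<longrightarrow>
        ((\<lambda>t. \<integral>x. f x \<partial>\<mu> t) \<longlongrightarrow> (\<integral>x. f x \<partial>\<nu>)) F)"

text \<open>The uniform distribution on \<^term>\<open>K_set n b\<close>: the probability measure on that set which is the
  weak limit of normalized Lebesgue measure on thin shells. The two constraint functions have
  gradients \<open>(1,\<dots>,1)\<close> and \<open>2x\<close>, whose Gram determinant is the constant \<open>4n\<^sup>2(b - 1)\<close> on the set; hence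
  shells cut out by the constraints and shells of constant Euclidean thickness have the same limit,
  namely normalized surface measure of the sphere restricted to the set.\<close>

definition uniform_on_K :: "nat \<Rightarrow> real \<Rightarrow> (nat \<Rightarrow> real) measure \<Rightarrow> bool" where
  "uniform_on_K n b \<mu> \<longleftrightarrow>
     prob_space \<mu> \<and> sets \<mu> = sets (borel_n n) \<and> emeasure \<mu> (K_set n b) = 1 \<and>
     weak_conv_n n (\<lambda>\<epsilon>. uniform_measure (lborel_n n) (K_shell n b \<epsilon>)) \<mu> (at_right 0)"

text \<open>Convergence in probability to a constant, where the \<open>n\<close>-th variable lives on its own
  probability space \<open>P n\<close>.\<close>

definition conv_in_prob ::
  "(nat \<Rightarrow> 'a measure) \<Rightarrow> (nat \<Rightarrow> 'a \<Rightarrow> real) \<Rightarrow> real \<Rightarrow> bool" where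
  "conv_in_prob P Y c \<longleftrightarrow>
     (\<forall>\<^sub>F n in sequentially. Y n \<in> borel_measurable (P n)) \<and>
     (\<forall>\<epsilon>>0. (\<lambda>n. measure (P n) {\<omega> \<in> space (P n). \<bar>Y n \<omega> - c\<bar> > \<epsilon>}) \<longlonglongrightarrow> 0)"

definition max_coord :: "nat \<Rightarrow> (nat \<Rightarrow> real) \<Rightarrow> real" where
  "max_coord n x = Max (x ` {1..n})"

text \<open>Second largest coordinate, counted with multiplicity (meaningful for \<open>n \<ge> 2\<close>).\<close>

definition second_max_coord :: "nat \<Rightarrow> (nat \<Rightarrow> real) \<Rightarrow> real" where
  "second_max_coord n x = rev (sort (map x [1..<Suc n])) ! 1"

end

theory Submission
  imports Defs "HOL-Analysis.Ball_Volume" "HOL-Real_Asymp.Real_Asymp"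
begin

text \<open>On a thin shell around \<open>K_set n b\<close> the joint density of independent exponential variables is
  nearly constant, so a uniform point is a sequence of exponential variables conditioned on its sum
  and its square sum. The proof estimates the price of this conditioning. The square sum of \<open>n\<close>
  exponential variables is typically \<open>2n\<close>, and the cheapest way to reach \<open>bn\<close> is one coordinate of size
  \<open>\<surd>((b - 2) n)\<close>, whose probability is \<open>exp (- \<surd>((b - 2) n))\<close>. An event whose probability for
  exponential variables, jointly with a large square sum, is smaller than this by a factor
  \<open>exp (- \<eta>\<surd>n)\<close> is therefore negligible for the uniform distribution.

  To avoid densities of the sum and the square sum, three coordinates are integrated out. The
  volume of a thin shell around a circle in three-dimensional space is a constant times \<open>\<epsilon>\<^sup>2\<close>,
  independently of the radius (\<open>circ_shell_volume_le\<close>, \<open>circ_shell_volume_eq\<close>). For an upper bound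
  (\<open>emeasure_K_shell_le\<close>) the three coordinates are chosen among those that are at most 2, so that the
  event can still be read off from the others, and there are at most \<open>n\<^sup>3\<close> choices. For a lower bound
  (\<open>emeasure_K_shell_ge\<close>) the others must leave a circle inside the positive octant. They do so if
  their sum falls short of \<open>n\<close> by a small multiple of \<open>\<surd>n\<close> and their square sum lies in a suitable
  window of length of order \<open>n\<close>; with one large coordinate, the central limit theorem and the law of
  large numbers this has a probability of the right order (\<open>good_set_prob\<close>). Together these give
  \<open>shell_measure_le\<close>.

  The following events are negligible: all coordinates are below \<open>L\<surd>n\<close> with \<open>L < \<surd>(b - 2)\<close>, by a
  Chernoff bound for truncated squares; some coordinate is above \<open>L\<surd>n\<close> with \<open>L > \<surd>(b - 2)\<close>; one
  coordinate is above \<open>L\<surd>n\<close> and another one above \<open>\<epsilon>\<surd>n\<close> with \<open>L + \<epsilon> > \<surd>(b - 2)\<close>; and the average of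
  a bounded function over disjoint blocks of coordinates deviates from its mean, which by Hoeffding's
  inequality has probability exponentially small in \<open>n\<close>. The first three determine the two largest
  coordinates. The last one gives the limit law of the first \<open>k\<close> coordinates, because the coordinates
  are exchangeable (\<open>uniform_on_K_permute\<close>). Exchangeability also gives the second moment. All
  statements pass from shells to their weak limit through continuous test functions
  (\<open>uniform_on_K_tail_le\<close>).\<close>

section \<open>Thin shells around a circle\<close>

lemma disc_area:
  "emeasure lborel {p :: real \<times> real. (fst p)\<^sup>2 + (snd p)\<^sup>2 < t} = ennreal (pi * max 0 t)"
  "emeasure lborel {p :: real \<times> real. (fst p)\<^sup>2 + (snd p)\<^sup>2 \<le> t} = ennreal (pi * max 0 t)"
proof -
  have vol: "unit_ball_vol 2 = pi" by (rule unit_ball_vol_2)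
  have 1: "{p :: real \<times> real. (fst p)\<^sup>2 + (snd p)\<^sup>2 < t} = ball 0 (sqrt t)" if "t \<ge> 0"
    using that by (auto simp: norm_prod_def real_sqrt_less_iff)
  have 2: "{p :: real \<times> real. (fst p)\<^sup>2 + (snd p)\<^sup>2 \<le> t} = cball 0 (sqrt t)" if "t \<ge> 0"
    using that by (auto simp: norm_prod_def)
  have 3: "{p :: real \<times> real. (fst p)\<^sup>2 + (snd p)\<^sup>2 < t} = {}"
          "{p :: real \<times> real. (fst p)\<^sup>2 + (snd p)\<^sup>2 \<le> t} = {}" if "t < 0"
    using that sum_power2_ge_zero by (auto simp: not_less not_le) (smt (verit) sum_power2_ge_zero)+
  show "emeasure lborel {p :: real \<times> real. (fst p)\<^sup>2 + (snd p)\<^sup>2 < t} = ennreal (pi * max 0 t)"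
    by (cases "t \<ge> 0") (auto simp: 1 3 emeasure_ball vol)
  show "emeasure lborel {p :: real \<times> real. (fst p)\<^sup>2 + (snd p)\<^sup>2 \<le> t} = ennreal (pi * max 0 t)"
    by (cases "t \<ge> 0") (auto simp: 2 3 emeasure_cball vol)
qed

lemma annulus_area:
  fixes r \<epsilon> :: real
  assumes "\<epsilon> > 0"
  defines "a \<equiv> (\<integral>\<^sup>+B. \<integral>\<^sup>+P. indicator {v. \<bar>v - r\<bar> < \<epsilon>} (P\<^sup>2 + B\<^sup>2) \<partial>lborel \<partial>lborel)"
  shows "a \<le> ennreal (2 * pi * \<epsilon>)" and "r \<ge> \<epsilon> \<Longrightarrow> a = ennreal (2 * pi * \<epsilon>)"
proof -
  let ?D = "{p :: real \<times> real. (fst p)\<^sup>2 + (snd p)\<^sup>2 < r + \<epsilon>}"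
  let ?C = "{p :: real \<times> real. (fst p)\<^sup>2 + (snd p)\<^sup>2 \<le> r - \<epsilon>}"
  have [measurable, simp]: "?D \<in> sets borel" "?C \<in> sets borel"
    by (intro borel_open open_Collect_less borel_closed closed_Collect_le continuous_intros)+
  have "a = (\<integral>\<^sup>+p. indicator {v. \<bar>v - r\<bar> < \<epsilon>} ((snd p)\<^sup>2 + (fst p)\<^sup>2) \<partial>(lborel \<Otimes>\<^sub>M lborel))"
    unfolding a_def by (subst lborel.nn_integral_fst[symmetric]) (auto simp: case_prod_unfold)
  also have "\<dots> = (\<integral>\<^sup>+p. indicator (?D - ?C) p \<partial>(lborel :: (real \<times> real) measure))"
    unfolding lborel_prod by (intro nn_integral_cong) (auto split: split_indicator)
  also have "\<dots> = emeasure lborel (?D - ?C)"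
    by (rule nn_integral_indicator) measurable
  also have "\<dots> = ennreal (pi * max 0 (r + \<epsilon>)) - ennreal (pi * max 0 (r - \<epsilon>))"
    using assms by (subst emeasure_Diff) (auto simp: disc_area)
  also have "\<dots> = ennreal (pi * max 0 (r + \<epsilon>) - pi * max 0 (r - \<epsilon>))"
    by (subst ennreal_minus) auto
  finally have a: "a = ennreal (pi * (max 0 (r + \<epsilon>) - max 0 (r - \<epsilon>)))" by (simp add: algebra_simps)
  have "pi * (max 0 (r + \<epsilon>) - max 0 (r - \<epsilon>)) \<le> pi * (2 * \<epsilon>)"
    using assms by (intro mult_left_mono) auto
  then show "a \<le> ennreal (2 * pi * \<epsilon>)" unfolding a by (intro ennreal_leI) (simp add: algebra_simps)
  show "a = ennreal (2 * pi * \<epsilon>)" if "r \<ge> \<epsilon>" unfolding a using that assms by (simp add: max_def algebra_simps)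
qed

text \<open>Change of variables to an orthogonal frame: \<open>u\<close> is the sum of the three coordinates, and \<open>B\<close>, \<open>P\<close>
  are orthonormal coordinates in the plane of vanishing sum. The substitutions \<open>z = u - x - y\<close>,
  \<open>x = (u - y)/2 + P/\<surd>2\<close> and \<open>y = u/3 + B\<surd>(2/3)\<close> are done one at a time, which gives the Jacobian
  \<open>1/\<surd>2 \<cdot> \<surd>(2/3) = 1/\<surd>3\<close>.\<close>

lemma nn_integral_orthogonal_coords:
  fixes F :: "real \<times> real \<times> real \<Rightarrow> ennreal"
  assumes [measurable]: "F \<in> borel_measurable borel"
  shows "(\<integral>\<^sup>+x. \<integral>\<^sup>+y. \<integral>\<^sup>+z. F (x, y, z) \<partial>lborel \<partial>lborel \<partial>lborel) =
    ennreal (1 / sqrt 3) * (\<integral>\<^sup>+u. \<integral>\<^sup>+B. \<integral>\<^sup>+P. F (u / 3 - B / sqrt 6 + P / sqrt 2, u / 3 + B * sqrt (2/3),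
       u / 3 - B / sqrt 6 - P / sqrt 2) \<partial>lborel \<partial>lborel \<partial>lborel)"
proof -
  have [measurable]: "F \<in> borel_measurable (borel \<Otimes>\<^sub>M borel \<Otimes>\<^sub>M borel)"
    using assms by (simp add: borel_prod)
  have "(\<integral>\<^sup>+x. \<integral>\<^sup>+y. \<integral>\<^sup>+z. F (x, y, z) \<partial>lborel \<partial>lborel \<partial>lborel) =
    (\<integral>\<^sup>+x. \<integral>\<^sup>+y. \<integral>\<^sup>+u. F (x, y, u - x - y) \<partial>lborel \<partial>lborel \<partial>lborel)"
  proof (rule nn_integral_cong, rule nn_integral_cong)
    fix x y :: real
    show "(\<integral>\<^sup>+z. F (x, y, z) \<partial>lborel) = (\<integral>\<^sup>+u. F (x, y, u - x - y) \<partial>lborel)"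
      by (subst nn_integral_real_affine[where c=1 and t="- x - y"]) (auto simp: algebra_simps)
  qed
  also have "\<dots> = (\<integral>\<^sup>+y. \<integral>\<^sup>+x. \<integral>\<^sup>+u. F (x, y, u - x - y) \<partial>lborel \<partial>lborel \<partial>lborel)"
    by (rule lborel_pair.Fubini') measurable
  also have "\<dots> = (\<integral>\<^sup>+y. \<integral>\<^sup>+u. \<integral>\<^sup>+x. F (x, y, u - x - y) \<partial>lborel \<partial>lborel \<partial>lborel)"
    by (intro nn_integral_cong lborel_pair.Fubini') measurable
  also have "\<dots> = (\<integral>\<^sup>+u. \<integral>\<^sup>+y. \<integral>\<^sup>+x. F (x, y, u - x - y) \<partial>lborel \<partial>lborel \<partial>lborel)"
    by (rule lborel_pair.Fubini') measurable
  also have "\<dots> = (\<integral>\<^sup>+u. \<integral>\<^sup>+y. ennreal (1 / sqrt 2) *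
      (\<integral>\<^sup>+P. F ((u - y) / 2 + P / sqrt 2, y, (u - y) / 2 - P / sqrt 2) \<partial>lborel) \<partial>lborel \<partial>lborel)"
  proof (intro nn_integral_cong)
    fix u y :: real
    show "(\<integral>\<^sup>+x. F (x, y, u - x - y) \<partial>lborel) = ennreal (1 / sqrt 2) *
      (\<integral>\<^sup>+P. F ((u - y) / 2 + P / sqrt 2, y, (u - y) / 2 - P / sqrt 2) \<partial>lborel)"
      by (subst nn_integral_real_affine[where c="1 / sqrt 2" and t="(u - y) / 2"])
         (auto simp: field_simps)
  qed
  also have "\<dots> = (\<integral>\<^sup>+u. ennreal (sqrt (2/3)) * (\<integral>\<^sup>+B. ennreal (1 / sqrt 2) *
      (\<integral>\<^sup>+P. F (u / 3 - B / sqrt 6 + P / sqrt 2, u / 3 + B * sqrt (2/3), u / 3 - B / sqrt 6 - P / sqrt 2)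
         \<partial>lborel) \<partial>lborel) \<partial>lborel)"
  proof (intro nn_integral_cong)
    fix u :: real
    have s: "sqrt (2/3) / 2 = 1 / sqrt 6"
    proof -
      have "sqrt 6 * sqrt (2/3) = sqrt 4" by (simp add: real_sqrt_mult[symmetric])
      also have "sqrt 4 = (2::real)" by simp
      finally show ?thesis by (simp add: field_simps)
    qed
    have eq: "(u - (u / 3 + sqrt (2/3) * B)) / 2 = u / 3 - B / sqrt 6" for B
    proof -
      have "sqrt (2/3) * B / 2 = B * (sqrt (2/3) / 2)" by simp
      also have "\<dots> = B / sqrt 6" unfolding s by simp
      finally show ?thesis by (simp add: field_simps)
    qed
    show "(\<integral>\<^sup>+y. ennreal (1 / sqrt 2) *
      (\<integral>\<^sup>+P. F ((u - y) / 2 + P / sqrt 2, y, (u - y) / 2 - P / sqrt 2) \<partial>lborel) \<partial>lborel) =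
      ennreal (sqrt (2/3)) * (\<integral>\<^sup>+B. ennreal (1 / sqrt 2) *
      (\<integral>\<^sup>+P. F (u / 3 - B / sqrt 6 + P / sqrt 2, u / 3 + B * sqrt (2/3), u / 3 - B / sqrt 6 - P / sqrt 2)
         \<partial>lborel) \<partial>lborel)"
      by (subst nn_integral_real_affine[where c="sqrt (2/3)" and t="u / 3"])
         (simp_all only: eq mult.commute[of _ "sqrt (2/3)"], auto)
  qed
  also have "\<dots> = (ennreal (sqrt (2/3)) * ennreal (1 / sqrt 2)) * (\<integral>\<^sup>+u. (\<integral>\<^sup>+B.
      (\<integral>\<^sup>+P. F (u / 3 - B / sqrt 6 + P / sqrt 2, u / 3 + B * sqrt (2/3), u / 3 - B / sqrt 6 - P / sqrt 2)
         \<partial>lborel) \<partial>lborel) \<partial>lborel)"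
    by (simp add: nn_integral_cmult mult.assoc)
  also have "ennreal (sqrt (2/3)) * ennreal (1 / sqrt 2) = ennreal (1 / sqrt 3)"
    by (subst ennreal_mult[symmetric]) (auto simp: real_sqrt_divide)
  finally show ?thesis .
qed

text \<open>The constant in the volume of a thin shell around a circle, per squared thickness.\<close>

definition circ_const :: real where "circ_const = 4 * pi / sqrt 3"

lemma circ_const_pos: "circ_const > 0" by (simp add: circ_const_def)

lemma sq_orthogonal:
  fixes u B P :: real
  shows "(u / 3 - B / sqrt 6 + P / sqrt 2)\<^sup>2 + (u / 3 + B * sqrt (2/3))\<^sup>2 + (u / 3 - B / sqrt 6 - P / sqrt 2)\<^sup>2
     = u\<^sup>2 / 3 + (P\<^sup>2 + B\<^sup>2)"
    and "(u / 3 - B / sqrt 6 + P / sqrt 2) + (u / 3 + B * sqrt (2/3)) + (u / 3 - B / sqrt 6 - P / sqrt 2) = u"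
proof -
  define s where "s = sqrt (2/3)"
  have s6: "1 / sqrt 6 = s / 2"
  proof -
    have "sqrt 6 * sqrt (2/3) = sqrt 4" by (simp add: real_sqrt_mult[symmetric])
    also have "sqrt 4 = (2::real)" by simp
    finally show ?thesis unfolding s_def by (simp add: field_simps)
  qed
  have B6: "B / sqrt 6 = B * (s / 2)" using s6 by (metis divide_inverse inverse_eq_divide)
  have ss: "s\<^sup>2 = 2/3" by (simp add: s_def)
  have PP: "(P / sqrt 2)\<^sup>2 = P\<^sup>2 / 2" by (simp add: power_divide)
  define p where "p = P / sqrt 2"
  show "(u / 3 - B / sqrt 6 + P / sqrt 2) + (u / 3 + B * sqrt (2/3)) + (u / 3 - B / sqrt 6 - P / sqrt 2) = u"
    unfolding B6 s_def[symmetric] by (simp add: field_simps)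
  have "(u / 3 - B * (s/2) + p)\<^sup>2 + (u / 3 + B * s)\<^sup>2 + (u / 3 - B * (s/2) - p)\<^sup>2
    = u\<^sup>2 / 3 + 2 * p\<^sup>2 + B\<^sup>2 * (3/2 * s\<^sup>2)"
    by (simp add: power2_eq_square algebra_simps)
  also have "2 * p\<^sup>2 = P\<^sup>2" unfolding p_def PP by simp
  finally show "(u / 3 - B / sqrt 6 + P / sqrt 2)\<^sup>2 + (u / 3 + B * sqrt (2/3))\<^sup>2 + (u / 3 - B / sqrt 6 - P / sqrt 2)\<^sup>2
     = u\<^sup>2 / 3 + (P\<^sup>2 + B\<^sup>2)" unfolding B6 s_def[symmetric] p_def[symmetric] ss by simp
qed

text \<open>The thin shell around the circle of points with coordinate sum \<open>s\<close> and square sum \<open>q\<close>, cut out by the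
  same two constraints as the shells in dimension \<open>n\<close>.\<close>

definition circ_shell :: "real \<Rightarrow> real \<Rightarrow> real \<Rightarrow> (real \<times> real \<times> real) set" where
  "circ_shell s q \<epsilon> = {(x, y, z). \<bar>x + y + z - s\<bar> < \<epsilon> \<and> \<bar>x\<^sup>2 + y\<^sup>2 + z\<^sup>2 - q\<bar> < \<epsilon>}"

lemma circ_shell_sets [measurable]: "circ_shell s q \<epsilon> \<in> sets borel"
proof -
  have "open {p :: real \<times> real \<times> real. \<bar>fst p + fst (snd p) + snd (snd p) - s\<bar> < \<epsilon> \<and>
    \<bar>(fst p)\<^sup>2 + (fst (snd p))\<^sup>2 + (snd (snd p))\<^sup>2 - q\<bar> < \<epsilon>}"
    by (intro open_Collect_conj open_Collect_less continuous_intros)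
  then show ?thesis by (simp add: circ_shell_def case_prod_unfold)
qed

lemma circ_shell_integral_eq:
  "(\<integral>\<^sup>+x. \<integral>\<^sup>+y. \<integral>\<^sup>+z. indicator (circ_shell s q \<epsilon>) (x, y, z) \<partial>lborel \<partial>lborel \<partial>lborel) =
    ennreal (1 / sqrt 3) * (\<integral>\<^sup>+u. indicator {s - \<epsilon> <..< s + \<epsilon>} u * (\<integral>\<^sup>+B. \<integral>\<^sup>+P. indicator {v. \<bar>v - (q - u\<^sup>2/3)\<bar> < \<epsilon>} (P\<^sup>2 + B\<^sup>2) \<partial>lborel \<partial>lborel) \<partial>lborel)"
proof -
  have eq: "indicator (circ_shell s q \<epsilon>) (u / 3 - B / sqrt 6 + P / sqrt 2, u / 3 + B * sqrt (2/3),
       u / 3 - B / sqrt 6 - P / sqrt 2) = (indicator {s - \<epsilon> <..< s + \<epsilon>} u * indicator {v. \<bar>v - (q - u\<^sup>2/3)\<bar> < \<epsilon>} (P\<^sup>2 + B\<^sup>2) :: ennreal)" for u B P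
    unfolding circ_shell_def indicator_def mem_Collect_eq case_prod_conv sq_orthogonal
    by (auto simp: algebra_simps abs_less_iff)
  show ?thesis
    by (subst nn_integral_orthogonal_coords) (auto simp: eq nn_integral_cmult)
qed

text \<open>In dimension three the slices of the shell are plane annuli, whose area depends only on the
  difference of the squared radii. Hence the volume is exactly \<open>circ_const * \<epsilon>\<^sup>2\<close> when no slice is
  degenerate, and at most that in general, uniformly in \<open>s\<close> and \<open>q\<close>. This is why three coordinates are
  singled out below.\<close>

lemma circ_shell_volume_le:
  assumes "\<epsilon> > 0"
  shows "(\<integral>\<^sup>+x. \<integral>\<^sup>+y. \<integral>\<^sup>+z. indicator (circ_shell s q \<epsilon>) (x, y, z) \<partial>lborel \<partial>lborel \<partial>lborel)
     \<le> ennreal (circ_const * \<epsilon>\<^sup>2)"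
proof -
  have "(\<integral>\<^sup>+x. \<integral>\<^sup>+y. \<integral>\<^sup>+z. indicator (circ_shell s q \<epsilon>) (x, y, z) \<partial>lborel \<partial>lborel \<partial>lborel) \<le>
     ennreal (1 / sqrt 3) * (\<integral>\<^sup>+u. ennreal (2 * pi * \<epsilon>) * indicator {s - \<epsilon> <..< s + \<epsilon>} u \<partial>lborel)"
    unfolding circ_shell_integral_eq
    by (intro mult_left_mono nn_integral_mono)
       (auto simp: annulus_area(1)[OF assms] split: split_indicator)
  also have "\<dots> = ennreal (1 / sqrt 3) * (ennreal (2 * pi * \<epsilon>) * ennreal (2 * \<epsilon>))"
    using assms by (simp add: nn_integral_cmult_indicator)
  also have "\<dots> = ennreal (circ_const * \<epsilon>\<^sup>2)"
    using assms by (simp add: ennreal_mult[symmetric] circ_const_def power2_eq_square field_simps)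
  finally show ?thesis .
qed

lemma circ_shell_volume_eq:
  assumes "\<epsilon> > 0" and "\<And>u. \<bar>u - s\<bar> < \<epsilon> \<Longrightarrow> q - u\<^sup>2 / 3 \<ge> \<epsilon>"
  shows "(\<integral>\<^sup>+x. \<integral>\<^sup>+y. \<integral>\<^sup>+z. indicator (circ_shell s q \<epsilon>) (x, y, z) \<partial>lborel \<partial>lborel \<partial>lborel)
     = ennreal (circ_const * \<epsilon>\<^sup>2)"
proof -
  have "(\<integral>\<^sup>+x. \<integral>\<^sup>+y. \<integral>\<^sup>+z. indicator (circ_shell s q \<epsilon>) (x, y, z) \<partial>lborel \<partial>lborel \<partial>lborel) =
     ennreal (1 / sqrt 3) * (\<integral>\<^sup>+u. ennreal (2 * pi * \<epsilon>) * indicator {s - \<epsilon> <..< s + \<epsilon>} u \<partial>lborel)"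
    unfolding circ_shell_integral_eq
  proof (rule arg_cong2[where f="(*)", OF refl], rule nn_integral_cong)
    fix u :: real
    show "indicator {s - \<epsilon> <..< s + \<epsilon>} u * (\<integral>\<^sup>+B. \<integral>\<^sup>+P. indicator {v. \<bar>v - (q - u\<^sup>2/3)\<bar> < \<epsilon>} (P\<^sup>2 + B\<^sup>2) \<partial>lborel \<partial>lborel)
      = ennreal (2 * pi * \<epsilon>) * indicator {s - \<epsilon> <..< s + \<epsilon>} u"
      using annulus_area(2)[OF assms(1), of "q - u\<^sup>2/3"] assms(2)[of u]
      by (cases "\<bar>u - s\<bar> < \<epsilon>") (auto simp: abs_less_iff split: split_indicator)
  qed
  also have "\<dots> = ennreal (1 / sqrt 3) * (ennreal (2 * pi * \<epsilon>) * ennreal (2 * \<epsilon>))"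
    using assms by (simp add: nn_integral_cmult_indicator)
  also have "\<dots> = ennreal (circ_const * \<epsilon>\<^sup>2)"
    using assms by (simp add: ennreal_mult[symmetric] circ_const_def power2_eq_square field_simps)
  finally show ?thesis .
qed

text \<open>If \<open>q < s\<^sup>2/2\<close>, a circle of sum \<open>s > 0\<close> and square sum \<open>q\<close> lies in the positive octant.\<close>
lemma circ_positive:
  fixes x y z :: real
  assumes "x + y + z > 0" "x\<^sup>2 + y\<^sup>2 + z\<^sup>2 < (x + y + z)\<^sup>2 / 2"
  shows "x > 0" "y > 0" "z > 0"
proof -
  have main: "a > 0" if "a + b + c > 0" "a\<^sup>2 + b\<^sup>2 + c\<^sup>2 < (a + b + c)\<^sup>2 / 2" for a b c :: real
  proof (rule ccontr)
    assume "\<not> a > 0"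
    then have "b + c \<ge> a + b + c" by simp
    then have "(a + b + c)\<^sup>2 \<le> (b + c)\<^sup>2" using that by (intro power_mono) auto
    also have "\<dots> \<le> 2 * (b\<^sup>2 + c\<^sup>2)" using sum_squares_bound[of b c] by (simp add: power2_sum)
    also have "\<dots> \<le> 2 * (a\<^sup>2 + b\<^sup>2 + c\<^sup>2)" by simp
    finally show False using that by simp
  qed
  show "x > 0" using main[of x y z] assms by simp
  show "y > 0" using main[of y x z] assms by (simp add: algebra_simps)
  show "z > 0" using main[of z x y] assms by (simp add: algebra_simps)
qed

section \<open>Integrating out three coordinates\<close>

lemma space_PiM_lborel [simp]: "space (PiM J (\<lambda>_. lborel :: real measure)) = (J \<rightarrow>\<^sub>E UNIV)"
  by (simp add: space_PiM)

lemma sets_PiM_lborel_borel: "sets (PiM J (\<lambda>_. lborel :: real measure)) = sets (PiM J (\<lambda>_. borel))"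
  by (intro sets_PiM_cong) auto

lemma PiM_density_lborel:
  fixes f :: "real \<Rightarrow> real"
  assumes fin: "finite J" and [measurable]: "f \<in> borel_measurable borel" and pos: "\<And>x. f x \<ge> 0"
    and prob: "prob_space (density lborel f)"
  shows "PiM J (\<lambda>_. density lborel f) = density (PiM J (\<lambda>_. lborel)) (\<lambda>x. ennreal (\<Prod>i\<in>J. f (x i)))"
proof -
  interpret P: prob_space "density lborel f" by fact
  interpret pl: product_sigma_finite "\<lambda>_. lborel :: real measure" by unfold_locales
  interpret pd: product_sigma_finite "\<lambda>_. density lborel f" by unfold_locales
  show ?thesis
  proof (rule pd.PiM_eqI[OF fin, symmetric])
    show "sets (density (PiM J (\<lambda>_. lborel)) (\<lambda>x. ennreal (\<Prod>i\<in>J. f (x i)))) = sets (PiM J (\<lambda>_. density lborel f))"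
      unfolding sets_density by (intro sets_PiM_cong) auto
    fix A :: "'a \<Rightarrow> real set" assume A: "\<And>i. i \<in> J \<Longrightarrow> A i \<in> sets (density lborel f)"
    then have A': "\<And>i. i \<in> J \<Longrightarrow> A i \<in> sets borel" by simp
    have AA[measurable]: "Pi\<^sub>E J A \<in> sets (PiM J (\<lambda>_. lborel))"
      using A' fin by (intro sets_PiM_I_finite) auto
    have "emeasure (density (PiM J (\<lambda>_. lborel)) (\<lambda>x. ennreal (\<Prod>i\<in>J. f (x i)))) (Pi\<^sub>E J A) =
       (\<integral>\<^sup>+x. ennreal (\<Prod>i\<in>J. f (x i)) * indicator (Pi\<^sub>E J A) x \<partial>PiM J (\<lambda>_. lborel))"
      by (subst emeasure_density) auto
    also have "\<dots> = (\<integral>\<^sup>+x. (\<Prod>i\<in>J. ennreal (f (x i)) * indicator (A i) (x i)) \<partial>PiM J (\<lambda>_. lborel))"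
    proof (intro nn_integral_cong)
      fix x assume "x \<in> space (PiM J (\<lambda>_. lborel :: real measure))"
      then have ind: "indicator (Pi\<^sub>E J A) x = (\<Prod>i\<in>J. indicator (A i) (x i) :: ennreal)"
        using fin by (auto simp: indicator_def PiE_iff prod_zero_iff)
      show "ennreal (\<Prod>i\<in>J. f (x i)) * indicator (Pi\<^sub>E J A) x = (\<Prod>i\<in>J. ennreal (f (x i)) * indicator (A i) (x i))"
        unfolding ind prod.distrib by (simp add: prod_ennreal pos)
    qed
    also have "\<dots> = (\<Prod>i\<in>J. \<integral>\<^sup>+x. ennreal (f x) * indicator (A i) x \<partial>lborel)"
      using A' by (intro pl.product_nn_integral_prod[OF fin]) auto
    also have "\<dots> = (\<Prod>i\<in>J. emeasure (density lborel f) (A i))"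
      using A' by (intro prod.cong refl, subst emeasure_density) auto
    finally show "emeasure (density (PiM J (\<lambda>_. lborel)) (\<lambda>x. ennreal (\<Prod>i\<in>J. f (x i)))) (Pi\<^sub>E J A) =
      (\<Prod>i\<in>J. emeasure (density lborel f) (A i))" .
  qed
qed

lemma nn_integral_PiM_three:
  fixes i j k :: 'i
  assumes dist: "i \<noteq> j" "i \<noteq> k" "j \<noteq> k" and [measurable]: "F \<in> borel_measurable borel"
  shows "(\<integral>\<^sup>+x. F (x i, x j, x k) \<partial>PiM {i, j, k} (\<lambda>_. lborel :: real measure)) =
    (\<integral>\<^sup>+x. \<integral>\<^sup>+y. \<integral>\<^sup>+z. F (x, y, z) \<partial>lborel \<partial>lborel \<partial>lborel)"
proof -
  interpret pl: product_sigma_finite "\<lambda>_::'i. lborel :: real measure" by unfold_locales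
  have [measurable]: "F \<in> borel_measurable (borel \<Otimes>\<^sub>M borel \<Otimes>\<^sub>M borel)"
    using assms by (simp add: borel_prod)
  have "(\<integral>\<^sup>+x. F (x i, x j, x k) \<partial>PiM {i, j, k} (\<lambda>_. lborel :: real measure)) =
      (\<integral>\<^sup>+a. \<integral>\<^sup>+x. F (a, x j, x k) \<partial>PiM {j, k} (\<lambda>_. lborel) \<partial>lborel)"
    using dist by (subst pl.product_nn_integral_insert_rev) auto
  also have "\<dots> = (\<integral>\<^sup>+a. \<integral>\<^sup>+b. \<integral>\<^sup>+x. F (a, b, x k) \<partial>PiM {k} (\<lambda>_. lborel) \<partial>lborel \<partial>lborel)"
    using dist by (intro nn_integral_cong, subst pl.product_nn_integral_insert_rev) auto
  also have "\<dots> = (\<integral>\<^sup>+a. \<integral>\<^sup>+b. \<integral>\<^sup>+c. F (a, b, c) \<partial>lborel \<partial>lborel \<partial>lborel)"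
    by (intro nn_integral_cong, subst pl.product_nn_integral_singleton) auto
  finally show ?thesis .
qed

lemma three_indicator_measurable:
  assumes "T = {i, j, k}"
  shows "(\<lambda>t. indicator (circ_shell s q \<epsilon>) (t i, t j, t k) :: ennreal) \<in> borel_measurable (PiM T (\<lambda>_. lborel))"
proof -
  have [measurable]: "circ_shell s q \<epsilon> \<in> sets (borel \<Otimes>\<^sub>M borel \<Otimes>\<^sub>M borel)"
    unfolding borel_prod by measurable
  show ?thesis unfolding assms by measurable
qed

text \<open>Integrating out three coordinates of a shell around the intersection of a hyperplane and a
  sphere costs at most the volume of a thin shell around a circle, whatever the other coordinates.\<close>

lemma emeasure_shell_le:
  fixes T J :: "'i set"
  assumes T: "card T = 3" and J: "finite J" "T \<inter> J = {}" and \<epsilon>: "\<epsilon> > 0"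
    and S[measurable]: "S \<in> sets (PiM (T \<union> J) (\<lambda>_. lborel :: real measure))"
    and B[measurable]: "B \<in> sets (PiM J (\<lambda>_. lborel :: real measure))"
    and SB: "\<And>x. x \<in> S \<Longrightarrow> restrict x J \<in> B"
    and Ssum: "\<And>x. x \<in> S \<Longrightarrow> \<bar>(\<Sum>i\<in>T \<union> J. x i) - a\<bar> < \<epsilon>"
    and Ssq: "\<And>x. x \<in> S \<Longrightarrow> \<bar>(\<Sum>i\<in>T \<union> J. (x i)\<^sup>2) - c\<bar> < \<epsilon>"
  shows "emeasure (PiM (T \<union> J) (\<lambda>_. lborel)) S \<le>
    ennreal (circ_const * \<epsilon>\<^sup>2) * emeasure (PiM J (\<lambda>_. lborel)) B"
proof -
  interpret pl: product_sigma_finite "\<lambda>_::'i. lborel :: real measure" by unfold_locales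
  from T obtain i j k where ijk: "T = {i, j, k}" "i \<noteq> j" "i \<noteq> k" "j \<noteq> k"
    by (auto simp: card_3_iff)
  have fT: "finite T" using ijk by simp
  have "emeasure (PiM (T \<union> J) (\<lambda>_. lborel)) S = (\<integral>\<^sup>+x. indicator S x \<partial>PiM (J \<union> T) (\<lambda>_. lborel))"
    using S by (simp add: Un_commute)
  also have "\<dots> = (\<integral>\<^sup>+y. \<integral>\<^sup>+t. indicator S (merge J T (y, t)) \<partial>PiM T (\<lambda>_. lborel) \<partial>PiM J (\<lambda>_. lborel))"
    using J fT S by (intro pl.product_nn_integral_fold) (auto simp: Un_commute)
  also have "\<dots> \<le> (\<integral>\<^sup>+y. ennreal (circ_const * \<epsilon>\<^sup>2) * indicator B y \<partial>PiM J (\<lambda>_. lborel))"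
  proof (intro nn_integral_mono)
    fix y assume y: "y \<in> space (PiM J (\<lambda>_. lborel :: real measure))"
    have "(\<integral>\<^sup>+t. indicator S (merge J T (y, t)) \<partial>PiM T (\<lambda>_. lborel)) \<le>
      (\<integral>\<^sup>+t. indicator B y * indicator (circ_shell (a - (\<Sum>i\<in>J. y i)) (c - (\<Sum>i\<in>J. (y i)\<^sup>2)) \<epsilon>) (t i, t j, t k) \<partial>PiM T (\<lambda>_. lborel))"
    proof (rule nn_integral_mono)
      fix t assume t: "t \<in> space (PiM T (\<lambda>_. lborel :: real measure))"
      let ?x = "merge J T (y, t)"
      have r: "restrict ?x J = y" using y J(2) by (auto simp: fun_eq_iff merge_def PiE_iff extensional_def)
      have xT: "?x l = t l" if "l \<in> T" for l using that J(2) by (auto simp: merge_def)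
      have xJ: "?x l = y l" if "l \<in> J" for l using that J(2) by (auto simp: merge_def)
      have s: "(\<Sum>l\<in>T \<union> J. g (?x l)) = g (t i) + g (t j) + g (t k) + (\<Sum>l\<in>J. g (y l))" for g :: "real \<Rightarrow> real"
      proof -
        have "(\<Sum>l\<in>T \<union> J. g (?x l)) = (\<Sum>l\<in>T. g (t l)) + (\<Sum>l\<in>J. g (y l))"
          using J fT by (subst sum.union_disjoint) (auto simp: xT xJ)
        then show ?thesis using ijk by simp
      qed
      show "indicator S ?x \<le> indicator B y * (indicator (circ_shell (a - (\<Sum>i\<in>J. y i)) (c - (\<Sum>i\<in>J. (y i)\<^sup>2)) \<epsilon>) (t i, t j, t k) :: ennreal)"
      proof (cases "?x \<in> S")
        case True
        from SB[OF True] r have "y \<in> B" by simp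
        moreover have "(t i, t j, t k) \<in> circ_shell (a - (\<Sum>i\<in>J. y i)) (c - (\<Sum>i\<in>J. (y i)\<^sup>2)) \<epsilon>"
          using Ssum[OF True] Ssq[OF True] s[of "\<lambda>v. v"] s[of "\<lambda>v. v\<^sup>2"]
          by (simp add: circ_shell_def algebra_simps)
        ultimately show ?thesis using True by simp
      qed simp
    qed
    also have "\<dots> = indicator B y * (\<integral>\<^sup>+t. indicator (circ_shell (a - (\<Sum>i\<in>J. y i)) (c - (\<Sum>i\<in>J. (y i)\<^sup>2)) \<epsilon>) (t i, t j, t k) \<partial>PiM T (\<lambda>_. lborel))"
      using three_indicator_measurable[OF ijk(1)] by (intro nn_integral_cmult)
    also have "\<dots> \<le> indicator B y * ennreal (circ_const * \<epsilon>\<^sup>2)"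
      unfolding ijk(1)
      by (subst nn_integral_PiM_three[OF ijk(2-4)]) (auto intro!: mult_left_mono circ_shell_volume_le \<epsilon>)
    finally show "(\<integral>\<^sup>+t. indicator S (merge J T (y, t)) \<partial>PiM T (\<lambda>_. lborel)) \<le> ennreal (circ_const * \<epsilon>\<^sup>2) * indicator B y"
      by (simp add: mult.commute)
  qed
  also have "\<dots> = ennreal (circ_const * \<epsilon>\<^sup>2) * emeasure (PiM J (\<lambda>_. lborel)) B"
    by (rule nn_integral_cmult_indicator) measurable
  finally show ?thesis .
qed


text \<open>The matching lower bound: if for every \<open>y\<close> in \<open>G\<close> the circle left for the remaining three coordinates is
  nondegenerate and lies in the positive octant, then its whole shell is available.\<close>

lemma emeasure_shell_ge:
  fixes T J :: "'i set"
  assumes T: "card T = 3" and J: "finite J" "T \<inter> J = {}" and \<epsilon>: "\<epsilon> > 0"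
    and S[measurable]: "S \<in> sets (PiM (T \<union> J) (\<lambda>_. lborel :: real measure))"
    and G[measurable]: "G \<in> sets (PiM J (\<lambda>_. lborel :: real measure))"
    and S': "\<And>x. x \<in> (T \<union> J) \<rightarrow>\<^sub>E {0<..} \<Longrightarrow> \<bar>(\<Sum>i\<in>T \<union> J. x i) - a\<bar> < \<epsilon> \<Longrightarrow>
       \<bar>(\<Sum>i\<in>T \<union> J. (x i)\<^sup>2) - c\<bar> < \<epsilon> \<Longrightarrow> x \<in> S"
    and Gpos: "\<And>y i. y \<in> G \<Longrightarrow> i \<in> J \<Longrightarrow> y i > 0"
    and Gu: "\<And>y u. y \<in> G \<Longrightarrow> \<bar>u - (a - (\<Sum>i\<in>J. y i))\<bar> < \<epsilon> \<Longrightarrow>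
       u > 0 \<and> u\<^sup>2 / 3 + \<epsilon> \<le> c - (\<Sum>i\<in>J. (y i)\<^sup>2) \<and> c - (\<Sum>i\<in>J. (y i)\<^sup>2) + \<epsilon> \<le> u\<^sup>2 / 2"
  shows "ennreal (circ_const * \<epsilon>\<^sup>2) * emeasure (PiM J (\<lambda>_. lborel)) G \<le>
    emeasure (PiM (T \<union> J) (\<lambda>_. lborel)) S"
proof -
  interpret pl: product_sigma_finite "\<lambda>_::'i. lborel :: real measure" by unfold_locales
  from T obtain i j k where ijk: "T = {i, j, k}" "i \<noteq> j" "i \<noteq> k" "j \<noteq> k"
    by (auto simp: card_3_iff)
  have fT: "finite T" using ijk by simp
  have "ennreal (circ_const * \<epsilon>\<^sup>2) * emeasure (PiM J (\<lambda>_. lborel)) G =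
     (\<integral>\<^sup>+y. ennreal (circ_const * \<epsilon>\<^sup>2) * indicator G y \<partial>PiM J (\<lambda>_. lborel))"
    by (rule nn_integral_cmult_indicator[symmetric]) measurable
  also have "\<dots> \<le> (\<integral>\<^sup>+y. \<integral>\<^sup>+t. indicator S (merge J T (y, t)) \<partial>PiM T (\<lambda>_. lborel) \<partial>PiM J (\<lambda>_. lborel))"
  proof (intro nn_integral_mono)
    fix y assume y: "y \<in> space (PiM J (\<lambda>_. lborel :: real measure))"
    show "ennreal (circ_const * \<epsilon>\<^sup>2) * indicator G y \<le> (\<integral>\<^sup>+t. indicator S (merge J T (y, t)) \<partial>PiM T (\<lambda>_. lborel))"
    proof (cases "y \<in> G")
      case True
      have "q - u\<^sup>2 / 3 \<ge> \<epsilon>" if "\<bar>u - s\<bar> < \<epsilon>" "s = a - (\<Sum>i\<in>J. y i)" "q = c - (\<Sum>i\<in>J. (y i)\<^sup>2)" for u s q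
        using Gu[OF True, of u] that by auto
      then have "ennreal (circ_const * \<epsilon>\<^sup>2) =
        (\<integral>\<^sup>+t. indicator (circ_shell (a - (\<Sum>i\<in>J. y i)) (c - (\<Sum>i\<in>J. (y i)\<^sup>2)) \<epsilon>) (t i, t j, t k) \<partial>PiM T (\<lambda>_. lborel))"
        unfolding ijk(1)
        by (subst nn_integral_PiM_three[OF ijk(2-4)]) (auto intro!: circ_shell_volume_eq[symmetric] \<epsilon>)
      also have "\<dots> \<le> (\<integral>\<^sup>+t. indicator S (merge J T (y, t)) \<partial>PiM T (\<lambda>_. lborel))"
      proof (rule nn_integral_mono)
        fix t assume t: "t \<in> space (PiM T (\<lambda>_. lborel :: real measure))"
        let ?x = "merge J T (y, t)"
        have xT: "?x l = t l" if "l \<in> T" for l using that J(2) by (auto simp: merge_def)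
        have xJ: "?x l = y l" if "l \<in> J" for l using that J(2) by (auto simp: merge_def)
        have s: "(\<Sum>l\<in>T \<union> J. g (?x l)) = g (t i) + g (t j) + g (t k) + (\<Sum>l\<in>J. g (y l))" for g :: "real \<Rightarrow> real"
        proof -
          have "(\<Sum>l\<in>T \<union> J. g (?x l)) = (\<Sum>l\<in>T. g (t l)) + (\<Sum>l\<in>J. g (y l))"
            using J fT by (subst sum.union_disjoint) (auto simp: xT xJ)
          then show ?thesis using ijk by simp
        qed
        have "?x \<in> S" if *: "(t i, t j, t k) \<in> circ_shell (a - (\<Sum>i\<in>J. y i)) (c - (\<Sum>i\<in>J. (y i)\<^sup>2)) \<epsilon>"
        proof (rule S')
          let ?u = "t i + t j + t k"
          have u: "\<bar>?u - (a - (\<Sum>i\<in>J. y i))\<bar> < \<epsilon>"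
            and q: "\<bar>(t i)\<^sup>2 + (t j)\<^sup>2 + (t k)\<^sup>2 - (c - (\<Sum>i\<in>J. (y i)\<^sup>2))\<bar> < \<epsilon>"
            using * by (auto simp: circ_shell_def)
          have "?u > 0" "(t i)\<^sup>2 + (t j)\<^sup>2 + (t k)\<^sup>2 < ?u\<^sup>2 / 2"
            using Gu[OF True u] q by auto
          from circ_positive[OF this] have "\<forall>l\<in>T. t l > 0" unfolding ijk(1) by auto
          then show "?x \<in> (T \<union> J) \<rightarrow>\<^sub>E {0<..}"
            using Gpos[OF True] by (auto simp: xT xJ merge_def split: if_splits)
          show "\<bar>(\<Sum>i\<in>T \<union> J. ?x i) - a\<bar> < \<epsilon>" using u s[of "\<lambda>v. v"] by (simp add: algebra_simps)
          show "\<bar>(\<Sum>i\<in>T \<union> J. (?x i)\<^sup>2) - c\<bar> < \<epsilon>" using q s[of "\<lambda>v. v\<^sup>2"] by (simp add: algebra_simps)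
        qed
        then show "indicator (circ_shell (a - (\<Sum>i\<in>J. y i)) (c - (\<Sum>i\<in>J. (y i)\<^sup>2)) \<epsilon>) (t i, t j, t k) \<le> (indicator S ?x :: ennreal)"
          by (auto split: split_indicator)
      qed
      finally show ?thesis using True by simp
    qed simp
  qed
  also have "\<dots> = (\<integral>\<^sup>+x. indicator S x \<partial>PiM (J \<union> T) (\<lambda>_. lborel))"
    using J fT S by (intro pl.product_nn_integral_fold[symmetric]) (auto simp: Un_commute)
  also have "\<dots> = emeasure (PiM (T \<union> J) (\<lambda>_. lborel)) S"
    using S by (simp add: Un_commute)
  finally show ?thesis .
qed

section \<open>Independent exponential variables\<close>

text \<open>A sequence of independent exponential variables of mean 1, indexed from 1.\<close>

locale exp_sequence = prob_space Q for Q :: "'q measure" +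
  fixes Z :: "nat \<Rightarrow> 'q \<Rightarrow> real"
  assumes Z_indep: "indep_vars (\<lambda>_. borel) Z {1..}"
    and Z_exp: "\<And>i. i \<ge> 1 \<Longrightarrow> distributed Q lborel (Z i) (exponential_density 1)"
begin

lemma Z_measurable [measurable]: "i \<ge> 1 \<Longrightarrow> Z i \<in> borel_measurable Q"
  using Z_exp[of i] by (simp add: distributed_def)

lemma distr_Z: "i \<ge> 1 \<Longrightarrow> distr Q borel (Z i) = density lborel (exponential_density 1)"
  using distributed_distr_eq_density[OF Z_exp[of i]] by (simp cong: distr_cong)

lemma Z_restrict_measurable:
  assumes "J \<subseteq> {1..}" shows "(\<lambda>\<omega>. \<lambda>i\<in>J. Z i \<omega>) \<in> measurable Q (PiM J (\<lambda>_. borel))"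
  using assms by (intro measurable_restrict Z_measurable) auto

lemma distr_Z_restrict:
  assumes J: "finite J" "J \<noteq> {}" "J \<subseteq> {1..}"
  shows "distr Q (PiM J (\<lambda>_. borel)) (\<lambda>\<omega>. \<lambda>i\<in>J. Z i \<omega>) =
    density (PiM J (\<lambda>_. lborel)) (\<lambda>x. ennreal (\<Prod>i\<in>J. exponential_density 1 (x i)))"
proof -
  have "distr Q (PiM J (\<lambda>_. borel)) (\<lambda>\<omega>. \<lambda>i\<in>J. Z i \<omega>) = PiM J (\<lambda>i. distr Q borel (Z i))"
    using J by (subst indep_vars_iff_distr_eq_PiM'[symmetric])
      (auto intro!: indep_vars_subset[OF Z_indep])
  also have "\<dots> = PiM J (\<lambda>_. density lborel (exponential_density 1))"
    using J by (intro PiM_cong refl distr_Z) auto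
  also have "\<dots> = density (PiM J (\<lambda>_. lborel)) (\<lambda>x. ennreal (\<Prod>i\<in>J. exponential_density 1 (x i)))"
    by (intro PiM_density_lborel J prob_space_exponential_density) auto
  finally show ?thesis .
qed

lemma prob_Z_restrict:
  assumes J: "finite J" "J \<noteq> {}" "J \<subseteq> {1..}" and B: "B \<in> sets (PiM J (\<lambda>_. borel))"
  shows "ennreal (\<P>(\<omega> in Q. (\<lambda>i\<in>J. Z i \<omega>) \<in> B)) =
    (\<integral>\<^sup>+x. ennreal (\<Prod>i\<in>J. exponential_density 1 (x i)) * indicator B x \<partial>PiM J (\<lambda>_. lborel))"
proof -
  have "ennreal (\<P>(\<omega> in Q. (\<lambda>i\<in>J. Z i \<omega>) \<in> B)) =
     emeasure (distr Q (PiM J (\<lambda>_. borel)) (\<lambda>\<omega>. \<lambda>i\<in>J. Z i \<omega>)) B"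
    using B Z_restrict_measurable[OF J(3)]
    by (subst emeasure_distr) (auto simp: emeasure_eq_measure vimage_def Int_def conj_commute)
  also have "\<dots> = (\<integral>\<^sup>+x. ennreal (\<Prod>i\<in>J. exponential_density 1 (x i)) * indicator B x \<partial>PiM J (\<lambda>_. lborel))"
    unfolding distr_Z_restrict[OF J] using B by (subst emeasure_density) (auto simp: sets_PiM_lborel_borel)
  finally show ?thesis .
qed

text \<open>On the positive orthant the joint density of the exponential variables is the exponential of
  minus the sum, so that Lebesgue measure and probability compare as soon as the sum is controlled.\<close>

lemma emeasure_le_prob:
  assumes J: "finite J" "J \<noteq> {}" "J \<subseteq> {1..}" and B: "B \<in> sets (PiM J (\<lambda>_. borel))"
    and B': "\<And>y. y \<in> B \<Longrightarrow> (\<forall>i\<in>J. y i > 0) \<and> (\<Sum>i\<in>J. y i) \<le> t"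
  shows "emeasure (PiM J (\<lambda>_. lborel)) B \<le> ennreal (exp t * \<P>(\<omega> in Q. (\<lambda>i\<in>J. Z i \<omega>) \<in> B))"
proof -
  have B[measurable]: "B \<in> sets (PiM J (\<lambda>_. lborel))" using B by (simp add: sets_PiM_lborel_borel)
  have "emeasure (PiM J (\<lambda>_. lborel)) B = (\<integral>\<^sup>+x. indicator B x \<partial>PiM J (\<lambda>_. lborel))" by simp
  also have "\<dots> \<le> (\<integral>\<^sup>+x. ennreal (exp t) * (ennreal (\<Prod>i\<in>J. exponential_density 1 (x i)) * indicator B x) \<partial>PiM J (\<lambda>_. lborel))"
  proof (intro nn_integral_mono)
    fix x
    show "indicator B x \<le> ennreal (exp t) * (ennreal (\<Prod>i\<in>J. exponential_density 1 (x i)) * indicator B x)"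
    proof (cases "x \<in> B")
      case True
      have "(\<Prod>i\<in>J. exponential_density 1 (x i)) = (\<Prod>i\<in>J. exp (- x i))"
        using B'[OF True] by (intro prod.cong refl) (auto simp: exponential_density_def not_less less_imp_le)
      also have "\<dots> = exp (- (\<Sum>i\<in>J. x i))" using J by (simp add: exp_sum[symmetric] sum_negf)
      finally have "exp t * (\<Prod>i\<in>J. exponential_density 1 (x i)) = exp (t - (\<Sum>i\<in>J. x i))"
        by (simp add: mult_exp_exp)
      also have "\<dots> \<ge> 1" using B'[OF True] by simp
      finally show ?thesis using True by (simp add: ennreal_mult'[symmetric])
    qed simp
  qed
  also have "\<dots> = ennreal (exp t * \<P>(\<omega> in Q. (\<lambda>i\<in>J. Z i \<omega>) \<in> B))"
    using B by (subst nn_integral_cmult) (auto simp: prob_Z_restrict[OF J assms(4), symmetric] ennreal_mult')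
  finally show ?thesis .
qed

lemma emeasure_ge_prob:
  assumes J: "finite J" "J \<noteq> {}" "J \<subseteq> {1..}" and B: "B \<in> sets (PiM J (\<lambda>_. borel))"
    and B': "\<And>y. y \<in> B \<Longrightarrow> t \<le> (\<Sum>i\<in>J. y i)"
  shows "ennreal (exp t * \<P>(\<omega> in Q. (\<lambda>i\<in>J. Z i \<omega>) \<in> B)) \<le> emeasure (PiM J (\<lambda>_. lborel)) B"
proof -
  have B[measurable]: "B \<in> sets (PiM J (\<lambda>_. lborel))" using B by (simp add: sets_PiM_lborel_borel)
  have "ennreal (exp t * \<P>(\<omega> in Q. (\<lambda>i\<in>J. Z i \<omega>) \<in> B)) =
    (\<integral>\<^sup>+x. ennreal (exp t) * (ennreal (\<Prod>i\<in>J. exponential_density 1 (x i)) * indicator B x) \<partial>PiM J (\<lambda>_. lborel))"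
    using B by (subst nn_integral_cmult) (auto simp: prob_Z_restrict[OF J assms(4), symmetric] ennreal_mult')
  also have "\<dots> \<le> (\<integral>\<^sup>+x. indicator B x \<partial>PiM J (\<lambda>_. lborel))"
  proof (intro nn_integral_mono)
    fix x
    show "ennreal (exp t) * (ennreal (\<Prod>i\<in>J. exponential_density 1 (x i)) * indicator B x) \<le> indicator B x"
    proof (cases "x \<in> B")
      case True
      have "(\<Prod>i\<in>J. exponential_density 1 (x i)) \<le> (\<Prod>i\<in>J. exp (- x i))"
        by (intro prod_mono) (auto simp: exponential_density_def)
      also have "\<dots> = exp (- (\<Sum>i\<in>J. x i))" using J by (simp add: exp_sum[symmetric] sum_negf)
      finally have "exp t * (\<Prod>i\<in>J. exponential_density 1 (x i)) \<le> exp t * exp (- (\<Sum>i\<in>J. x i))"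
        by simp
      also have "\<dots> = exp (t - (\<Sum>i\<in>J. x i))" by (simp add: mult_exp_exp)
      also have "\<dots> \<le> 1" using B'[OF True] by simp
      finally show ?thesis using True by (simp add: ennreal_mult'[symmetric])
    qed simp
  qed
  also have "\<dots> = emeasure (PiM J (\<lambda>_. lborel)) B" by simp
  finally show ?thesis .
qed

end

section \<open>Volumes of thin shells\<close>

lemma K_shell_eq:
  "K_shell n b \<epsilon> = {x \<in> space (borel_n n). (\<forall>i\<in>{1..n}. 0 < x i) \<and>
     \<bar>(\<Sum>i=1..n. x i) - real n\<bar> < \<epsilon> \<and> \<bar>(\<Sum>i=1..n. (x i)\<^sup>2) - real n * b\<bar> < \<epsilon>}"
  by (auto simp: K_shell_def space_PiM PiE_iff)

lemma K_shell_measurable [measurable]: "K_shell n b \<epsilon> \<in> sets (borel_n n)"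
  unfolding K_shell_eq by measurable

context exp_sequence
begin

text \<open>Any point of a thin shell has at least three coordinates that are at most 2, because its
  coordinates have average about 1. Integrating these out leaves an event about independent
  exponential variables.\<close>

lemma emeasure_K_shell_le:
  assumes n: "n \<ge> 7" and \<epsilon>: "0 < \<epsilon>" "\<epsilon> \<le> 1"
    and A: "A \<in> sets (borel_n n)"
    and B: "\<And>T. T \<subseteq> {1..n} \<Longrightarrow> card T = 3 \<Longrightarrow> B T \<in> sets (PiM ({1..n} - T) (\<lambda>_. borel))"
    and AB: "\<And>x T. x \<in> K_shell n b \<epsilon> \<Longrightarrow> x \<in> A \<Longrightarrow> T \<subseteq> {1..n} \<Longrightarrow> card T = 3 \<Longrightarrow> (\<And>i. i \<in> T \<Longrightarrow> x i \<le> 2)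
       \<Longrightarrow> restrict x ({1..n} - T) \<in> B T"
    and p: "\<And>T. T \<subseteq> {1..n} \<Longrightarrow> card T = 3 \<Longrightarrow>
       \<P>(\<omega> in Q. (\<lambda>i\<in>{1..n} - T. Z i \<omega>) \<in> B T) \<le> p"
  shows "emeasure (lborel_n n) (K_shell n b \<epsilon> \<inter> A) \<le>
    ennreal (circ_const * \<epsilon>\<^sup>2 * (real n ^ 3 * (exp (real n + 1) * p)))"
proof -
  define TT where "TT = {T. T \<subseteq> {1..n} \<and> card T = 3}"
  have finTT: "finite TT" unfolding TT_def by (rule finite_subset[of _ "Pow {1..n}"]) auto
  have cardTT: "real (card TT) \<le> real n ^ 3"
  proof -
    have "card TT = n choose 3" unfolding TT_def using n_subsets[of "{1..n}" 3] by simp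
    also have "\<dots> \<le> n ^ 3" using n by (intro binomial_le_pow) auto
    finally show ?thesis by (metis of_nat_le_iff of_nat_power)
  qed
  have TTD: "T \<subseteq> {1..n}" "card T = 3" if "T \<in> TT" for T using that by (auto simp: TT_def)
  have "{1..3} \<in> TT" using n by (auto simp: TT_def)
  then have p0: "p \<ge> 0" using p[OF TTD] measure_nonneg order_trans by blast
  \<comment> \<open>The choice of the three small coordinates costs only the polynomial factor \<open>card TT \<le> n\<^sup>3\<close>.\<close>
  define S where "S T = {x \<in> K_shell n b \<epsilon> \<inter> A. \<forall>i\<in>T. x i \<le> 2}" for T
  have S_meas: "S T \<in> sets (lborel_n n)" if "T \<in> TT" for T
  proof -
    have *: "i \<in> {1..n}" if "i \<in> T" for i using TTD[OF \<open>T \<in> TT\<close>] that by auto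
    have "S T = {x \<in> space (borel_n n). x \<in> K_shell n b \<epsilon> \<and> x \<in> A \<and> (\<forall>i\<in>T. x i \<le> 2)}"
      unfolding S_def using sets.sets_into_space[OF A] by auto
    also have "\<dots> \<in> sets (borel_n n)"
      using A finite_subset[OF TTD(1)[OF that]] * by measurable
    finally show ?thesis by (simp add: sets_PiM_lborel_borel)
  qed
  have cover: "K_shell n b \<epsilon> \<inter> A \<subseteq> (\<Union>T\<in>TT. S T)"
  proof
    fix x assume x: "x \<in> K_shell n b \<epsilon> \<inter> A"
    then have xpos: "\<And>i. i \<in> {1..n} \<Longrightarrow> x i > 0" and xs: "(\<Sum>i=1..n. x i) < real n + 1"
      using \<epsilon> by (auto simp: K_shell_def PiE_iff)
    define L where "L = {i \<in> {1..n}. x i > 2}"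
    have "2 * real (card L) = (\<Sum>i\<in>L. 2)" by simp
    also have "\<dots> \<le> (\<Sum>i\<in>L. x i)" by (intro sum_mono) (auto simp: L_def)
    also have "\<dots> \<le> (\<Sum>i=1..n. x i)"
      using xpos by (intro sum_mono2) (auto simp: L_def less_imp_le)
    finally have "2 * card L < n + 1" using xs by linarith
    moreover have "card ({1..n} - L) = n - card L"
      by (subst card_Diff_subset) (auto simp: L_def)
    ultimately have "3 \<le> card ({1..n} - L)" using n by linarith
    then obtain T where T: "T \<subseteq> {1..n} - L" "card T = 3" by (meson obtain_subset_with_card_n)
    then have "T \<in> TT" by (auto simp: TT_def)
    moreover have "x \<in> S T" using x T by (auto simp: S_def L_def)
    ultimately show "x \<in> (\<Union>T\<in>TT. S T)" by blast
  qed
  have S_le: "emeasure (lborel_n n) (S T) \<le> ennreal (circ_const * \<epsilon>\<^sup>2 * (exp (real n + 1) * p))" if T: "T \<in> TT" for T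
  proof -
    define J where "J = {1..n} - T"
    have fT: "finite T" using TTD(2)[OF T] by (intro card_ge_0_finite) auto
    have TJ: "T \<union> J = {1..n}" "T \<inter> J = {}" using TTD[OF T] by (auto simp: J_def)
    have "card J = n - 3" unfolding J_def using TTD[OF T] fT by (subst card_Diff_subset) auto
    then have "J \<noteq> {}" using n by force
    then have J: "finite J" "J \<noteq> {}" "J \<subseteq> {1..}" by (auto simp: J_def)
    note BT = B[OF TTD[OF T], folded J_def]
    define B' where "B' = {y \<in> space (PiM J (\<lambda>_. borel)). y \<in> B T \<and> (\<forall>i\<in>J. y i > 0) \<and> (\<Sum>i\<in>J. y i) \<le> real n + 1}"
    have B': "B' \<in> sets (PiM J (\<lambda>_. borel))" unfolding B'_def using BT J by measurable
    have "emeasure (lborel_n n) (S T) = emeasure (PiM (T \<union> J) (\<lambda>_. lborel)) (S T)" by (simp add: TJ)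
    also have "\<dots> \<le> ennreal (circ_const * \<epsilon>\<^sup>2) * emeasure (PiM J (\<lambda>_. lborel)) B'"
    proof (rule emeasure_shell_le)
      show "S T \<in> sets (Pi\<^sub>M (T \<union> J) (\<lambda>_. lborel))" using S_meas[OF T] by (simp add: TJ)
      show "B' \<in> sets (Pi\<^sub>M J (\<lambda>_. lborel))" using B' by (simp add: sets_PiM_lborel_borel)
      fix x assume x: "x \<in> S T"
      then have xK: "x \<in> K_shell n b \<epsilon>" and xA: "x \<in> A" and x2: "\<And>i. i \<in> T \<Longrightarrow> x i \<le> 2"
        by (auto simp: S_def)
      have xpos: "\<And>i. i \<in> {1..n} \<Longrightarrow> x i > 0"
        using xK by (auto simp: K_shell_def PiE_iff)
      show "\<bar>(\<Sum>i\<in>T \<union> J. x i) - real n\<bar> < \<epsilon>" "\<bar>(\<Sum>i\<in>T \<union> J. (x i)\<^sup>2) - real n * b\<bar> < \<epsilon>"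
        using xK by (auto simp: K_shell_def TJ)
      have "(\<Sum>i\<in>J. x i) \<le> (\<Sum>i=1..n. x i)"
        using xpos by (intro sum_mono2) (auto simp: J_def less_imp_le)
      also have "\<dots> \<le> real n + 1" using xK \<epsilon> by (auto simp: K_shell_def)
      finally have "(\<Sum>i\<in>J. x i) \<le> real n + 1" .
      moreover have "restrict x J \<in> B T" unfolding J_def by (rule AB[OF xK xA TTD[OF T] x2])
      ultimately show "restrict x J \<in> B'" using xpos sets.sets_into_space[OF BT]
        by (auto simp: B'_def J_def)
    qed (use TTD[OF T] J TJ \<epsilon> in auto)
    also have "\<dots> \<le> ennreal (circ_const * \<epsilon>\<^sup>2) * ennreal (exp (real n + 1) * \<P>(\<omega> in Q. (\<lambda>i\<in>J. Z i \<omega>) \<in> B'))"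
      by (intro mult_left_mono emeasure_le_prob J B') (auto simp: B'_def)
    also have "\<dots> \<le> ennreal (circ_const * \<epsilon>\<^sup>2) * ennreal (exp (real n + 1) * p)"
    proof (intro mult_left_mono ennreal_leI)
      have ev: "{\<omega> \<in> space Q. (\<lambda>i\<in>J. Z i \<omega>) \<in> B T} \<in> events"
        using measurable_sets[OF Z_restrict_measurable[OF J(3)] BT] by (simp add: vimage_def Int_def conj_commute)
      have "\<P>(\<omega> in Q. (\<lambda>i\<in>J. Z i \<omega>) \<in> B') \<le> \<P>(\<omega> in Q. (\<lambda>i\<in>J. Z i \<omega>) \<in> B T)"
        by (rule finite_measure_mono[OF _ ev]) (auto simp: B'_def)
      also have "\<dots> \<le> p" unfolding J_def by (rule p[OF TTD[OF T]])
      finally show "\<P>(\<omega> in Q. (\<lambda>i\<in>J. Z i \<omega>) \<in> B') \<le> p" .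
    qed auto
    finally show ?thesis using circ_const_pos p0 by (simp add: ennreal_mult)
  qed
  have "emeasure (lborel_n n) (K_shell n b \<epsilon> \<inter> A) \<le> emeasure (lborel_n n) (\<Union>T\<in>TT. S T)"
    using cover S_meas finTT by (intro emeasure_mono) auto
  also have "\<dots> \<le> (\<Sum>T\<in>TT. emeasure (lborel_n n) (S T))"
    using S_meas finTT by (intro emeasure_subadditive_finite) auto
  also have "\<dots> \<le> (\<Sum>T\<in>TT. ennreal (circ_const * \<epsilon>\<^sup>2 * (exp (real n + 1) * p)))"
    by (intro sum_mono S_le)
  also have "\<dots> = ennreal (real (card TT) * (circ_const * \<epsilon>\<^sup>2 * (exp (real n + 1) * p)))"
    using circ_const_pos p0 by (simp add: ennreal_mult ennreal_of_nat_eq_real_of_nat)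
  also have "\<dots> \<le> ennreal (real n ^ 3 * (circ_const * \<epsilon>\<^sup>2 * (exp (real n + 1) * p)))"
    using circ_const_pos p0 by (intro ennreal_leI mult_right_mono cardTT) auto
  finally show ?thesis by (simp add: mult_ac)
qed

end

text \<open>The configurations of all coordinates but three that leave, for the remaining three, a circle
  which is contained in the positive octant: the missing sum \<open>s\<close> and the missing square sum \<open>q\<close>
  satisfy \<open>s\<^sup>2/3 < q < s\<^sup>2/2\<close> with room to spare, while \<open>s\<close> is only of order \<open>\<delta>\<surd>n\<close>.\<close>

definition good_set :: "nat \<Rightarrow> real \<Rightarrow> real \<Rightarrow> (nat \<Rightarrow> real) set" where
  "good_set n b \<delta> = {y \<in> space (PiM {4..n} (\<lambda>_. borel)). (\<forall>i\<in>{4..n}. 0 < y i) \<and>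
     (\<Sum>i\<in>{4..n}. y i) \<in> {real n - 1.1 * \<delta> * sqrt n .. real n - \<delta> * sqrt n} \<and>
     (\<Sum>i\<in>{4..n}. (y i)\<^sup>2) \<in> {real n * b - 0.48 * \<delta>\<^sup>2 * n .. real n * b - 0.42 * \<delta>\<^sup>2 * n}}"

lemma good_set_measurable [measurable]: "good_set n b \<delta> \<in> sets (PiM {4..n} (\<lambda>_. borel))"
  unfolding good_set_def by measurable

text \<open>With \<open>t = \<delta>\<surd>n\<close>, the window \<open>0.42 t\<^sup>2 \<le> q \<le> 0.48 t\<^sup>2\<close> lies strictly between \<open>s\<^sup>2/3 \<le> 1.21 t\<^sup>2/3 < 0.404 t\<^sup>2\<close> and
  \<open>s\<^sup>2/2 \<ge> t\<^sup>2/2\<close>, which leaves room for errors of order \<open>t\<close>.\<close>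

lemma good_window:
  fixes t s q u \<epsilon> :: real
  assumes t: "t \<ge> 100" and \<epsilon>: "0 < \<epsilon>" "\<epsilon> \<le> 1" and s: "t \<le> s" "s \<le> 1.1 * t"
    and q: "0.42 * t\<^sup>2 \<le> q" "q \<le> 0.48 * t\<^sup>2" and u: "\<bar>u - s\<bar> < \<epsilon>"
  shows "u > 0 \<and> u\<^sup>2 / 3 + \<epsilon> \<le> q \<and> q + \<epsilon> \<le> u\<^sup>2 / 2"
proof -
  have u1: "t - 1 \<le> u" "u \<le> 1.1 * t + 1" using u s \<epsilon> by (auto simp: abs_less_iff)
  have "u\<^sup>2 \<le> (1.1 * t + 1)\<^sup>2" using u1 t by (intro power_mono) auto
  also have "\<dots> = 1.21 * t\<^sup>2 + 2.2 * t + 1" by (simp add: power2_eq_square algebra_simps)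
  finally have a: "u\<^sup>2 \<le> 1.21 * t\<^sup>2 + 2.2 * t + 1" .
  have "(t - 1)\<^sup>2 \<le> u\<^sup>2" using u1 t by (intro power_mono) auto
  then have c: "t\<^sup>2 - 2 * t + 1 \<le> u\<^sup>2" by (simp add: power2_eq_square algebra_simps)
  have tt: "t\<^sup>2 \<ge> 100 * t" using t by (simp add: power2_eq_square)
  show ?thesis using a c tt t u1 q \<epsilon> by auto
qed

context exp_sequence
begin

lemma emeasure_K_shell_ge:
  assumes n: "n \<ge> 4" and t: "\<delta> * sqrt n \<ge> 100" and \<epsilon>: "0 < \<epsilon>" "\<epsilon> \<le> 1"
  shows "ennreal (circ_const * \<epsilon>\<^sup>2 * (exp (real n - 1.1 * \<delta> * sqrt n) *
      \<P>(\<omega> in Q. (\<lambda>i\<in>{4..n}. Z i \<omega>) \<in> good_set n b \<delta>))) \<le> emeasure (lborel_n n) (K_shell n b \<epsilon>)"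
proof -
  have I: "{1,2,3} \<union> {4..n} = {1..n}" using n by auto
  have "ennreal (circ_const * \<epsilon>\<^sup>2 * (exp (real n - 1.1 * \<delta> * sqrt n) *
      \<P>(\<omega> in Q. (\<lambda>i\<in>{4..n}. Z i \<omega>) \<in> good_set n b \<delta>))) =
    ennreal (circ_const * \<epsilon>\<^sup>2) * ennreal (exp (real n - 1.1 * \<delta> * sqrt n) *
      \<P>(\<omega> in Q. (\<lambda>i\<in>{4..n}. Z i \<omega>) \<in> good_set n b \<delta>))"
    using circ_const_pos by (intro ennreal_mult) auto
  also have "\<dots> \<le> ennreal (circ_const * \<epsilon>\<^sup>2) * emeasure (PiM {4..n} (\<lambda>_. lborel)) (good_set n b \<delta>)"
    using n by (intro mult_left_mono emeasure_ge_prob) (auto simp: good_set_def)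
  also have "\<dots> \<le> emeasure (PiM ({1,2,3} \<union> {4..n}) (\<lambda>_. lborel)) (K_shell n b \<epsilon>)"
  proof (rule emeasure_shell_ge[where a="real n" and c="real n * b"])
    show "K_shell n b \<epsilon> \<in> sets (Pi\<^sub>M ({1, 2, 3} \<union> {4..n}) (\<lambda>_. lborel))"
      unfolding I sets_PiM_lborel_borel by (rule K_shell_measurable)
    show "good_set n b \<delta> \<in> sets (Pi\<^sub>M {4..n} (\<lambda>_. lborel))"
      by (simp add: sets_PiM_lborel_borel)
    show "x \<in> K_shell n b \<epsilon>" if "x \<in> {1, 2, 3} \<union> {4..n} \<rightarrow>\<^sub>E {0<..}"
      "\<bar>(\<Sum>i\<in>{1, 2, 3} \<union> {4..n}. x i) - real n\<bar> < \<epsilon>" "\<bar>(\<Sum>i\<in>{1, 2, 3} \<union> {4..n}. (x i)\<^sup>2) - real n * b\<bar> < \<epsilon>" for x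
      using that unfolding I K_shell_def by auto
    show "y i > 0" if "y \<in> good_set n b \<delta>" "i \<in> {4..n}" for y i using that by (auto simp: good_set_def)
    fix y u assume y: "y \<in> good_set n b \<delta>" and u: "\<bar>u - (real n - (\<Sum>i\<in>{4..n}. y i))\<bar> < \<epsilon>"
    have sq: "(\<delta> * sqrt n)\<^sup>2 = \<delta>\<^sup>2 * n" by (simp add: power_mult_distrib)
    show "u > 0 \<and> u\<^sup>2 / 3 + \<epsilon> \<le> real n * b - (\<Sum>i\<in>{4..n}. (y i)\<^sup>2) \<and> real n * b - (\<Sum>i\<in>{4..n}. (y i)\<^sup>2) + \<epsilon> \<le> u\<^sup>2 / 2"
      by (rule good_window[OF t \<epsilon> _ _ _ _ u]) (use y in \<open>auto simp: good_set_def sq\<close>)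
  qed (use \<epsilon> in auto)
  finally show ?thesis unfolding I .
qed

end

section \<open>The probability of good configurations\<close>

lemma (in prob_space) second_moment_sum_indep:
  fixes Y :: "'i \<Rightarrow> 'a \<Rightarrow> real"
  assumes "finite I" and "indep_vars (\<lambda>_. borel) Y I"
    and "\<And>i. i \<in> I \<Longrightarrow> integrable M (\<lambda>x. (Y i x)\<^sup>2)"
    and "\<And>i. i \<in> I \<Longrightarrow> expectation (Y i) = 0"
    and "\<And>i. i \<in> I \<Longrightarrow> expectation (\<lambda>x. (Y i x)\<^sup>2) = v"
  shows "integrable M (\<lambda>x. (\<Sum>i\<in>I. Y i x)\<^sup>2) \<and> expectation (\<lambda>x. (\<Sum>i\<in>I. Y i x)\<^sup>2) = real (card I) * v"
  using assms
proof (induction I)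
  case (insert i I)
  let ?S = "\<lambda>x. \<Sum>i\<in>I. Y i x"
  have meas: "random_variable borel (Y j)" if "j \<in> insert i I" for j
    using insert.prems(1) that by (auto simp: indep_vars_def)
  have IH: "integrable M (\<lambda>x. (?S x)\<^sup>2)" "expectation (\<lambda>x. (?S x)\<^sup>2) = real (card I) * v"
    using insert.IH indep_vars_subset[OF insert.prems(1), of I] insert.prems by auto
  have int: "integrable M (Y j)" if "j \<in> insert i I" for j
    by (rule square_integrable_imp_integrable) (use that meas insert.prems in auto)
  have intS: "integrable M ?S" using int by auto
  have ind: "indep_var borel (Y i) borel ?S"
    by (rule indep_vars_sum) (use insert in auto)
  have prod: "integrable M (\<lambda>x. Y i x * ?S x)" "expectation (\<lambda>x. Y i x * ?S x) = 0"
    using indep_var_integrable[OF ind int intS] indep_var_lebesgue_integral[OF ind int intS] insert.prems(3)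
    by auto
  have eq: "(\<lambda>x. (\<Sum>i\<in>insert i I. Y i x)\<^sup>2) = (\<lambda>x. ((Y i x)\<^sup>2 + 2 * (Y i x * ?S x)) + (?S x)\<^sup>2)"
    using insert.hyps by (auto simp: power2_eq_square algebra_simps)
  have int1: "integrable M (\<lambda>x. (Y i x)\<^sup>2)" using insert.prems by auto
  have "expectation (\<lambda>x. ((Y i x)\<^sup>2 + 2 * (Y i x * ?S x)) + (?S x)\<^sup>2) =
     expectation (\<lambda>x. (Y i x)\<^sup>2) + 2 * expectation (\<lambda>x. Y i x * ?S x) + expectation (\<lambda>x. (?S x)\<^sup>2)"
    using int1 prod(1) IH(1) by simp
  also have "\<dots> = real (card (insert i I)) * v"
    using insert.prems(4)[of i] prod IH insert.hyps by (simp add: algebra_simps)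
  finally show ?case unfolding eq using int1 prod(1) IH(1) by simp
qed simp

lemma std_normal_interval_pos:
  assumes "\<alpha> < \<beta>" shows "cdf std_normal_distribution \<beta> - cdf std_normal_distribution \<alpha> > 0"
proof -
  interpret N: real_distribution std_normal_distribution by (rule real_dist_normal_dist)
  have eq: "cdf std_normal_distribution \<beta> - cdf std_normal_distribution \<alpha> = measure std_normal_distribution {\<alpha><..\<beta>}"
    using assms by (rule N.cdf_diff_eq)
  have "emeasure std_normal_distribution {\<alpha><..\<beta>} \<noteq> 0"
  proof
    assume "emeasure std_normal_distribution {\<alpha><..\<beta>} = 0"
    then have "(\<integral>\<^sup>+x. ennreal (std_normal_density x) * indicator {\<alpha><..\<beta>} x \<partial>lborel) = 0"
      by (subst (asm) emeasure_density) auto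
    then have "AE x in lborel. ennreal (std_normal_density x) * indicator {\<alpha><..\<beta>} x = 0"
      by (subst (asm) nn_integral_0_iff_AE) auto
    then have "AE x in lborel. x \<notin> {\<alpha><..\<beta>}"
    proof (rule AE_mp, intro AE_I2 impI)
      fix x assume *: "ennreal (std_normal_density x) * indicator {\<alpha><..\<beta>} x = 0"
      have "std_normal_density x > 0" by (rule normal_density_pos) simp
      then show "x \<notin> {\<alpha><..\<beta>}" using * by (auto simp: ennreal_eq_0_iff split: split_indicator_asm)
    qed
    then have "emeasure lborel {\<alpha><..\<beta>} = 0"
      by (subst (asm) AE_iff_measurable[of "{\<alpha><..\<beta>}"]) auto
    then show False using assms by simp
  qed
  then have "measure std_normal_distribution {\<alpha><..\<beta>} \<noteq> 0"
    by (simp add: N.emeasure_eq_measure)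
  then show ?thesis unfolding eq using measure_nonneg[of std_normal_distribution "{\<alpha><..\<beta>}"] by linarith
qed

lemma std_normal_isCont_cdf: "isCont (cdf std_normal_distribution) x"
proof -
  interpret N: real_distribution std_normal_distribution by (rule real_dist_normal_dist)
  have "emeasure std_normal_distribution {x} = (\<integral>\<^sup>+y. ennreal (std_normal_density y) * indicator {x} y \<partial>lborel)"
    by (rule emeasure_density) auto
  also have "\<dots> = 0"
    by (subst nn_integral_0_iff_AE) (auto intro: AE_mp[OF AE_lborel_singleton[of x]])
  finally show ?thesis unfolding N.isCont_cdf by (simp add: measure_def)
qed

context exp_sequence
begin

lemma Z_moment:
  assumes "i \<ge> 1"
  shows "integrable Q (\<lambda>\<omega>. Z i \<omega> ^ k)" "expectation (\<lambda>\<omega>. Z i \<omega> ^ k) = fact k"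
  using erlang_ith_moment_integrable[OF _ Z_exp[OF assms], of k] erlang_ith_moment[OF _ Z_exp[OF assms], of k]
  by auto

lemma Z_pos_AE: assumes "i \<ge> 1" shows "AE \<omega> in Q. Z i \<omega> > 0"
proof -
  have "\<P>(\<omega> in Q. 0 < Z i \<omega>) = 1"
    using exponential_distributedD_gt[OF Z_exp[OF assms], of 0] by simp
  moreover have "{\<omega> \<in> space Q. 0 < Z i \<omega>} \<in> events" using Z_measurable[OF assms] by measurable
  ultimately show ?thesis using AE_prob_1[of "{\<omega> \<in> space Q. 0 < Z i \<omega>}"] by (auto elim: AE_mp)
qed

lemma prob_Z_gt: "i \<ge> 1 \<Longrightarrow> a \<ge> 0 \<Longrightarrow> \<P>(\<omega> in Q. a < Z i \<omega>) = exp (- a)"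
  using exponential_distributedD_gt[OF Z_exp[of i], of a] by simp

lemma Z_shift_indep:
  assumes "\<And>i. i \<in> I \<Longrightarrow> i + m \<ge> 1"
  shows "indep_vars (\<lambda>_. borel) (\<lambda>i. Z (i + m)) I"
proof -
  have "indep_vars (\<lambda>j. PiM {j + m} (\<lambda>_. borel)) (\<lambda>j \<omega>. restrict (\<lambda>i. Z i \<omega>) {j + m}) I"
    by (rule indep_vars_restrict[OF Z_indep]) (use assms in \<open>auto simp: disjoint_family_on_def\<close>)
  from indep_vars_compose2[OF this, of "\<lambda>j x. x (j + m)" "\<lambda>_. borel"]
  show ?thesis by simp
qed

text \<open>The variables \<open>Z\<^sub>1, Z\<^sub>2, Z\<^sub>3\<close> are integrated out and \<open>Z\<^sub>4\<close> will be the large coordinate; the law of large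
  numbers for the squares and the central limit theorem are applied to the variables from \<open>Z\<^sub>5\<close> on.\<close>

lemma sum_square_concentration:
  assumes "a > 0"
  shows "(\<lambda>N. \<P>(\<omega> in Q. \<bar>(\<Sum>i<N. (Z (i + 5) \<omega>)\<^sup>2) - 2 * real N\<bar> \<ge> a * real N)) \<longlonglongrightarrow> 0"
proof (rule tendsto_sandwich[of "\<lambda>_. 0" _ _ "\<lambda>N. 20 / (a\<^sup>2 * real N)"])
  define Y where "Y i \<omega> = (Z (i + 5) \<omega>)\<^sup>2 - 2" for i \<omega>
  have indY: "indep_vars (\<lambda>_. borel) Y {..<N}" for N :: nat
    unfolding Y_def by (rule indep_vars_subset[OF indep_vars_compose2[OF Z_shift_indep[where I = UNIV]]]) auto
  have [measurable]: "Y i \<in> borel_measurable Q" for i unfolding Y_def by measurable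
  have Y2: "(Y i \<omega>)\<^sup>2 = Z (i + 5) \<omega> ^ 4 - 4 * Z (i + 5) \<omega> ^ 2 + 4" for i \<omega>
    unfolding Y_def by (simp add: power2_eq_square power4_eq_xxxx algebra_simps)
  have intY: "integrable Q (\<lambda>\<omega>. (Y i \<omega>)\<^sup>2)" for i
    unfolding Y2 using Z_moment(1)[of "i+5" 4] Z_moment(1)[of "i+5" 2] by auto
  have EY: "expectation (Y i) = 0" for i
    unfolding Y_def using Z_moment[of "i+5" 2] by (simp add: prob_space)
  have EY2: "expectation (\<lambda>\<omega>. (Y i \<omega>)\<^sup>2) = 20" for i
    unfolding Y2 using Z_moment[of "i+5" 2] Z_moment[of "i+5" 4]
    by (simp add: prob_space fact_numeral)
  show "\<forall>\<^sub>F N in sequentially. \<P>(\<omega> in Q. \<bar>(\<Sum>i<N. (Z (i + 5) \<omega>)\<^sup>2) - 2 * real N\<bar> \<ge> a * real N)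
     \<le> 20 / (a\<^sup>2 * real N)"
    using eventually_gt_at_top[of 0]
  proof eventually_elim
    fix N :: nat assume N: "N > 0"
    let ?S = "\<lambda>\<omega>. \<Sum>i<N. Y i \<omega>"
    have *: "integrable Q (\<lambda>\<omega>. (?S \<omega>)\<^sup>2) \<and> expectation (\<lambda>\<omega>. (?S \<omega>)\<^sup>2) = real (card {..<N}) * 20"
      by (rule second_moment_sum_indep) (auto simp: indY intY EY EY2)
    have sq: "(a * real N \<le> \<bar>s\<bar>) = ((a * real N)\<^sup>2 \<le> s\<^sup>2)" for s
      using assms N by (metis abs_ge_zero abs_le_square_iff abs_of_nonneg mult_nonneg_nonneg less_imp_le of_nat_0_le_iff)
    have "{\<omega> \<in> space Q. \<bar>(\<Sum>i<N. (Z (i + 5) \<omega>)\<^sup>2) - 2 * real N\<bar> \<ge> a * real N} =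
      {\<omega> \<in> space Q. (?S \<omega>)\<^sup>2 \<ge> (a * real N)\<^sup>2}"
      unfolding sq by (simp add: Y_def sum_subtractf mult.commute)
    also have "prob \<dots> \<le> expectation (\<lambda>\<omega>. (?S \<omega>)\<^sup>2) / (a * real N)\<^sup>2"
      using * assms N by (intro integral_Markov_inequality_measure[where A="{}"]) auto
    also have "\<dots> = 20 / (a\<^sup>2 * real N)"
      using * N assms by (simp add: power2_eq_square field_simps)
    finally show "\<P>(\<omega> in Q. \<bar>(\<Sum>i<N. (Z (i + 5) \<omega>)\<^sup>2) - 2 * real N\<bar> \<ge> a * real N) \<le> 20 / (a\<^sup>2 * real N)" .
  qed
  show "(\<lambda>N. 20 / (a\<^sup>2 * real N)) \<longlonglongrightarrow> 0" using assms by real_asymp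
qed auto

lemma sum_window:
  assumes "\<alpha> < \<beta>"
  shows "(\<lambda>N. \<P>(\<omega> in Q. (\<Sum>i<N. Z (i + 5) \<omega> - 1) / sqrt (real N) \<in> {\<alpha><..\<beta>})) \<longlonglongrightarrow>
    cdf std_normal_distribution \<beta> - cdf std_normal_distribution \<alpha>"
proof -
  let ?X = "\<lambda>N \<omega>. (\<Sum>i<N. Z (i + 5) \<omega> - 1) / sqrt (real N)"
  have [measurable]: "?X N \<in> borel_measurable Q" for N by measurable
  have "weak_conv_m (\<lambda>N. distr Q borel (\<lambda>\<omega>. (\<Sum>i<N. Z (i + 5) \<omega> - 1) / sqrt (real N * 1\<^sup>2))) std_normal_distribution"
  proof (rule central_limit_theorem)
    show "indep_vars (\<lambda>_. borel) (\<lambda>i. Z (i + 5)) (UNIV :: nat set)" by (rule Z_shift_indep) simp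
    show "integrable Q (\<lambda>x. (Z (i + 5) x)\<^sup>2)" for i using Z_moment[of "i+5" 2] by simp
    show "expectation (Z (i + 5)) = 1" for i using Z_moment[of "i+5" 1] by simp
    show "variance (Z (i + 5)) = 1\<^sup>2" for i
      using exponential_distributed_variance[OF _ Z_exp[of "i+5"]] by simp
    show "distr Q borel (Z (i + 5)) = density lborel (exponential_density 1)" for i by (rule distr_Z) simp
  qed simp
  then have conv: "(\<lambda>N. cdf (distr Q borel (?X N)) x) \<longlonglongrightarrow> cdf std_normal_distribution x" for x
    using std_normal_isCont_cdf[of x] by (simp add: weak_conv_m_def weak_conv_def)
  have "\<P>(\<omega> in Q. ?X N \<omega> \<in> {\<alpha><..\<beta>}) = cdf (distr Q borel (?X N)) \<beta> - cdf (distr Q borel (?X N)) \<alpha>" for N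
  proof -
    interpret D: real_distribution "distr Q borel (?X N)" by (rule real_distribution_distr) measurable
    show ?thesis unfolding D.cdf_diff_eq[OF assms]
      by (subst measure_distr) (auto intro!: arg_cong[where f=prob])
  qed
  then show ?thesis using conv[of \<alpha>] conv[of \<beta>] by (auto intro!: tendsto_diff)
qed

lemma prob_Z_window:
  assumes "i \<ge> 1" "a \<ge> 0"
  shows "\<P>(\<omega> in Q. a < Z i \<omega> \<and> Z i \<omega> \<le> a + 1) = exp (- a) * (1 - exp (- 1))"
proof -
  have [measurable]: "Z i \<in> borel_measurable Q" using assms by simp
  have "{\<omega> \<in> space Q. a < Z i \<omega> \<and> Z i \<omega> \<le> a + 1} = {\<omega> \<in> space Q. a < Z i \<omega>} - {\<omega> \<in> space Q. a + 1 < Z i \<omega>}"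
    by auto
  also have "prob \<dots> = \<P>(\<omega> in Q. a < Z i \<omega>) - \<P>(\<omega> in Q. a + 1 < Z i \<omega>)"
    by (rule finite_measure_Diff) auto
  also have "\<dots> = exp (- a) * (1 - exp (- 1))"
    using assms by (simp add: prob_Z_gt algebra_simps mult_exp_exp)
  finally show ?thesis .
qed

end

text \<open>Deterministic bookkeeping: with \<open>r = \<surd>n\<close>, one coordinate \<open>w\<close> near \<open>\<kappa>r\<close> and the other
  coordinates having sum \<open>S\<close> and square sum \<open>S2\<close> in suitable windows make up a good configuration.\<close>

lemma good_configuration:
  fixes r \<kappa> \<delta> w S S2 N b :: real
  assumes \<delta>: "\<delta> > 0" and \<kappa>: "\<kappa> > 0" "\<kappa>\<^sup>2 = b - 2 - 0.45 * \<delta>\<^sup>2" and \<delta>2: "\<delta> \<le> 1"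
    and N: "N = r\<^sup>2 - 4"
    and r: "r \<ge> 3" "0.03 * \<delta> * r \<ge> \<kappa> + 5" "0.02 * \<delta>\<^sup>2 * r\<^sup>2 \<ge> 2 * \<kappa> * r + 8"
    and w: "\<kappa> * r < w" "w \<le> \<kappa> * r + 1"
    and S: "(S - N) / sqrt N \<in> {-\<kappa> - 1.07 * \<delta> <.. -\<kappa> - 1.03 * \<delta>}"
    and S2: "\<bar>S2 - 2 * N\<bar> < 0.01 * \<delta>\<^sup>2 * N"
  shows "w + S \<in> {r\<^sup>2 - 1.1 * \<delta> * r .. r\<^sup>2 - \<delta> * r}"
    and "w\<^sup>2 + S2 \<in> {r\<^sup>2 * b - 0.48 * \<delta>\<^sup>2 * r\<^sup>2 .. r\<^sup>2 * b - 0.42 * \<delta>\<^sup>2 * r\<^sup>2}"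
proof -
  have r2: "r\<^sup>2 \<ge> 9" using power_mono[of 3 r 2] r by simp
  then have N0: "N > 0" using N by simp
  have s1: "sqrt N \<le> r" using r N by (intro real_le_lsqrt) auto
  have s2: "r - 1 \<le> sqrt N" using r N by (intro real_le_rsqrt) (auto simp: power2_eq_square algebra_simps)
  have sp: "sqrt N > 0" using N0 by simp
  have S1: "S - N > (-\<kappa> - 1.07 * \<delta>) * sqrt N" "S - N \<le> (-\<kappa> - 1.03 * \<delta>) * sqrt N"
    using S sp by (auto simp: field_simps)
  have "(-\<kappa> - 1.07 * \<delta>) * sqrt N \<ge> (-\<kappa> - 1.07 * \<delta>) * r"
    using s1 \<delta> \<kappa> by (intro mult_left_mono_neg) auto
  moreover have eq: "(-\<kappa> - 1.07 * \<delta>) * r = - \<kappa> * r - 1.07 * (\<delta> * r)"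
    "(-\<kappa> - 1.03 * \<delta>) * (r - 1) = - \<kappa> * r - 1.03 * (\<delta> * r) + \<kappa> + 1.03 * \<delta>"
    by (simp_all add: field_simps)
  moreover have "(-\<kappa> - 1.03 * \<delta>) * sqrt N \<le> (-\<kappa> - 1.03 * \<delta>) * (r - 1)"
    using s2 \<delta> \<kappa> by (intro mult_left_mono_neg) auto
  ultimately have S3: "S - N \<ge> - \<kappa> * r - 1.07 * (\<delta> * r)" "S - N \<le> - \<kappa> * r - 1.03 * (\<delta> * r) + \<kappa> + 1.03 * \<delta>"
    using S1 by linarith+
  have r': "0.03 * (\<delta> * r) \<ge> \<kappa> + 5" using r by simp
  show "w + S \<in> {r\<^sup>2 - 1.1 * \<delta> * r .. r\<^sup>2 - \<delta> * r}"
    using S3 w N r' \<delta>2 \<kappa> by auto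
  have w2: "w\<^sup>2 \<ge> \<kappa>\<^sup>2 * r\<^sup>2" "w\<^sup>2 \<le> \<kappa>\<^sup>2 * r\<^sup>2 + 2 * (\<kappa> * r) + 1"
  proof -
    have "(\<kappa> * r)\<^sup>2 \<le> w\<^sup>2" using w r \<kappa> by (intro power_mono) auto
    then show "w\<^sup>2 \<ge> \<kappa>\<^sup>2 * r\<^sup>2" by (simp add: power_mult_distrib)
    have "w \<ge> 0" using w r \<kappa> by (smt (verit) mult_nonneg_nonneg)
    then have "w\<^sup>2 \<le> (\<kappa> * r + 1)\<^sup>2" using w by (intro power_mono) auto
    then show "w\<^sup>2 \<le> \<kappa>\<^sup>2 * r\<^sup>2 + 2 * (\<kappa> * r) + 1" by (simp add: power2_eq_square algebra_simps)
  qed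
  have k2: "\<kappa>\<^sup>2 * r\<^sup>2 = r\<^sup>2 * b - 2 * r\<^sup>2 - 0.45 * (\<delta>\<^sup>2 * r\<^sup>2)"
    unfolding \<kappa>(2) by (simp add: algebra_simps)
  have d: "0.01 * \<delta>\<^sup>2 * N \<le> 0.01 * (\<delta>\<^sup>2 * r\<^sup>2)"
    using N \<delta> by (simp add: mult_left_mono)
  have kr: "\<kappa> * r > 0" using r \<kappa> by simp
  show "w\<^sup>2 + S2 \<in> {r\<^sup>2 * b - 0.48 * \<delta>\<^sup>2 * r\<^sup>2 .. r\<^sup>2 * b - 0.42 * \<delta>\<^sup>2 * r\<^sup>2}"
    using w2 S2 N d k2 r(3) kr unfolding mult.assoc atLeastAtMost_iff by (intro conjI) linarith+
qed

context exp_sequence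
begin

text \<open>One coordinate of size \<open>\<kappa>\<surd>n\<close> makes up for the excess of the square sum, at the price
  \<open>exp (- \<kappa>\<surd>n)\<close>; the sum of the others must then fall short of its mean by a multiple of \<open>\<surd>n\<close>, which by
  the central limit theorem has a probability bounded away from zero. The value \<open>0.45\<close> is the
  middle of the window \<open>[0.42, 0.48]\<close> in \<open>good_set\<close>.\<close>

lemma good_set_prob:
  assumes \<delta>: "\<delta> > 0" "\<delta> \<le> 1" and \<kappa>: "\<kappa> > 0" "\<kappa>\<^sup>2 = b - 2 - 0.45 * \<delta>\<^sup>2"
  shows "\<exists>c>0. \<forall>\<^sub>F n in sequentially. c * exp (- \<kappa> * sqrt n) \<le>
    \<P>(\<omega> in Q. (\<lambda>i\<in>{4..n}. Z i \<omega>) \<in> good_set n b \<delta>)"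
proof -
  define \<alpha> \<beta> where "\<alpha> = -\<kappa> - 1.07 * \<delta>" and "\<beta> = -\<kappa> - 1.03 * \<delta>"
  have "\<alpha> < \<beta>" using \<delta> by (simp add: \<alpha>_def \<beta>_def)
  define \<phi> where "\<phi> = cdf std_normal_distribution \<beta> - cdf std_normal_distribution \<alpha>"
  have \<phi>: "\<phi> > 0" unfolding \<phi>_def by (rule std_normal_interval_pos) fact
  define a where "a = 0.01 * \<delta>\<^sup>2"
  have a: "a > 0" using \<delta> by (simp add: a_def)
  define W where "W N = {\<omega> \<in> space Q. (\<Sum>i<N. Z (i + 5) \<omega> - 1) / sqrt (real N) \<in> {\<alpha><..\<beta>}}" for N
  define V where "V N = {\<omega> \<in> space Q. \<bar>(\<Sum>i<N. (Z (i + 5) \<omega>)\<^sup>2) - 2 * real N\<bar> \<ge> a * real N}" for N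
  have [measurable]: "W N \<in> events" "V N \<in> events" for N unfolding W_def V_def by measurable
  have "(\<lambda>N. prob (W N) - prob (V N)) \<longlonglongrightarrow> \<phi> - 0"
    unfolding W_def V_def \<phi>_def by (intro tendsto_diff sum_window sum_square_concentration) fact+
  then have "\<forall>\<^sub>F N in sequentially. \<phi> / 2 < prob (W N) - prob (V N)"
    using \<phi> by (intro order_tendstoD) auto
  moreover have "filterlim (\<lambda>n::nat. n - 4) sequentially sequentially"
    by (rule filterlim_minus_const_nat_at_top)
  ultimately have evWV: "\<forall>\<^sub>F n in sequentially. \<phi> / 2 < prob (W (n - 4)) - prob (V (n - 4))"
    by (rule eventually_compose_filterlim)
  have "\<forall>\<^sub>F n in sequentially. 0.03 * \<delta> * sqrt (real n) \<ge> \<kappa> + 5"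
    using \<delta> by real_asymp
  moreover have "\<forall>\<^sub>F n in sequentially. 0.02 * \<delta>\<^sup>2 * (sqrt (real n))\<^sup>2 \<ge> 2 * \<kappa> * sqrt (real n) + 8"
    using \<delta> by real_asymp
  moreover note evWV eventually_ge_at_top[of "9::nat"]
  ultimately have "\<forall>\<^sub>F n in sequentially. (\<phi> / 2 * (1 - exp (- 1))) * exp (- \<kappa> * sqrt n) \<le>
    \<P>(\<omega> in Q. (\<lambda>i\<in>{4..n}. Z i \<omega>) \<in> good_set n b \<delta>)"
  proof eventually_elim
    case (elim n)
    define r N where "r = sqrt (real n)" and "N = n - 4"
    have r: "r \<ge> 3" "r\<^sup>2 = real n" and N: "real N = r\<^sup>2 - 4"
      using elim(4) by (auto simp: r_def N_def intro!: real_le_rsqrt)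
    define E4 where "E4 = {\<omega> \<in> space Q. \<kappa> * r < Z 4 \<omega> \<and> Z 4 \<omega> \<le> \<kappa> * r + 1}"
    define BR where "BR = {y \<in> space (PiM {5..n} (\<lambda>_. borel :: real measure)).
       (\<Sum>i\<in>{5..n}. y i - 1) / sqrt (real N) \<in> {\<alpha><..\<beta>} \<and> \<bar>(\<Sum>i\<in>{5..n}. (y i)\<^sup>2) - 2 * real N\<bar> < a * real N
       \<and> (\<forall>i\<in>{5..n}. y i > 0)}"
    have BR[measurable]: "BR \<in> sets (PiM {5..n} (\<lambda>_. borel))" unfolding BR_def by measurable
    define ER where "ER = {\<omega> \<in> space Q. (\<lambda>i\<in>{5..n}. Z i \<omega>) \<in> BR}"
    have reidx: "(\<Sum>i\<in>{5..n}. g i) = (\<Sum>i<N. g (i + 5))" for g :: "nat \<Rightarrow> real"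
      by (rule sum.reindex_bij_witness[of _ "\<lambda>i. i + 5" "\<lambda>i. i - 5"]) (use elim(4) in \<open>auto simp: N_def\<close>)
    have ERm: "ER \<in> events" unfolding ER_def
      using measurable_sets[OF Z_restrict_measurable[of "{5..n}"] BR] by (simp add: vimage_def Int_def conj_commute)
    have "AE \<omega> in Q. \<forall>i\<in>{5..n}. Z i \<omega> > 0"
      by (intro AE_finite_allI Z_pos_AE) auto
    then have ERge: "prob (W N - V N) \<le> prob ER"
    proof (intro finite_measure_mono_AE)
      show "AE \<omega> in Q. \<omega> \<in> W N - V N \<longrightarrow> \<omega> \<in> ER"
        using \<open>AE \<omega> in Q. \<forall>i\<in>{5..n}. Z i \<omega> > 0\<close>
      proof (rule AE_mp, intro AE_I2 impI)
        fix \<omega> assume "\<omega> \<in> space Q" "\<forall>i\<in>{5..n}. 0 < Z i \<omega>" "\<omega> \<in> W N - V N"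
        moreover have "(\<Sum>i\<in>{5..n}. (\<lambda>i\<in>{5..n}. Z i \<omega>) i - 1) = (\<Sum>i<N. Z (i + 5) \<omega> - 1)"
          unfolding reidx by (intro sum.cong) (auto simp: N_def)
        moreover have "(\<Sum>i\<in>{5..n}. ((\<lambda>i\<in>{5..n}. Z i \<omega>) i)\<^sup>2) = (\<Sum>i<N. (Z (i + 5) \<omega>)\<^sup>2)"
          unfolding reidx by (intro sum.cong) (auto simp: N_def)
        ultimately show "\<omega> \<in> ER" unfolding W_def V_def ER_def BR_def mem_Collect_eq by (auto simp: space_PiM)
      qed
    qed (rule ERm)
    have "prob (W N) \<le> prob (W N - V N) + prob (V N)"
    proof -
      have "prob (W N) \<le> prob ((W N - V N) \<union> V N)" by (intro finite_measure_mono) auto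
      also have "\<dots> \<le> prob (W N - V N) + prob (V N)" by (intro measure_Un_le) auto
      finally show ?thesis .
    qed
    then have ER2: "\<phi> / 2 \<le> prob ER" using elim(3) ERge by (simp add: N_def)
    have E4p: "prob E4 = exp (- (\<kappa> * r)) * (1 - exp (- 1))"
      unfolding E4_def by (rule prob_Z_window) (use \<kappa> r in auto)
    define B4 where "B4 = {y \<in> space (PiM {4} (\<lambda>_. borel :: real measure)). \<kappa> * r < y (4::nat) \<and> y 4 \<le> \<kappa> * r + 1}"
    have B4[measurable]: "B4 \<in> sets (PiM {4} (\<lambda>_. borel))" unfolding B4_def by measurable
    have ind: "indep_var (PiM {4} (\<lambda>_. borel)) (\<lambda>\<omega>. restrict (\<lambda>i. Z i \<omega>) {4})
       (PiM {5..n} (\<lambda>_. borel)) (\<lambda>\<omega>. restrict (\<lambda>i. Z i \<omega>) {5..n})"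
      by (rule indep_var_restrict[OF Z_indep]) auto
    have E4': "(\<lambda>\<omega>. restrict (\<lambda>i. Z i \<omega>) {4}) -` B4 \<inter> space Q = E4"
      by (auto simp: B4_def E4_def space_PiM)
    have ER': "(\<lambda>\<omega>. restrict (\<lambda>i. Z i \<omega>) {5..n}) -` BR \<inter> space Q = ER"
      by (auto simp: ER_def)
    have "(\<lambda>\<omega>. (restrict (\<lambda>i. Z i \<omega>) {4}, restrict (\<lambda>i. Z i \<omega>) {5..n})) -` (B4 \<times> BR) \<inter> space Q = E4 \<inter> ER"
      using E4' ER' by auto
    then have E4ER: "prob (E4 \<inter> ER) = prob E4 * prob ER"
      using indep_varD[OF ind B4 BR] E4' ER' by simp
    have sub: "E4 \<inter> ER \<subseteq> {\<omega> \<in> space Q. (\<lambda>i\<in>{4..n}. Z i \<omega>) \<in> good_set n b \<delta>}"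
    proof
      fix \<omega> assume \<omega>: "\<omega> \<in> E4 \<inter> ER"
      let ?w = "Z 4 \<omega>" and ?S = "\<Sum>i\<in>{5..n}. Z i \<omega>" and ?S2 = "\<Sum>i\<in>{5..n}. (Z i \<omega>)\<^sup>2"
      have w: "\<kappa> * r < ?w" "?w \<le> \<kappa> * r + 1" using \<omega> by (auto simp: E4_def)
      have cardN: "real (card {5..n}) = real N" using elim(4) by (simp add: N_def)
      have S: "(?S - real N) / sqrt (real N) \<in> {\<alpha><..\<beta>}" and S2: "\<bar>?S2 - 2 * real N\<bar> < a * real N"
        and pos: "\<forall>i\<in>{5..n}. Z i \<omega> > 0"
        using \<omega> cardN by (auto simp: ER_def BR_def sum_subtractf)
      have split: "{4..n} = insert 4 {5..n}" using elim(4) by auto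
      have s: "(\<Sum>i\<in>{4..n}. (\<lambda>i\<in>{4..n}. Z i \<omega>) i) = ?w + ?S"
        "(\<Sum>i\<in>{4..n}. ((\<lambda>i\<in>{4..n}. Z i \<omega>) i)\<^sup>2) = ?w\<^sup>2 + ?S2"
      proof -
        have "(\<Sum>i\<in>{4..n}. (\<lambda>i\<in>{4..n}. Z i \<omega>) i) = (\<Sum>i\<in>{4..n}. Z i \<omega>)" by (intro sum.cong) auto
        then show "(\<Sum>i\<in>{4..n}. (\<lambda>i\<in>{4..n}. Z i \<omega>) i) = ?w + ?S" unfolding split by simp
        have "(\<Sum>i\<in>{4..n}. ((\<lambda>i\<in>{4..n}. Z i \<omega>) i)\<^sup>2) = (\<Sum>i\<in>{4..n}. (Z i \<omega>)\<^sup>2)" by (intro sum.cong) auto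
        then show "(\<Sum>i\<in>{4..n}. ((\<lambda>i\<in>{4..n}. Z i \<omega>) i)\<^sup>2) = ?w\<^sup>2 + ?S2" unfolding split by simp
      qed
      have "0 < ?w" using w \<kappa> r by (smt (verit) mult_nonneg_nonneg)
      with pos have pos': "\<forall>i\<in>{4..n}. 0 < Z i \<omega>" unfolding split by auto
      note g = good_configuration[OF \<delta>(1) \<kappa> \<delta>(2) N r(1) elim(1,2)[folded r_def] w
          S[unfolded \<alpha>_def \<beta>_def] S2[unfolded a_def]]
      show "\<omega> \<in> {\<omega> \<in> space Q. (\<lambda>i\<in>{4..n}. Z i \<omega>) \<in> good_set n b \<delta>}"
        using \<omega> g pos' unfolding good_set_def mem_Collect_eq s r(2) r_def[symmetric]
        by (auto simp: E4_def space_PiM)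
    qed
    have gm: "{\<omega> \<in> space Q. (\<lambda>i\<in>{4..n}. Z i \<omega>) \<in> good_set n b \<delta>} \<in> events"
      using measurable_sets[OF Z_restrict_measurable[of "{4..n}"] good_set_measurable] by (simp add: vimage_def Int_def conj_commute)
    have "(\<phi> / 2 * (1 - exp (- 1))) * exp (- \<kappa> * r) = prob E4 * (\<phi> / 2)"
      unfolding E4p by simp
    also have "\<dots> \<le> prob E4 * prob ER" by (intro mult_left_mono ER2) auto
    also have "\<dots> \<le> \<P>(\<omega> in Q. (\<lambda>i\<in>{4..n}. Z i \<omega>) \<in> good_set n b \<delta>)"
      unfolding E4ER[symmetric] by (intro finite_measure_mono sub gm)
    finally show ?case by (simp add: r_def)
  qed
  moreover have "\<phi> / 2 * (1 - exp (- 1)) > 0" using \<phi> by simp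
  ultimately show ?thesis by blast
qed

end

section \<open>Events that are negligible after conditioning\<close>

text \<open>The normalized Lebesgue measure on a shell.\<close>

abbreviation shell_law :: "nat \<Rightarrow> real \<Rightarrow> real \<Rightarrow> (nat \<Rightarrow> real) measure" where
  "shell_law n b \<epsilon> \<equiv> uniform_measure (lborel_n n) (K_shell n b \<epsilon>)"

lemma K_shell_mono: "\<epsilon> \<le> \<epsilon>' \<Longrightarrow> K_shell n b \<epsilon> \<subseteq> K_shell n b \<epsilon>'"
  by (auto simp: K_shell_def)

text \<open>The constant 13 is the sum of the thickness 1 and of three squares that are at most 4.\<close>

lemma K_shell_removed_square_sum:
  assumes x: "x \<in> K_shell n b 1" and T: "T \<subseteq> {1..n}" "card T = 3" and x2: "\<And>i. i \<in> T \<Longrightarrow> x i \<le> 2"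
  shows "real n * b - 13 \<le> (\<Sum>i\<in>{1..n} - T. (x i)\<^sup>2)"
proof -
  have "(\<Sum>i\<in>T. (x i)\<^sup>2) \<le> (\<Sum>i\<in>T. 2\<^sup>2)"
    using x T x2 by (intro sum_mono power_mono) (auto simp: K_shell_def PiE_iff intro: less_imp_le)
  also have "\<dots> = 12" using T by simp
  finally have "(\<Sum>i\<in>T. (x i)\<^sup>2) \<le> 12" .
  moreover have "(\<Sum>i=1..n. (x i)\<^sup>2) = (\<Sum>i\<in>{1..n} - T. (x i)\<^sup>2) + (\<Sum>i\<in>T. (x i)\<^sup>2)"
    using T by (intro sum.subset_diff) auto
  ultimately show ?thesis using x by (auto simp: K_shell_def abs_less_iff)
qed

lemma ennreal_divide_le:
  assumes den: "den > 0" and num: "num \<ge> (0::real)" and up: "X \<le> ennreal num" and low: "ennreal den \<le> Y"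
  shows "X / Y \<le> ennreal (num / den)"
proof -
  obtain x where x: "X = ennreal x" "0 \<le> x" "x \<le> num"
    using up num by (cases X) (auto simp: top_unique)
  show ?thesis
  proof (cases Y)
    case (real y)
    then have "den \<le> y" using low den by (simp add: ennreal_le_iff)
    then have "x / y \<le> num / den" using x den num by (intro frac_le) auto
    then show ?thesis using real x \<open>den \<le> y\<close> den by (simp add: divide_ennreal ennreal_leI)
  next
    case top
    then show ?thesis using x by simp
  qed
qed

lemma eventually_power_times_exp_le:
  fixes s \<eta> :: real
  assumes "\<eta> > 0"
  shows "\<forall>\<^sub>F n in sequentially. real n ^ k * exp (- (s + 4 * \<eta>) * sqrt (real n)) \<le> exp (- (s + 2 * \<eta>) * sqrt (real n))"
proof -
  have "\<forall>\<^sub>F n in sequentially. real n ^ k \<le> exp (2 * \<eta> * sqrt (real n))" using assms by real_asymp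
  then show ?thesis
  proof eventually_elim
    case (elim n)
    have "real n ^ k * exp (- (s + 4 * \<eta>) * sqrt n) \<le> exp (2 * \<eta> * sqrt n) * exp (- (s + 4 * \<eta>) * sqrt n)"
      using elim by (intro mult_right_mono) auto
    also have "\<dots> = exp (- (s + 2 * \<eta>) * sqrt n)" by (simp add: exp_add[symmetric] algebra_simps)
    finally show ?case .
  qed
qed

lemma exp_le_quadratic:
  fixes u :: real assumes "u \<ge> 0" shows "exp u \<le> 1 + u + u\<^sup>2 * exp u"
proof -
  have "1 - u \<le> exp (- u)" using exp_ge_add_one_self[of "- u"] by simp
  then have "exp u * (1 - u) \<le> exp u * exp (- u)" by (intro mult_left_mono) auto
  then have 1: "exp u - 1 \<le> u * exp u" by (simp add: mult_exp_exp algebra_simps)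
  have "u * (exp u - 1) \<le> u * (u * exp u)" using 1 assms by (intro mult_left_mono) auto
  with 1 show ?thesis by (simp add: power2_eq_square algebra_simps)
qed

context exp_sequence
begin

text \<open>\<open>controlled n b A p\<close>: once three coordinates that are at most 2 have been dropped, a shell
  point of \<open>A\<close> satisfies an event which has probability at most \<open>p\<close> for independent exponential
  variables.\<close>

definition controlled :: "nat \<Rightarrow> real \<Rightarrow> (nat \<Rightarrow> real) set \<Rightarrow> real \<Rightarrow> bool" where
  "controlled n b A p \<longleftrightarrow> A \<in> sets (borel_n n) \<and>
    (\<forall>T. T \<subseteq> {1..n} \<and> card T = 3 \<longrightarrow> (\<exists>B \<in> sets (PiM ({1..n} - T) (\<lambda>_. borel)).
       (\<forall>x \<in> K_shell n b 1 \<inter> A. (\<forall>i\<in>T. x i \<le> 2) \<longrightarrow> restrict x ({1..n} - T) \<in> B) \<and>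
       \<P>(\<omega> in Q. (\<lambda>i\<in>{1..n} - T. Z i \<omega>) \<in> B) \<le> p))"

lemma controlledI:
  assumes "A \<in> sets (borel_n n)"
    and "\<And>T. T \<subseteq> {1..n} \<Longrightarrow> card T = 3 \<Longrightarrow> B T \<in> sets (PiM ({1..n} - T) (\<lambda>_. borel))"
    and "\<And>x T. x \<in> K_shell n b 1 \<Longrightarrow> x \<in> A \<Longrightarrow> T \<subseteq> {1..n} \<Longrightarrow> card T = 3 \<Longrightarrow> (\<And>i. i \<in> T \<Longrightarrow> x i \<le> 2)
       \<Longrightarrow> restrict x ({1..n} - T) \<in> B T"
    and "\<And>T. T \<subseteq> {1..n} \<Longrightarrow> card T = 3 \<Longrightarrow>
       \<P>(\<omega> in Q. (\<lambda>i\<in>{1..n} - T. Z i \<omega>) \<in> B T) \<le> p"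
  shows "controlled n b A p"
  unfolding controlled_def using assms by (intro conjI allI impI bexI[of _ "B _"]) blast+

text \<open>Conditioning on the shell multiplies probabilities by at most \<open>exp (\<surd>((b - 2) n))\<close>, up to a factor
  \<open>exp (\<eta>\<surd>n)\<close> with an arbitrarily small \<open>\<eta>\<close>.\<close>

lemma shell_measure_le:
  assumes b: "b > 2" and \<eta>: "\<eta> > 0"
  shows "\<forall>\<^sub>F n in sequentially. \<forall>A p \<epsilon>. controlled n b A p \<longrightarrow> 0 < \<epsilon> \<longrightarrow> \<epsilon> \<le> 1 \<longrightarrow>
    measure (shell_law n b \<epsilon>) A \<le> exp ((sqrt (b - 2) + \<eta>) * sqrt n) * p"
proof -
  \<comment> \<open>Small enough for \<open>1.1 \<delta> \<le> \<eta>/2\<close> and \<open>0.45 \<delta>\<^sup>2 < b - 2\<close>.\<close>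
  define \<delta> where "\<delta> = min 1 (min (\<eta> / 4) ((b - 2) / 2))"
  have \<delta>: "\<delta> > 0" "\<delta> \<le> 1" "\<delta> \<le> \<eta> / 4" using b \<eta> by (auto simp: \<delta>_def)
  have \<delta>4: "\<delta> \<le> (b - 2) / 2" unfolding \<delta>_def by (rule min.coboundedI2[OF min.cobounded2])
  have "\<delta>\<^sup>2 \<le> \<delta>" using \<delta> by (simp add: power2_eq_square mult_left_le)
  then have "0.45 * \<delta>\<^sup>2 \<le> 0.45 * \<delta>" by (intro mult_left_mono) auto
  also have "\<dots> < b - 2" using \<delta>(1) \<delta>4 by simp
  finally have pos: "b - 2 - 0.45 * \<delta>\<^sup>2 > 0" by simp
  define \<kappa> where "\<kappa> = sqrt (b - 2 - 0.45 * \<delta>\<^sup>2)"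
  have \<kappa>: "\<kappa> > 0" "\<kappa>\<^sup>2 = b - 2 - 0.45 * \<delta>\<^sup>2" "\<kappa> \<le> sqrt (b - 2)" using pos by (auto simp: \<kappa>_def)
  from good_set_prob[OF \<delta>(1,2) \<kappa>(1,2)] obtain c where c: "c > 0" and
    ev: "\<forall>\<^sub>F n in sequentially. c * exp (- \<kappa> * sqrt n) \<le>
       \<P>(\<omega> in Q. (\<lambda>i\<in>{4..n}. Z i \<omega>) \<in> good_set n b \<delta>)" by blast
  have "\<forall>\<^sub>F n in sequentially. \<delta> * sqrt (real n) \<ge> 100" using \<delta>(1) by real_asymp
  moreover have "\<forall>\<^sub>F n in sequentially. real n ^ 3 * exp 1 / c \<le> exp (\<eta> / 2 * sqrt (real n))"
    using c \<eta> by real_asymp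
  moreover note ev eventually_ge_at_top[of "7::nat"]
  ultimately show ?thesis
  proof eventually_elim
    case (elim n)
    show ?case
    proof (intro allI impI)
      fix A p \<epsilon> assume con: "controlled n b A p" and \<epsilon>: "0 < \<epsilon>" "\<epsilon> \<le> (1::real)"
      let ?L = "lborel_n n" and ?S = "K_shell n b \<epsilon>"
      have A: "A \<in> sets (borel_n n)" using con by (simp add: controlled_def)
      have "\<forall>T. \<exists>B. T \<subseteq> {1..n} \<and> card T = 3 \<longrightarrow> B \<in> sets (PiM ({1..n} - T) (\<lambda>_. borel)) \<and>
         (\<forall>x \<in> K_shell n b 1 \<inter> A. (\<forall>i\<in>T. x i \<le> 2) \<longrightarrow> restrict x ({1..n} - T) \<in> B) \<and>
         \<P>(\<omega> in Q. (\<lambda>i\<in>{1..n} - T. Z i \<omega>) \<in> B) \<le> p"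
        using con unfolding controlled_def by blast
      from choice[OF this] obtain B where B0: "\<forall>T. T \<subseteq> {1..n} \<and> card T = 3 \<longrightarrow> B T \<in> sets (PiM ({1..n} - T) (\<lambda>_. borel)) \<and>
         (\<forall>x \<in> K_shell n b 1 \<inter> A. (\<forall>i\<in>T. x i \<le> 2) \<longrightarrow> restrict x ({1..n} - T) \<in> B T) \<and>
         \<P>(\<omega> in Q. (\<lambda>i\<in>{1..n} - T. Z i \<omega>) \<in> B T) \<le> p" ..
      have B: "\<And>T. T \<subseteq> {1..n} \<Longrightarrow> card T = 3 \<Longrightarrow> B T \<in> sets (PiM ({1..n} - T) (\<lambda>_. borel))"
        "\<And>x T. x \<in> K_shell n b 1 \<Longrightarrow> x \<in> A \<Longrightarrow> T \<subseteq> {1..n} \<Longrightarrow> card T = 3 \<Longrightarrow> (\<And>i. i \<in> T \<Longrightarrow> x i \<le> 2)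
           \<Longrightarrow> restrict x ({1..n} - T) \<in> B T"
        "\<And>T. T \<subseteq> {1..n} \<Longrightarrow> card T = 3 \<Longrightarrow> \<P>(\<omega> in Q. (\<lambda>i\<in>{1..n} - T. Z i \<omega>) \<in> B T) \<le> p"
        using B0 by blast+
      have "{1..3} \<subseteq> {1..n}" "card {1..3::nat} = 3" using elim(4) by auto
      then have p0: "p \<ge> 0" using B(3)[of "{1..3}"] measure_nonneg order_trans by blast
      define num where "num = circ_const * \<epsilon>\<^sup>2 * (real n ^ 3 * (exp (real n + 1) * p))"
      define den where "den = circ_const * \<epsilon>\<^sup>2 * (exp (real n - 1.1 * \<delta> * sqrt n) * (c * exp (- \<kappa> * sqrt n)))"
      have den0: "den > 0" unfolding den_def using circ_const_pos \<epsilon> c by (intro mult_pos_pos) auto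
      have num0: "num \<ge> 0" unfolding num_def using circ_const_pos p0 by simp
      have up: "emeasure ?L (?S \<inter> A) \<le> ennreal num" unfolding num_def
        using K_shell_mono[OF \<epsilon>(2), of n b]
        by (intro emeasure_K_shell_le[OF elim(4) \<epsilon> A B(1) _ B(3)] B(2)) auto
      have "ennreal den \<le> ennreal (circ_const * \<epsilon>\<^sup>2 * (exp (real n - 1.1 * \<delta> * sqrt n) *
         \<P>(\<omega> in Q. (\<lambda>i\<in>{4..n}. Z i \<omega>) \<in> good_set n b \<delta>)))"
        unfolding den_def using circ_const_pos elim(3) by (intro ennreal_leI mult_left_mono) auto
      also have "\<dots> \<le> emeasure ?L ?S" using elim(1,4) \<epsilon> by (intro emeasure_K_shell_ge) auto
      finally have low: "ennreal den \<le> emeasure ?L ?S" .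
      have "emeasure (uniform_measure ?L ?S) A = emeasure ?L (?S \<inter> A) / emeasure ?L ?S"
        using A by (intro emeasure_uniform_measure) (simp_all add: sets_PiM_lborel_borel del: One_nat_def)
      also have "\<dots> \<le> ennreal (num / den)" by (rule ennreal_divide_le[OF den0 num0 up low])
      finally have 1: "measure (uniform_measure ?L ?S) A \<le> num / den"
        unfolding measure_def using num0 den0 by (simp add: enn2real_leI)
      have "num / den = (real n ^ 3 * exp 1 / c) * (exp ((1.1 * \<delta> + \<kappa>) * sqrt n) * p)"
      proof -
        have e1: "exp (real n + 1) = exp 1 * exp (real n)" by (simp add: exp_add)
        have e2: "exp (real n - 1.1 * \<delta> * sqrt n) * (c * exp (- \<kappa> * sqrt n)) = exp (real n) * c / exp ((1.1 * \<delta> + \<kappa>) * sqrt n)"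
        proof -
          have "exp (real n - 1.1 * \<delta> * sqrt n) * (c * exp (- \<kappa> * sqrt n)) =
              c * exp ((real n - 1.1 * \<delta> * sqrt n) + - \<kappa> * sqrt n)"
            unfolding exp_add by simp
          also have "(real n - 1.1 * \<delta> * sqrt n) + - \<kappa> * sqrt n = real n - (1.1 * \<delta> + \<kappa>) * sqrt n"
            by (simp add: algebra_simps)
          finally show ?thesis by (simp add: exp_diff)
        qed
        show ?thesis unfolding num_def den_def e1 e2 using circ_const_pos \<epsilon> c by (simp add: field_simps)
      qed
      also have "\<dots> \<le> exp (\<eta> / 2 * sqrt n) * (exp ((1.1 * \<delta> + \<kappa>) * sqrt n) * p)"
        using p0 elim(2) by (intro mult_right_mono) auto
      also have "\<dots> = exp ((\<eta> / 2 + 1.1 * \<delta> + \<kappa>) * sqrt n) * p"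
        by (simp add: exp_add[symmetric] algebra_simps)
      also have "\<dots> \<le> exp ((sqrt (b - 2) + \<eta>) * sqrt n) * p"
      proof (intro mult_right_mono p0)
        have "\<eta> / 2 + 1.1 * \<delta> + \<kappa> \<le> sqrt (b - 2) + \<eta>" using \<delta> \<kappa> \<eta> by auto
        then show "exp ((\<eta> / 2 + 1.1 * \<delta> + \<kappa>) * sqrt n) \<le> exp ((sqrt (b - 2) + \<eta>) * sqrt n)"
          by (simp add: mult_right_mono)
      qed
      finally show "measure (uniform_measure ?L ?S) A \<le> exp ((sqrt (b - 2) + \<eta>) * sqrt n) * p"
        using 1 by simp
    qed
  qed
qed

text \<open>Sequences of events that are too unlikely to survive the conditioning: their cost exceeds the
  price \<open>exp (\<surd>((b - 2) n))\<close> by a factor that is exponential in \<open>\<surd>n\<close>. The \<open>2\<eta>\<close> leaves one \<open>\<eta>\<close> for the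
  loss in \<open>shell_measure_le\<close> and one for the decay.\<close>

definition negligible :: "real \<Rightarrow> (nat \<Rightarrow> (nat \<Rightarrow> real) set) \<Rightarrow> bool" where
  "negligible b A \<longleftrightarrow> (\<exists>\<eta>>0. \<forall>\<^sub>F n in sequentially. controlled n b (A n) (exp (- (sqrt (b - 2) + 2 * \<eta>) * sqrt n)))"

lemma negligible_shell:
  assumes b: "b > 2" and "negligible b A"
  obtains p where "p \<longlonglongrightarrow> (0::real)"
    "\<forall>\<^sub>F n in sequentially. \<forall>\<epsilon>. 0 < \<epsilon> \<longrightarrow> \<epsilon> \<le> 1 \<longrightarrow> measure (shell_law n b \<epsilon>) (A n) \<le> p n"
proof -
  from assms obtain \<eta> where \<eta>: "\<eta> > 0" and
    ev: "\<forall>\<^sub>F n in sequentially. controlled n b (A n) (exp (- (sqrt (b - 2) + 2 * \<eta>) * sqrt n))"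
    unfolding negligible_def by blast
  show thesis
  proof (rule that[of "\<lambda>n. exp (- \<eta> * sqrt (real n))"])
    show "(\<lambda>n. exp (- \<eta> * sqrt (real n))) \<longlonglongrightarrow> 0" using \<eta> by real_asymp
    show "\<forall>\<^sub>F n in sequentially. \<forall>\<epsilon>. 0 < \<epsilon> \<longrightarrow> \<epsilon> \<le> 1 \<longrightarrow>
       measure (shell_law n b \<epsilon>) (A n) \<le> exp (- \<eta> * sqrt (real n))"
      using ev shell_measure_le[OF b \<eta>]
    proof eventually_elim
      case (elim n)
      have "exp ((sqrt (b - 2) + \<eta>) * sqrt n) * exp (- (sqrt (b - 2) + 2 * \<eta>) * sqrt n) = exp (- \<eta> * sqrt n)"
        by (simp add: exp_add[symmetric] algebra_simps)
      then show ?case using elim by metis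
    qed
  qed
qed

text \<open>Exponential moment of a square that is truncated at \<open>a\<close>. The truncation makes \<open>tZ\<^sup>2\<close> at most
  \<open>taZ \<le> \<rho>Z\<close>, whose exponential is integrable against the exponential density because \<open>\<rho> < 1\<close>.\<close>

lemma truncated_square_mgf:
  assumes i: "i \<ge> 1" and t: "t > 0" and a: "a \<ge> 0" and \<rho>: "t * a \<le> \<rho>" "\<rho> < 1"
  shows "(\<integral>\<^sup>+\<omega>. ennreal (if Z i \<omega> \<le> a then exp (t * (Z i \<omega>)\<^sup>2) else 1) \<partial>Q) \<le>
    ennreal (1 + 2 * t + 24 / (1 - \<rho>) ^ 5 * t\<^sup>2)"
proof -
  have \<rho>0: "\<rho> \<ge> 0" using t a \<rho> by (smt (verit) mult_nonneg_nonneg)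
  have erl: "(\<integral>\<^sup>+x. ennreal (erlang_density k l x) \<partial>lborel) = 1" if "l > 0" for k l
    using nn_integral_erlang_ith_moment[OF that, of k 0] by simp
  let ?h = "\<lambda>z. if z \<le> a then exp (t * z\<^sup>2) else 1"
  have "(\<integral>\<^sup>+\<omega>. ennreal (?h (Z i \<omega>)) \<partial>Q) = (\<integral>\<^sup>+z. ennreal (exponential_density 1 z) * ennreal (?h z) \<partial>lborel)"
    by (subst distributed_nn_integral[OF Z_exp[OF i], symmetric]) auto
  also have "\<dots> \<le> (\<integral>\<^sup>+z. ennreal (erlang_density 0 1 z) + ennreal (2 * t) * ennreal (erlang_density 2 1 z) +
      ennreal (24 / (1 - \<rho>) ^ 5 * t\<^sup>2) * ennreal (erlang_density 4 (1 - \<rho>) z) \<partial>lborel)"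
  proof (intro nn_integral_mono)
    fix z :: real
    have "exponential_density 1 z * ?h z \<le> erlang_density 0 1 z + 2 * t * erlang_density 2 1 z +
      24 / (1 - \<rho>) ^ 5 * t\<^sup>2 * erlang_density 4 (1 - \<rho>) z"
    proof (cases "z < 0")
      case False
      then have z: "z \<ge> 0" by simp
      have h: "?h z \<le> 1 + t * z\<^sup>2 + t\<^sup>2 * z ^ 4 * exp (\<rho> * z)"
      proof (cases "z \<le> a")
        case True
        have "t * z\<^sup>2 = (t * z) * z" by (simp add: power2_eq_square)
        also have "\<dots> \<le> \<rho> * z"
          using True t z \<rho> by (intro mult_right_mono) (auto intro: order_trans[OF mult_left_mono])
        finally have e: "exp (t * z\<^sup>2) \<le> exp (\<rho> * z)" by simp
        have "exp (t * z\<^sup>2) \<le> 1 + t * z\<^sup>2 + (t * z\<^sup>2)\<^sup>2 * exp (t * z\<^sup>2)"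
          using t by (intro exp_le_quadratic) auto
        also have "\<dots> \<le> 1 + t * z\<^sup>2 + (t * z\<^sup>2)\<^sup>2 * exp (\<rho> * z)"
          using e by (intro add_left_mono mult_left_mono) auto
        finally show ?thesis using True by (simp add: power_mult_distrib)
      next
        case False
        then show ?thesis using t z by simp
      qed
      have "exponential_density 1 z * ?h z = exp (- z) * ?h z" using z by (simp add: exponential_density_def)
      also have "\<dots> \<le> exp (- z) * (1 + t * z\<^sup>2 + t\<^sup>2 * z ^ 4 * exp (\<rho> * z))"
        using h by (intro mult_left_mono) auto
      also have "\<dots> = erlang_density 0 1 z + 2 * t * erlang_density 2 1 z +
        24 / (1 - \<rho>) ^ 5 * t\<^sup>2 * erlang_density 4 (1 - \<rho>) z"
      proof -
        define E F where "E = exp (- z)" and "F = exp (\<rho> * z)"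
        have e: "exp ((\<rho> - 1) * z) = E * F" unfolding E_def F_def
          by (simp add: mult_exp_exp algebra_simps)
        define R where "R = (1 - \<rho>) ^ 5"
        have R: "R > 0" using \<rho> by (simp add: R_def)
        have e4: "erlang_density 4 (1 - \<rho>) z = R * (z ^ 4 * (E * F) / 24)"
          using z by (simp add: erlang_density_def fact_numeral e R_def)
        have "24 / R * t\<^sup>2 * erlang_density 4 (1 - \<rho>) z = t\<^sup>2 * (z ^ 4 * (E * F))"
          unfolding e4 using R by simp
        moreover have "erlang_density 0 1 z = E" "erlang_density 2 1 z = z\<^sup>2 * E / 2"
          using z by (simp_all add: erlang_density_def fact_numeral E_def)
        ultimately show ?thesis unfolding E_def[symmetric] F_def[symmetric] R_def[symmetric] by (simp add: algebra_simps)
      qed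
      finally show ?thesis .
    qed (simp add: erlang_density_def)
    then have "ennreal (exponential_density 1 z * ?h z) \<le> ennreal (erlang_density 0 1 z + 2 * t * erlang_density 2 1 z +
      24 / (1 - \<rho>) ^ 5 * t\<^sup>2 * erlang_density 4 (1 - \<rho>) z)" by (rule ennreal_leI)
    then show "ennreal (exponential_density 1 z) * ennreal (?h z) \<le> ennreal (erlang_density 0 1 z) + ennreal (2 * t) * ennreal (erlang_density 2 1 z) +
      ennreal (24 / (1 - \<rho>) ^ 5 * t\<^sup>2) * ennreal (erlang_density 4 (1 - \<rho>) z)"
      using t \<rho> by (simp add: ennreal_mult[symmetric] ennreal_plus[symmetric] del: ennreal_plus)
  qed
  also have "\<dots> = 1 + ennreal (2 * t) + ennreal (24 / (1 - \<rho>) ^ 5 * t\<^sup>2)"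
    using \<rho> by (simp add: nn_integral_add nn_integral_cmult erl)
  also have "\<dots> = ennreal (1 + 2 * t + 24 / (1 - \<rho>) ^ 5 * t\<^sup>2)"
    using t \<rho> by (simp add: ennreal_plus[symmetric] ennreal_1[symmetric] del: ennreal_plus ennreal_1)
  finally show ?thesis .
qed

text \<open>Chernoff bound with exponent \<open>\<theta>/\<surd>n\<close> for the sum of the squares of at most \<open>n\<close> variables, on the event
  that none of them exceeds \<open>L\<surd>n\<close>.\<close>

lemma truncated_square_sum_tail:
  assumes J: "finite J" "J \<subseteq> {1..}" "card J \<le> n" and n: "n \<ge> 1"
    and \<theta>: "\<theta> > 0" and L: "L > 0" "\<theta> * L < 1"
  shows "\<P>(\<omega> in Q. (\<forall>i\<in>J. Z i \<omega> \<le> L * sqrt n) \<and> c \<le> (\<Sum>i\<in>J. (Z i \<omega>)\<^sup>2)) \<le>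
     exp (- (\<theta> * c / sqrt n) + 2 * \<theta> * sqrt n + 24 / (1 - \<theta> * L) ^ 5 * \<theta>\<^sup>2)"
proof -
  define t where "t = \<theta> / sqrt n"
  have t: "t > 0" using \<theta> n by (simp add: t_def)
  have tn: "t * real n = \<theta> * sqrt n" "t\<^sup>2 * real n = \<theta>\<^sup>2" "t * (L * sqrt n) = \<theta> * L"
    using n by (auto simp: t_def power_divide real_div_sqrt field_simps)
  define h where "h z = (if z \<le> L * sqrt n then exp (t * z\<^sup>2) else 1)" for z
  have h_meas[measurable]: "h \<in> borel_measurable borel" unfolding h_def by measurable
  let ?A = "{\<omega> \<in> space Q. (\<forall>i\<in>J. Z i \<omega> \<le> L * sqrt n) \<and> c \<le> (\<Sum>i\<in>J. (Z i \<omega>)\<^sup>2)}"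
  have [measurable]: "Z i \<in> borel_measurable Q" if "i \<in> J" for i using J that by auto
  have A: "?A \<in> events" using J(1) by measurable
  define D where "D = 24 / (1 - \<theta> * L) ^ 5"
  have D: "D \<ge> 0" unfolding D_def using L by simp
  have "emeasure Q ?A = (\<integral>\<^sup>+\<omega>. indicator ?A \<omega> \<partial>Q)" using A by simp
  also have "\<dots> \<le> (\<integral>\<^sup>+\<omega>. ennreal (exp (- t * c)) * (\<Prod>i\<in>J. ennreal (h (Z i \<omega>))) \<partial>Q)"
  proof (intro nn_integral_mono)
    fix \<omega> assume "\<omega> \<in> space Q"
    show "indicator ?A \<omega> \<le> ennreal (exp (- t * c)) * (\<Prod>i\<in>J. ennreal (h (Z i \<omega>)))"
    proof (cases "\<omega> \<in> ?A")
      case True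
      have "(\<Prod>i\<in>J. h (Z i \<omega>)) = (\<Prod>i\<in>J. exp (t * (Z i \<omega>)\<^sup>2))"
        using True by (intro prod.cong) (auto simp: h_def)
      also have "\<dots> = exp (t * (\<Sum>i\<in>J. (Z i \<omega>)\<^sup>2))" using J by (simp add: exp_sum sum_distrib_left)
      finally have p: "(\<Prod>i\<in>J. h (Z i \<omega>)) = exp (t * (\<Sum>i\<in>J. (Z i \<omega>)\<^sup>2))" .
      have "1 \<le> exp (t * ((\<Sum>i\<in>J. (Z i \<omega>)\<^sup>2) - c))" using True t by simp
      also have "\<dots> = exp (- t * c) * (\<Prod>i\<in>J. h (Z i \<omega>))"
        unfolding p mult_exp_exp by (simp add: algebra_simps)
      finally have "1 \<le> ennreal (exp (- t * c) * (\<Prod>i\<in>J. h (Z i \<omega>)))" by simp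
      then show ?thesis using True by (simp add: ennreal_mult prod_nonneg prod_ennreal h_def)
    qed simp
  qed
  also have "\<dots> = ennreal (exp (- t * c)) * (\<integral>\<^sup>+\<omega>. (\<Prod>i\<in>J. ennreal (h (Z i \<omega>))) \<partial>Q)"
    by (rule nn_integral_cmult) measurable
  also have "(\<integral>\<^sup>+\<omega>. (\<Prod>i\<in>J. ennreal (h (Z i \<omega>))) \<partial>Q) = (\<Prod>i\<in>J. \<integral>\<^sup>+\<omega>. ennreal (h (Z i \<omega>)) \<partial>Q)"
    by (rule indep_vars_nn_integral[OF J(1)])
       (auto intro!: indep_vars_subset[OF indep_vars_compose2[OF Z_indep]] J)
  also have "\<dots> \<le> (\<Prod>i\<in>J. ennreal (1 + 2 * t + D * t\<^sup>2))"
    unfolding h_def D_def using J t L by (intro prod_mono_ennreal truncated_square_mgf) (auto simp: tn)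
  also have "\<dots> \<le> ennreal (exp (2 * \<theta> * sqrt n + D * \<theta>\<^sup>2))"
  proof -
    have "(1 + 2 * t + D * t\<^sup>2) ^ card J \<le> (1 + 2 * t + D * t\<^sup>2) ^ n"
      using t D J by (intro power_increasing) auto
    also have "\<dots> \<le> exp (2 * t + D * t\<^sup>2) ^ n"
      using t D exp_ge_add_one_self[of "2 * t + D * t\<^sup>2"] by (intro power_mono) (auto simp: algebra_simps)
    also have "\<dots> = exp (real n * (2 * t + D * t\<^sup>2))" by (rule exp_of_nat_mult[symmetric])
    also have "real n * (2 * t + D * t\<^sup>2) = 2 * (t * real n) + D * (t\<^sup>2 * real n)" by (simp add: algebra_simps)
    finally show ?thesis unfolding tn using t D by (subst prod_constant, subst ennreal_power) (auto simp: mult.assoc simp del: ennreal_plus)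
  qed
  finally have "emeasure Q ?A \<le> ennreal (exp (- t * c)) * ennreal (exp (2 * \<theta> * sqrt n + D * \<theta>\<^sup>2))"
    by (simp add: mult_left_mono)
  also have "\<dots> = ennreal (exp (- (\<theta> * c / sqrt n) + 2 * \<theta> * sqrt n + D * \<theta>\<^sup>2))"
    by (simp add: ennreal_mult[symmetric] mult_exp_exp t_def algebra_simps)
  finally show ?thesis unfolding D_def by (simp add: emeasure_eq_measure)
qed

end

section \<open>Extreme coordinates and block averages\<close>

text \<open>The \<open>j\<close>-th of the disjoint blocks of \<open>k\<close> coordinates. Consecutive blocks start \<open>k + 1\<close> apart, not
  \<open>k\<close>, so that \<open>k = 0\<close> needs no separate treatment when blocks are counted.\<close>

definition block :: "nat \<Rightarrow> nat \<Rightarrow> (nat \<Rightarrow> real) \<Rightarrow> nat \<Rightarrow> real" where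
  "block k j x = (\<lambda>i\<in>{1..k}. x (j * Suc k + i))"

lemma block_in_Rn: "block k j x \<in> Rn k"
  by (auto simp: block_def)

lemma block_measurable:
  assumes "{j * Suc k + 1..j * Suc k + k} \<subseteq> J"
  shows "block k j \<in> measurable (PiM J (\<lambda>_. borel)) (borel_n k)"
  unfolding block_def
proof (rule measurable_restrict)
  fix i assume "i \<in> {1..k}"
  then have "j * Suc k + i \<in> J" using assms by auto
  then show "(\<lambda>x. x (j * Suc k + i)) \<in> borel_measurable (PiM J (\<lambda>_. borel))" by measurable
qed

lemma block_restrict:
  assumes "{j * Suc k + 1..j * Suc k + k} \<subseteq> J"
  shows "block k j (restrict x J) = block k j x"
proof -
  have "j * Suc k + i \<in> J" if "i \<in> {1..k}" for i using assms that by auto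
  then show ?thesis by (auto simp: block_def fun_eq_iff)
qed

lemma block_range:
  assumes "j < n div Suc k" shows "{j * Suc k + 1..j * Suc k + k} \<subseteq> {1..n}"
proof -
  have "Suc j * Suc k \<le> (n div Suc k) * Suc k" using assms by (intro mult_right_mono) auto
  also have "\<dots> \<le> n" by (rule div_times_less_eq_dividend)
  finally show ?thesis by auto
qed

context exp_sequence
begin

lemma prob_restrict_eq:
  assumes "J \<subseteq> {1..}" "\<And>y. y \<in> space (PiM J (\<lambda>_. borel :: real measure)) \<Longrightarrow> P y \<longleftrightarrow> P' y"
    "\<And>\<omega>. P' (\<lambda>i\<in>J. Z i \<omega>) \<longleftrightarrow> R \<omega>"
  shows "\<P>(\<omega> in Q. (\<lambda>i\<in>J. Z i \<omega>) \<in> {y \<in> space (PiM J (\<lambda>_. borel)). P y}) = \<P>(\<omega> in Q. R \<omega>)"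
  using assms by (intro arg_cong[where f=prob]) (auto simp: space_PiM)

text \<open>Without a coordinate of size close to \<open>\<surd>((b - 2) n)\<close>, the excess \<open>(b - 2) n\<close> of the square sum has to be
  built from coordinates below \<open>L\<surd>n\<close>, with probability about \<open>exp (- \<theta> (b - 2) \<surd>n)\<close> at most, for any
  \<open>\<theta> < 1/L\<close>; this is much smaller than \<open>exp (- \<surd>(b - 2) \<surd>n)\<close> as soon as \<open>\<theta> > 1/\<surd>(b - 2)\<close>.\<close>

lemma negligible_no_large:
  assumes L: "0 < L" "L < sqrt (b - 2)" and b: "b > 2"
  shows "negligible b (\<lambda>n. {x \<in> space (borel_n n). \<forall>i\<in>{1..n}. x i \<le> L * sqrt n})"
proof -
  define s where "s = sqrt (b - 2)"
  have s: "s > 0" "s\<^sup>2 = b - 2" "L < s" using b L by (auto simp: s_def)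
  \<comment> \<open>Any value strictly between \<open>1/s\<close> and \<open>1/L\<close> would do.\<close>
  define \<theta> where "\<theta> = (1 / s + 1 / L) / 2"
  have "1 / s < 1 / L" using L s by (intro divide_strict_left_mono) auto
  then have \<theta>1: "1 / s < \<theta>" "\<theta> < 1 / L" by (auto simp: \<theta>_def)
  have "0 < 1 / s" using s(1) by simp
  then have \<theta>: "\<theta> > 0" "\<theta> * L < 1" using \<theta>1 L(1) by (linarith, simp add: field_simps)
  have "1 / s * s\<^sup>2 < \<theta> * s\<^sup>2" using \<theta>1(1) s(1) by (intro mult_strict_right_mono) auto
  then have \<theta>s: "s < \<theta> * (b - 2)" unfolding s(2)[symmetric] using s(1) by (simp add: power2_eq_square)
  define \<eta> where "\<eta> = (\<theta> * (b - 2) - s) / 4"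
  have \<eta>: "\<eta> > 0" "\<theta> * (b - 2) = s + 4 * \<eta>" using \<theta>s by (simp_all add: \<eta>_def field_simps)
  define D where "D = 24 / (1 - \<theta> * L) ^ 5 * \<theta>\<^sup>2"
  have "\<forall>\<^sub>F n in sequentially. 13 * \<theta> / sqrt (real n) + D \<le> 2 * \<eta> * sqrt (real n)"
    using \<eta>(1) by real_asymp
  with eventually_ge_at_top[of "1::nat"]
  have "\<forall>\<^sub>F n in sequentially. controlled n b {x \<in> space (borel_n n). \<forall>i\<in>{1..n}. x i \<le> L * sqrt n}
      (exp (- (s + 2 * \<eta>) * sqrt n))"
  proof eventually_elim
    case (elim n)
    let ?B = "\<lambda>T. {y \<in> space (PiM ({1..n} - T) (\<lambda>_. borel :: real measure)).
       (\<forall>i\<in>{1..n} - T. y i \<le> L * sqrt n) \<and> real n * b - 13 \<le> (\<Sum>i\<in>{1..n} - T. (y i)\<^sup>2)}"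
    show ?case
    proof (rule controlledI[where B="?B"])
      fix T :: "nat set" assume T: "T \<subseteq> {1..n}" "card T = 3"
      have cJ: "card ({1..n} - T) \<le> n" using card_mono[of "{1..n}" "{1..n} - T"] by auto
      have "\<P>(\<omega> in Q. (\<lambda>i\<in>{1..n} - T. Z i \<omega>) \<in> ?B T) =
        \<P>(\<omega> in Q. (\<forall>i\<in>{1..n} - T. Z i \<omega> \<le> L * sqrt n) \<and> real n * b - 13 \<le> (\<Sum>i\<in>{1..n} - T. (Z i \<omega>)\<^sup>2))"
        by (rule prob_restrict_eq) auto
      also have "\<dots> \<le> exp (- (\<theta> * (real n * b - 13) / sqrt n) + 2 * \<theta> * sqrt n + 24 / (1 - \<theta> * L) ^ 5 * \<theta>\<^sup>2)"
        using elim cJ \<theta> L by (intro truncated_square_sum_tail) auto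
      also have "\<dots> \<le> exp (- (s + 2 * \<eta>) * sqrt n)"
      proof -
        have n: "sqrt n > 0" using elim by simp
        have "real n / sqrt n = sqrt n" by (rule real_div_sqrt) simp
        then have "\<theta> * (real n * b - 13) / sqrt n = \<theta> * b * sqrt n - 13 * \<theta> / sqrt n"
          by (simp add: diff_divide_distrib right_diff_distrib) (metis mult.assoc mult.commute times_divide_eq_right)
        moreover have "\<theta> * b * sqrt n - 2 * \<theta> * sqrt n = (s + 4 * \<eta>) * sqrt n"
          unfolding \<eta>(2)[symmetric] by (simp add: algebra_simps)
        ultimately have "- (\<theta> * (real n * b - 13) / sqrt n) + 2 * \<theta> * sqrt n + D \<le> - (s + 2 * \<eta>) * sqrt n"
          using elim(2) by (simp add: algebra_simps)
        then show ?thesis unfolding D_def by simp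
      qed
      finally show "\<P>(\<omega> in Q. (\<lambda>i\<in>{1..n} - T. Z i \<omega>) \<in> ?B T) \<le> exp (- (s + 2 * \<eta>) * sqrt n)" .
    next
      fix x T assume x: "x \<in> K_shell n b 1" "x \<in> {x \<in> space (borel_n n). \<forall>i\<in>{1..n}. x i \<le> L * sqrt n}"
        and T: "T \<subseteq> {1..n}" "card T = 3" "\<And>i. i \<in> T \<Longrightarrow> x i \<le> 2"
      show "restrict x ({1..n} - T) \<in> ?B T"
        using K_shell_removed_square_sum[OF x(1) T] x(2) by (auto simp: space_PiM)
    qed measurable
  qed
  then show ?thesis unfolding negligible_def s_def[symmetric] using \<eta>(1) by blast
qed

lemma negligible_some_large:
  assumes L: "L > sqrt (b - 2)" and b: "b > 2"
  shows "negligible b (\<lambda>n. {x \<in> space (borel_n n). \<exists>i\<in>{1..n}. L * sqrt n < x i})"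
proof -
  define s where "s = sqrt (b - 2)"
  have s: "s > 0" "s < L" using b L by (auto simp: s_def)
  define \<eta> where "\<eta> = (L - s) / 4"
  have \<eta>: "\<eta> > 0" "L = s + 4 * \<eta>" using s by (auto simp: \<eta>_def field_simps)
  have "L > 0" using s by simp
  then have "\<forall>\<^sub>F n in sequentially. L * sqrt (real n) \<ge> 2" by real_asymp
  moreover have "\<forall>\<^sub>F n in sequentially. real n ^ 1 * exp (- (s + 4 * \<eta>) * sqrt (real n)) \<le> exp (- (s + 2 * \<eta>) * sqrt (real n))"
    by (rule eventually_power_times_exp_le[OF \<eta>(1)])
  ultimately have "\<forall>\<^sub>F n in sequentially. controlled n b {x \<in> space (borel_n n). \<exists>i\<in>{1..n}. L * sqrt n < x i}
      (exp (- (s + 2 * \<eta>) * sqrt n))"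
  proof eventually_elim
    case (elim n)
    let ?B = "\<lambda>T. {y \<in> space (PiM ({1..n} - T) (\<lambda>_. borel :: real measure)). \<exists>i\<in>{1..n} - T. L * sqrt n < y i}"
    show ?case
    proof (rule controlledI[where B="?B"])
      fix T :: "nat set" assume T: "T \<subseteq> {1..n}" "card T = 3"
      let ?J = "{1..n} - T"
      have cJ: "card ?J \<le> n" using card_mono[of "{1..n}" ?J] by auto
      have "\<P>(\<omega> in Q. (\<lambda>i\<in>?J. Z i \<omega>) \<in> ?B T) = \<P>(\<omega> in Q. \<exists>i\<in>?J. L * sqrt n < Z i \<omega>)"
        by (rule prob_restrict_eq) auto
      also have "{\<omega> \<in> space Q. \<exists>i\<in>?J. L * sqrt n < Z i \<omega>} = (\<Union>i\<in>?J. {\<omega> \<in> space Q. L * sqrt n < Z i \<omega>})" by auto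
      also have "prob \<dots> \<le> (\<Sum>i\<in>?J. \<P>(\<omega> in Q. L * sqrt n < Z i \<omega>))"
      proof (rule finite_measure_subadditive_finite)
        show "(\<lambda>i. {\<omega> \<in> space Q. L * sqrt n < Z i \<omega>}) ` ?J \<subseteq> events"
        proof safe
          fix i assume "i \<in> {1..n}"
          then have [measurable]: "Z i \<in> borel_measurable Q" by simp
          show "{\<omega> \<in> space Q. L * sqrt n < Z i \<omega>} \<in> events" by measurable
        qed
      qed simp
      also have "\<dots> = real (card ?J) * exp (- (L * sqrt n))"
        using \<open>L > 0\<close> by (simp add: prob_Z_gt)
      also have "\<dots> \<le> real n * exp (- (L * sqrt n))" using cJ by (intro mult_right_mono) auto
      also have "\<dots> \<le> exp (- (s + 2 * \<eta>) * sqrt n)" using elim(2) unfolding \<eta>(2) by (simp only: mult_minus_left power_one_right)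
      finally show "\<P>(\<omega> in Q. (\<lambda>i\<in>?J. Z i \<omega>) \<in> ?B T) \<le> exp (- (s + 2 * \<eta>) * sqrt n)" .
    next
      fix x T assume x: "x \<in> K_shell n b 1" "x \<in> {x \<in> space (borel_n n). \<exists>i\<in>{1..n}. L * sqrt n < x i}"
        and T: "T \<subseteq> {1..n}" "card T = 3" "\<And>i. i \<in> T \<Longrightarrow> x i \<le> 2"
      then obtain i where i: "i \<in> {1..n}" "L * sqrt n < x i" by auto
      with elim(1) T(3)[of i] have "i \<notin> T" by force
      with i show "restrict x ({1..n} - T) \<in> ?B T" by (auto simp: space_PiM)
    qed measurable
  qed
  then show ?thesis unfolding negligible_def s_def[symmetric] using \<eta>(1) by blast
qed

lemma prob_two_gt:
  assumes "i \<noteq> j" "i \<ge> 1" "j \<ge> 1" "a \<ge> 0" "c \<ge> 0"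
  shows "\<P>(\<omega> in Q. a < Z i \<omega> \<and> c < Z j \<omega>) = exp (- a) * exp (- c)"
proof -
  have [measurable]: "Z i \<in> borel_measurable Q" "Z j \<in> borel_measurable Q" using assms by auto
  have "indep_var borel (Z i) borel (\<lambda>\<omega>. \<Sum>l\<in>{j}. Z l \<omega>)"
    by (rule indep_vars_sum) (use assms in \<open>auto intro: indep_vars_subset[OF Z_indep]\<close>)
  then have "indep_var borel (Z i) borel (Z j)" by simp
  from indep_varD[OF this, of "{a<..}" "{c<..}"]
  have "prob ((\<lambda>x. (Z i x, Z j x)) -` ({a<..} \<times> {c<..}) \<inter> space Q) =
     prob (Z i -` {a<..} \<inter> space Q) * prob (Z j -` {c<..} \<inter> space Q)" by simp
  also have "(\<lambda>x. (Z i x, Z j x)) -` ({a<..} \<times> {c<..}) \<inter> space Q = {\<omega> \<in> space Q. a < Z i \<omega> \<and> c < Z j \<omega>}" by auto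
  also have "Z i -` {a<..} \<inter> space Q = {\<omega> \<in> space Q. a < Z i \<omega>}" by auto
  also have "Z j -` {c<..} \<inter> space Q = {\<omega> \<in> space Q. c < Z j \<omega>}" by auto
  finally show ?thesis using assms by (simp add: prob_Z_gt)
qed

lemma negligible_two_large:
  assumes L: "L > 0" "\<epsilon> > 0" "L + \<epsilon> > sqrt (b - 2)" and b: "b > 2"
  shows "negligible b (\<lambda>n. {x \<in> space (borel_n n). \<exists>i\<in>{1..n}. \<exists>j\<in>{1..n}. i \<noteq> j \<and> L * sqrt n < x i \<and> \<epsilon> * sqrt n < x j})"
proof -
  define s where "s = sqrt (b - 2)"
  have s: "s > 0" "s < L + \<epsilon>" using b L by (auto simp: s_def)
  define \<eta> where "\<eta> = (L + \<epsilon> - s) / 4"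
  have \<eta>: "\<eta> > 0" "L + \<epsilon> = s + 4 * \<eta>" using s by (auto simp: \<eta>_def field_simps)
  have "\<forall>\<^sub>F n in sequentially. L * sqrt (real n) \<ge> 2" using L by real_asymp
  moreover have "\<forall>\<^sub>F n in sequentially. \<epsilon> * sqrt (real n) \<ge> 2" using L by real_asymp
  moreover have "\<forall>\<^sub>F n in sequentially. real n ^ 2 * exp (- (s + 4 * \<eta>) * sqrt (real n)) \<le> exp (- (s + 2 * \<eta>) * sqrt (real n))"
    by (rule eventually_power_times_exp_le[OF \<eta>(1)])
  ultimately have "\<forall>\<^sub>F n in sequentially. controlled n b
      {x \<in> space (borel_n n). \<exists>i\<in>{1..n}. \<exists>j\<in>{1..n}. i \<noteq> j \<and> L * sqrt n < x i \<and> \<epsilon> * sqrt n < x j}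
      (exp (- (s + 2 * \<eta>) * sqrt n))"
  proof eventually_elim
    case (elim n)
    let ?B = "\<lambda>T. {y \<in> space (PiM ({1..n} - T) (\<lambda>_. borel :: real measure)).
      \<exists>i\<in>{1..n} - T. \<exists>j\<in>{1..n} - T. i \<noteq> j \<and> L * sqrt n < y i \<and> \<epsilon> * sqrt n < y j}"
    show ?case
    proof (rule controlledI[where B="?B"])
      fix T :: "nat set" assume T: "T \<subseteq> {1..n}" "card T = 3"
      let ?J = "{1..n} - T"
      let ?P = "{p \<in> ?J \<times> ?J. fst p \<noteq> snd p}"
      have fP: "finite ?P" by (rule finite_subset[of _ "?J \<times> ?J"]) auto
      have "card ?P \<le> card ({1..n} \<times> {1..n})" by (rule card_mono) auto
      then have "card ?P \<le> n ^ 2" by (simp add: power2_eq_square)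
      then have "real (card ?P) \<le> real (n ^ 2)" by (simp only: of_nat_le_iff)
      then have cP: "real (card ?P) \<le> real n ^ 2" unfolding of_nat_power .
      let ?E = "\<lambda>p. {\<omega> \<in> space Q. L * sqrt n < Z (fst p) \<omega> \<and> \<epsilon> * sqrt n < Z (snd p) \<omega>}"
      have "\<P>(\<omega> in Q. (\<lambda>i\<in>?J. Z i \<omega>) \<in> ?B T) =
         \<P>(\<omega> in Q. \<exists>i\<in>?J. \<exists>j\<in>?J. i \<noteq> j \<and> L * sqrt n < Z i \<omega> \<and> \<epsilon> * sqrt n < Z j \<omega>)"
        by (rule prob_restrict_eq[OF _ refl]) auto
      also have "{\<omega> \<in> space Q. \<exists>i\<in>?J. \<exists>j\<in>?J. i \<noteq> j \<and> L * sqrt n < Z i \<omega> \<and> \<epsilon> * sqrt n < Z j \<omega>} = (\<Union>p\<in>?P. ?E p)"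
      proof (intro equalityI subsetI)
        fix \<omega> assume "\<omega> \<in> {\<omega> \<in> space Q. \<exists>i\<in>?J. \<exists>j\<in>?J. i \<noteq> j \<and> L * sqrt n < Z i \<omega> \<and> \<epsilon> * sqrt n < Z j \<omega>}"
        then obtain i j where "i \<in> ?J" "j \<in> ?J" "i \<noteq> j" "\<omega> \<in> ?E (i, j)" by auto
        then show "\<omega> \<in> (\<Union>p\<in>?P. ?E p)" by (intro UN_I[of "(i, j)"]) simp_all
      next
        fix \<omega> assume "\<omega> \<in> (\<Union>p\<in>?P. ?E p)"
        then obtain p where "p \<in> ?P" "\<omega> \<in> ?E p" by blast
        then obtain i j where "i \<in> ?J" "j \<in> ?J" "i \<noteq> j" "\<omega> \<in> ?E (i, j)" by (cases p) auto
        then show "\<omega> \<in> {\<omega> \<in> space Q. \<exists>i\<in>?J. \<exists>j\<in>?J. i \<noteq> j \<and> L * sqrt n < Z i \<omega> \<and> \<epsilon> * sqrt n < Z j \<omega>}"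
          unfolding mem_Collect_eq fst_conv snd_conv by blast
      qed
      also have "prob \<dots> \<le> (\<Sum>p\<in>?P. prob (?E p))"
      proof (rule finite_measure_subadditive_finite[OF fP], safe)
        fix i j assume "i \<in> {1..n}" "j \<in> {1..n}"
        then have [measurable]: "Z i \<in> borel_measurable Q" "Z j \<in> borel_measurable Q" by auto
        show "?E (i, j) \<in> events" by simp
      qed
      also have "\<dots> = (\<Sum>p\<in>?P. exp (- (L * sqrt n)) * exp (- (\<epsilon> * sqrt n)))"
        using L by (intro sum.cong refl prob_two_gt) auto
      also have "\<dots> = real (card ?P) * exp (- (s + 4 * \<eta>) * sqrt n)"
        unfolding \<eta>(2)[symmetric] by (simp add: mult_exp_exp algebra_simps)
      also have "\<dots> \<le> real n ^ 2 * exp (- (s + 4 * \<eta>) * sqrt n)" using cP by (intro mult_right_mono) auto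
      also have "\<dots> \<le> exp (- (s + 2 * \<eta>) * sqrt n)" using elim(3) by simp
      finally show "\<P>(\<omega> in Q. (\<lambda>i\<in>?J. Z i \<omega>) \<in> ?B T) \<le> exp (- (s + 2 * \<eta>) * sqrt n)" .
    next
      fix x T assume x: "x \<in> K_shell n b 1"
        "x \<in> {x \<in> space (borel_n n). \<exists>i\<in>{1..n}. \<exists>j\<in>{1..n}. i \<noteq> j \<and> L * sqrt n < x i \<and> \<epsilon> * sqrt n < x j}"
        and T: "T \<subseteq> {1..n}" "card T = 3" "\<And>i. i \<in> T \<Longrightarrow> x i \<le> 2"
      then obtain i j where i: "i \<in> {1..n}" "j \<in> {1..n}" "i \<noteq> j" "L * sqrt n < x i" "\<epsilon> * sqrt n < x j" by auto
      with elim(1,2) T(3)[of i] T(3)[of j] have "i \<notin> T" "j \<notin> T" by force+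
      with i have "i \<in> {1..n} - T" "j \<in> {1..n} - T" by auto
      then have "\<exists>i\<in>{1..n} - T. \<exists>j\<in>{1..n} - T. i \<noteq> j \<and> L * sqrt n < restrict x ({1..n} - T) i \<and>
          \<epsilon> * sqrt n < restrict x ({1..n} - T) j"
        using i by (intro bexI[of _ i] bexI[of _ j]) simp_all
      then show "restrict x ({1..n} - T) \<in> ?B T" unfolding mem_Collect_eq by (simp add: space_PiM)
    qed measurable
  qed
  then show ?thesis unfolding negligible_def s_def[symmetric] using \<eta>(1) by blast
qed

lemma abs_expectation_Z_le:
  fixes f :: "(nat \<Rightarrow> real) \<Rightarrow> real"
  assumes C: "C > 0" "\<And>x. x \<in> Rn k \<Longrightarrow> \<bar>f x\<bar> \<le> C"
  shows "\<bar>expectation (\<lambda>\<omega>. f (\<lambda>i\<in>{1..k}. Z i \<omega>))\<bar> \<le> C"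
proof -
  have "\<bar>expectation (\<lambda>\<omega>. f (\<lambda>i\<in>{1..k}. Z i \<omega>))\<bar> \<le> expectation (\<lambda>\<omega>. \<bar>f (\<lambda>i\<in>{1..k}. Z i \<omega>)\<bar>)"
    by (rule integral_abs_bound)
  also have "\<dots> \<le> expectation (\<lambda>_. C)" by (rule integral_mono_AE') (use C in auto)
  also have "\<dots> = C" by (simp add: prob_space)
  finally show ?thesis .
qed

lemma expectation_block:
  fixes f :: "(nat \<Rightarrow> real) \<Rightarrow> real"
  assumes f: "f \<in> borel_measurable (borel_n k)"
  shows "expectation (\<lambda>\<omega>. f (block k j (\<lambda>i. Z i \<omega>))) = expectation (\<lambda>\<omega>. f (\<lambda>i\<in>{1..k}. Z i \<omega>))"
proof (cases "k = 0")
  case True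
  then show ?thesis by (simp add: block_def restrict_def)
next
  case False
  have *: "distr Q (borel_n k) (\<lambda>\<omega>. \<lambda>i\<in>{1..k}. Z (i + m) \<omega>) = PiM {1..k} (\<lambda>_. density lborel (exponential_density 1))" for m
  proof -
    have "distr Q (borel_n k) (\<lambda>\<omega>. \<lambda>i\<in>{1..k}. Z (i + m) \<omega>) = PiM {1..k} (\<lambda>i. distr Q borel (Z (i + m)))"
      using False by (subst indep_vars_iff_distr_eq_PiM'[symmetric])
        (auto intro!: Z_shift_indep)
    also have "\<dots> = PiM {1..k} (\<lambda>_. density lborel (exponential_density 1))"
      by (intro PiM_cong refl distr_Z) auto
    finally show ?thesis .
  qed
  have m: "(\<lambda>\<omega>. \<lambda>i\<in>{1..k}. Z (i + m) \<omega>) \<in> measurable Q (borel_n k)" for m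
    by (intro measurable_restrict Z_measurable) auto
  have e: "expectation (\<lambda>\<omega>. f (\<lambda>i\<in>{1..k}. Z (i + m) \<omega>)) =
    (\<integral>x. f x \<partial>PiM {1..k} (\<lambda>_. density lborel (exponential_density 1)))" for m
    unfolding *[of m, symmetric] by (rule integral_distr[OF m f, symmetric])
  show ?thesis using e[of "j * Suc k"] e[of 0] by (simp add: block_def add.commute)
qed

lemma block_indep:
  fixes f :: "(nat \<Rightarrow> real) \<Rightarrow> real"
  assumes f: "f \<in> borel_measurable (borel_n k)"
  shows "indep_vars (\<lambda>_. borel) (\<lambda>j \<omega>. f (block k j (\<lambda>i. Z i \<omega>))) UNIV"
proof -
  let ?K = "\<lambda>j. {j * Suc k + 1..j * Suc k + k}"
  have dis: "disjoint_family_on ?K UNIV"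
  proof -
    have "(l - 1) div Suc k = j" if "l \<in> ?K j" for l j
    proof -
      have "l - 1 = (l - 1 - j * Suc k) + j * Suc k" "l - 1 - j * Suc k < Suc k" using that by auto
      then show ?thesis by (metis div_less div_mult_self3 nat.simps(3) plus_nat.add_0 add.commute)
    qed
    then show ?thesis unfolding disjoint_family_on_def by blast
  qed
  have "indep_vars (\<lambda>j. PiM (?K j) (\<lambda>_. borel)) (\<lambda>j \<omega>. restrict (\<lambda>i. Z i \<omega>) (?K j)) UNIV"
    by (rule indep_vars_restrict[OF Z_indep _ dis]) auto
  from indep_vars_compose2[OF this, of "\<lambda>j x. f (block k j x)" "\<lambda>_. borel"]
  have "indep_vars (\<lambda>_. borel) (\<lambda>j \<omega>. f (block k j (restrict (\<lambda>i. Z i \<omega>) (?K j)))) UNIV"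
    using measurable_compose[OF block_measurable f] by auto
  then show ?thesis by (simp only: block_restrict[OF subset_refl])
qed

text \<open>By Hoeffding's inequality the empirical average of a bounded function over blocks deviates
  from its mean with a probability that is exponentially small in \<open>n\<close>, hence negligible against
  the conditioning, which costs only \<open>exp (O(\<surd>n))\<close>.\<close>

lemma negligible_block_deviation:
  fixes f :: "(nat \<Rightarrow> real) \<Rightarrow> real" and b :: real
  assumes f: "f \<in> borel_measurable (borel_n k)" and C: "C > 0" "\<And>x. x \<in> Rn k \<Longrightarrow> \<bar>f x\<bar> \<le> C"
    and \<delta>: "\<delta> > 0"
  defines "\<mu> \<equiv> expectation (\<lambda>\<omega>. f (\<lambda>i\<in>{1..k}. Z i \<omega>))"
  shows "negligible b (\<lambda>n. {x \<in> space (borel_n n).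
     \<delta> * real (n div Suc k) \<le> \<bar>\<Sum>j<n div Suc k. f (block k j x) - \<mu>\<bar>})"
proof -
  define s where "s = sqrt (b - 2)"
  have f': "f (block k j x) \<in> {- C..C}" for j x using C(2)[OF block_in_Rn, of j x] by (auto simp: abs_le_iff)
  have \<mu>: "\<bar>\<mu>\<bar> \<le> C" unfolding \<mu>_def by (rule abs_expectation_Z_le[OF C])
  have "\<forall>\<^sub>F n in sequentially. 12 * C \<le> \<delta> * (real n / real (Suc k) - 1)" using \<delta> by real_asymp
  moreover have "\<forall>\<^sub>F n in sequentially. 4 \<le> real n / real (Suc k) - 1" by real_asymp
  moreover have "\<forall>\<^sub>F n in sequentially. 2 * exp (- (\<delta>\<^sup>2 * (real n / real (Suc k) - 1) / (8 * C\<^sup>2))) \<le> exp (- (s + 2 * 1) * sqrt (real n))"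
  proof -
    define c where "c = \<delta>\<^sup>2 / (8 * C\<^sup>2)"
    have "c > 0" using \<delta> C by (simp add: c_def)
    then have "\<forall>\<^sub>F n in sequentially. (s + 2) * sqrt (real n) + 1 \<le> c * (real n / real (Suc k) - 1)"
      by real_asymp
    then show ?thesis
    proof eventually_elim
      case (elim n)
      have "2 * exp (- (c * (real n / real (Suc k) - 1))) \<le> exp 1 * exp (- (c * (real n / real (Suc k) - 1)))"
        using exp_ge_add_one_self[of 1] by (intro mult_right_mono) auto
      also have "\<dots> \<le> exp (- (s + 2) * sqrt (real n))"
        using elim by (simp add: mult_exp_exp algebra_simps)
      finally show ?case by (simp add: c_def)
    qed
  qed
  ultimately have "\<forall>\<^sub>F n in sequentially. controlled n b {x \<in> space (borel_n n).
     \<delta> * real (n div Suc k) \<le> \<bar>\<Sum>j<n div Suc k. f (block k j x) - \<mu>\<bar>} (exp (- (s + 2 * 1) * sqrt (real n)))"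
  proof eventually_elim
    case (elim n)
    define m where "m = n div Suc k"
    have mn: "real m \<ge> real n / real (Suc k) - 1"
    proof -
      have "n \<le> m * Suc k + Suc k" unfolding m_def
        by (metis div_mult_mod_eq add_left_mono less_imp_le mod_less_divisor zero_less_Suc)
      then have "real n \<le> real (m * Suc k + Suc k)" by (simp only: of_nat_le_iff)
      then have "real n \<le> (real m + 1) * real (Suc k)" by (simp add: algebra_simps)
      then show ?thesis by (simp add: field_simps)
    qed
    have m1: "12 * C \<le> \<delta> * real m" using elim(1) mn \<delta> by (meson mult_left_mono order_trans less_imp_le)
    have m2: "real m \<ge> 4" using elim(2) mn by linarith
    let ?K = "\<lambda>j. {j * Suc k + 1..j * Suc k + k}"
    define S where "S T = {j \<in> {..<m}. ?K j \<inter> T = {}}" for T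
    have SJ: "?K j \<subseteq> {1..n} - T" if "j \<in> S T" for j T
      using that block_range[of j n k] by (auto simp: S_def m_def)
    have finS: "finite (S T)" for T by (simp add: S_def)
    let ?B = "\<lambda>T. {y \<in> space (PiM ({1..n} - T) (\<lambda>_. borel :: real measure)).
      \<delta> * real m / 2 \<le> \<bar>\<Sum>j\<in>S T. f (block k j y) - \<mu>\<bar>}"
    \<comment> \<open>The blocks are disjoint, so each of the three dropped coordinates spoils at most one block.\<close>
    have cardS: "card ({..<m} - S T) \<le> 3" if T: "T \<subseteq> {1..n}" "card T = 3" for T
    proof -
      have fT: "finite T" using T by (metis card.infinite zero_neq_numeral)
      have "{..<m} - S T \<subseteq> (\<lambda>l. (l - 1) div Suc k) ` T"
      proof
        fix j assume "j \<in> {..<m} - S T"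
        then obtain l where l: "l \<in> ?K j" "l \<in> T" unfolding S_def by blast
        have "l - 1 = (l - 1 - j * Suc k) + j * Suc k" "l - 1 - j * Suc k < Suc k" using l by auto
        then have "(l - 1) div Suc k = j" by (metis div_less div_mult_self3 nat.simps(3) plus_nat.add_0 add.commute)
        with l show "j \<in> (\<lambda>l. (l - 1) div Suc k) ` T" by blast
      qed
      then have "card ({..<m} - S T) \<le> card ((\<lambda>l. (l - 1) div Suc k) ` T)" using fT by (intro card_mono) auto
      also have "\<dots> \<le> 3" using card_image_le[OF fT] T by metis
      finally show ?thesis .
    qed
    show ?case unfolding m_def[symmetric]
    proof (rule controlledI[where B="?B"])
      have [measurable]: "(\<lambda>x. f (block k j x)) \<in> borel_measurable (borel_n n)" if "j \<in> {..<m}" for j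
        using that by (intro measurable_compose[OF block_measurable f] block_range) (auto simp: m_def)
      show "{x \<in> space (borel_n n). \<delta> * real m \<le> \<bar>\<Sum>j<m. f (block k j x) - \<mu>\<bar>} \<in> sets (borel_n n)"
        by measurable
    next
      fix T :: "nat set" assume T: "T \<subseteq> {1..n}" "card T = 3"
      have [measurable]: "(\<lambda>x. f (block k j x)) \<in> borel_measurable (PiM ({1..n} - T) (\<lambda>_. borel))" if "j \<in> S T" for j
        using that SJ by (intro measurable_compose[OF block_measurable f]) auto
      show "?B T \<in> sets (PiM ({1..n} - T) (\<lambda>_. borel))" by measurable
    next
      fix x T assume x: "x \<in> K_shell n b 1" "x \<in> {x \<in> space (borel_n n). \<delta> * real m \<le> \<bar>\<Sum>j<m. f (block k j x) - \<mu>\<bar>}"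
        and T: "T \<subseteq> {1..n}" "card T = 3"
      let ?g = "\<lambda>j. f (block k j x) - \<mu>"
      have g: "\<bar>?g j\<bar> \<le> 2 * C" for j using f'[of j x] \<mu> by (auto simp: abs_le_iff)
      have "(\<Sum>j<m. ?g j) = (\<Sum>j\<in>{..<m} - S T. ?g j) + (\<Sum>j\<in>S T. ?g j)"
        by (rule sum.subset_diff) (auto simp: S_def)
      moreover have "\<bar>\<Sum>j\<in>{..<m} - S T. ?g j\<bar> \<le> 6 * C"
      proof -
        have "\<bar>\<Sum>j\<in>{..<m} - S T. ?g j\<bar> \<le> (\<Sum>j\<in>{..<m} - S T. 2 * C)"
          by (rule order_trans[OF sum_abs]) (intro sum_mono g)
        also have "\<dots> = real (card ({..<m} - S T)) * (2 * C)" by simp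
        also have "\<dots> \<le> 3 * (2 * C)" using cardS[OF T] C by (intro mult_right_mono) auto
        finally show ?thesis by simp
      qed
      ultimately have "\<delta> * real m / 2 \<le> \<bar>\<Sum>j\<in>S T. ?g j\<bar>" using x(2) m1 by auto
      moreover have "(\<Sum>j\<in>S T. f (block k j (restrict x ({1..n} - T))) - \<mu>) = (\<Sum>j\<in>S T. ?g j)"
        by (intro sum.cong refl) (simp only: block_restrict[OF SJ])
      ultimately show "restrict x ({1..n} - T) \<in> ?B T" by (simp add: space_PiM)
    next
      fix T :: "nat set" assume T: "T \<subseteq> {1..n}" "card T = 3"
      let ?X = "\<lambda>j \<omega>. f (block k j (\<lambda>i. Z i \<omega>))"
      have ind: "indep_vars (\<lambda>_. borel) ?X (S T)"
        by (rule indep_vars_subset[OF block_indep[OF f]]) auto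
      interpret H: Hoeffding_ineq Q "S T" ?X "\<lambda>_. - C" "\<lambda>_. C" "\<Sum>j\<in>S T. expectation (?X j)"
        by unfold_locales (use finS ind f' in auto)
      have eS: "(\<Sum>j\<in>S T. expectation (?X j)) = (\<Sum>j\<in>S T. \<mu>)"
        unfolding \<mu>_def by (intro sum.cong refl expectation_block f)
      have "card {..<m} \<le> card ({..<m} - S T) + card (S T)"
        by (rule order_trans[OF card_mono card_Un_le]) (auto simp: S_def)
      then have cS: "card (S T) \<ge> 1" using cardS[OF T] m2 by simp
      have cS2: "card (S T) \<le> m" using card_mono[of "{..<m}" "S T"] by (auto simp: S_def)
      have pos: "(\<Sum>i\<in>S T. (C - - C)\<^sup>2) > 0" using cS C by simp
      have "\<P>(\<omega> in Q. (\<lambda>i\<in>{1..n} - T. Z i \<omega>) \<in> ?B T) =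
        \<P>(\<omega> in Q. \<delta> * real m / 2 \<le> \<bar>(\<Sum>j\<in>S T. ?X j \<omega>) - (\<Sum>j\<in>S T. expectation (?X j))\<bar>)"
      proof (rule prob_restrict_eq[OF _ refl])
        fix \<omega>
        have "(\<Sum>j\<in>S T. f (block k j (\<lambda>i\<in>{1..n} - T. Z i \<omega>)) - \<mu>) = (\<Sum>j\<in>S T. ?X j \<omega> - \<mu>)"
          by (intro sum.cong refl) (simp only: block_restrict[OF SJ])
        then show "(\<delta> * real m / 2 \<le> \<bar>\<Sum>j\<in>S T. f (block k j (\<lambda>i\<in>{1..n} - T. Z i \<omega>)) - \<mu>\<bar>) =
          (\<delta> * real m / 2 \<le> \<bar>(\<Sum>j\<in>S T. ?X j \<omega>) - (\<Sum>j\<in>S T. expectation (?X j))\<bar>)"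
          unfolding eS by (simp add: sum_subtractf)
      qed auto
      also have "\<dots> \<le> 2 * exp (- 2 * (\<delta> * real m / 2)\<^sup>2 / (\<Sum>i\<in>S T. (C - - C)\<^sup>2))"
        using \<delta> by (intro H.Hoeffding_ineq_abs_ge pos) auto
      also have "\<dots> \<le> 2 * exp (- (\<delta>\<^sup>2 * (real n / real (Suc k) - 1) / (8 * C\<^sup>2)))"
      proof -
        have "(\<Sum>i\<in>S T. (C - - C)\<^sup>2) = real (card (S T)) * (4 * C\<^sup>2)" by (simp add: power2_eq_square)
        also have "\<dots> \<le> real m * (4 * C\<^sup>2)" using cS2 by (intro mult_right_mono) auto
        finally have d: "(\<Sum>i\<in>S T. (C - - C)\<^sup>2) \<le> real m * (4 * C\<^sup>2)" .
        have "\<delta>\<^sup>2 * (real n / real (Suc k) - 1) / (8 * C\<^sup>2) \<le> \<delta>\<^sup>2 * real m / (8 * C\<^sup>2)"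
          using mn by (intro divide_right_mono mult_left_mono) auto
        also have "\<dots> = 2 * (\<delta> * real m / 2)\<^sup>2 / (real m * (4 * C\<^sup>2))"
          using m2 C by (simp add: power2_eq_square field_simps)
        also have "\<dots> \<le> 2 * (\<delta> * real m / 2)\<^sup>2 / (\<Sum>i\<in>S T. (C - - C)\<^sup>2)"
          using pos by (intro divide_left_mono d mult_pos_pos) (use m2 C in auto)
        finally show ?thesis by simp
      qed
      also have "\<dots> \<le> exp (- (s + 2 * 1) * sqrt (real n))" using elim(3) .
      finally show "\<P>(\<omega> in Q. (\<lambda>i\<in>{1..n} - T. Z i \<omega>) \<in> ?B T) \<le> exp (- (s + 2 * 1) * sqrt (real n))" .
    qed
  qed
  then show ?thesis unfolding negligible_def s_def[symmetric] by (intro exI[of _ 1]) auto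
qed

end

section \<open>Passing from shells to the uniform distribution\<close>

lemma continuous_on_coordinate: "continuous_on S (\<lambda>x :: nat \<Rightarrow> real. x i)"
  by (rule continuous_on_subset[OF continuous_on_product_coordinates]) simp

lemma continuous_on_Max:
  fixes g :: "'i \<Rightarrow> 'a::topological_space \<Rightarrow> real"
  assumes "finite I" "I \<noteq> {}" "\<And>i. i \<in> I \<Longrightarrow> continuous_on S (g i)"
  shows "continuous_on S (\<lambda>x. Max ((\<lambda>i. g i x) ` I))"
  using assms
proof (induction I rule: finite_ne_induct)
  case (insert i I)
  have "continuous_on S (\<lambda>x. max (g i x) (Max ((\<lambda>i. g i x) ` I)))"
    using insert by (intro continuous_on_max) auto
  then show ?case using insert.hyps by simp
qed simp

lemma continuous_on_restrict_indices:
  "continuous_on S (\<lambda>x :: nat \<Rightarrow> real. \<lambda>i\<in>I. x (g i))"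
proof (rule continuous_on_coordinatewise_then_product)
  fix i show "continuous_on S (\<lambda>x. (\<lambda>i\<in>I. x (g i)) i)"
    by (cases "i \<in> I") (auto intro: continuous_on_coordinate)
qed

lemma continuous_on_Rn_measurable:
  fixes f :: "(nat \<Rightarrow> real) \<Rightarrow> real"
  assumes "continuous_on (Rn n) f"
  shows "f \<in> borel_measurable (borel_n n)"
proof -
  have "continuous_on UNIV (\<lambda>x. f (\<lambda>i\<in>{1..n}. x i))"
    by (rule continuous_on_compose2[OF assms continuous_on_restrict_indices]) auto
  then have m: "(\<lambda>x. f (\<lambda>i\<in>{1..n}. x i)) \<in> borel_measurable borel"
    by (rule borel_measurable_continuous_onI)
  have "(\<lambda>x. x) \<in> measurable (borel_n n) (borel :: (nat \<Rightarrow> real) measure)"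
  proof (rule measurable_coordinatewise_then_product)
    fix i :: nat
    show "(\<lambda>x. x i) \<in> borel_measurable (borel_n n)"
    proof (cases "i \<in> {1..n}")
      case False
      then have "(\<lambda>x. x i) \<in> borel_measurable (borel_n n) \<longleftrightarrow> (\<lambda>x. undefined :: real) \<in> borel_measurable (borel_n n)"
        by (intro measurable_cong) (auto simp: space_PiM PiE_def extensional_def)
      then show ?thesis by simp
    qed simp
  qed
  from measurable_compose[OF this m]
  have "(\<lambda>x. f (\<lambda>i\<in>{1..n}. x i)) \<in> borel_measurable (borel_n n)" .
  moreover have "(\<lambda>x. f (\<lambda>i\<in>{1..n}. x i)) \<in> borel_measurable (borel_n n) \<longleftrightarrow> f \<in> borel_measurable (borel_n n)"
  proof (rule measurable_cong)
    fix x assume "x \<in> space (borel_n n)"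
    then have "restrict x {1..n} = x" unfolding space_PiM by (rule PiE_restrict)
    then show "f (\<lambda>i\<in>{1..n}. x i) = f x" by simp
  qed
  ultimately show ?thesis by simp
qed

lemma emeasure_uniform_measure_le_1: "S \<in> sets M \<Longrightarrow> B \<in> sets M \<Longrightarrow> emeasure (uniform_measure M S) B \<le> 1"
proof -
  assume S: "S \<in> sets M" and B: "B \<in> sets M"
  have "emeasure (uniform_measure M S) B = emeasure M (S \<inter> B) / emeasure M S"
    using S B by simp
  also have "\<dots> \<le> emeasure M S / emeasure M S"
    using S by (intro divide_right_mono_ennreal emeasure_mono) auto
  also have "\<dots> \<le> 1"
  proof (cases "emeasure M S")
    case (real r)
    then show ?thesis by (cases "r = 0") (simp_all add: divide_ennreal)
  qed (simp add: divide_ennreal_def)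
  finally show ?thesis .
qed

lemma uniform_on_K_D:
  assumes "uniform_on_K n b \<mu>"
  shows "prob_space \<mu>" "sets \<mu> = sets (borel_n n)" "space \<mu> = Rn n" "AE x in \<mu>. x \<in> K_set n b"
proof -
  interpret prob_space \<mu> using assms by (simp add: uniform_on_K_def)
  show "prob_space \<mu>" by (rule prob_space_axioms)
  show s: "sets \<mu> = sets (borel_n n)" using assms by (simp add: uniform_on_K_def)
  show "space \<mu> = Rn n" using sets_eq_imp_space_eq[OF s] by (simp add: space_PiM)
  have "emeasure \<mu> (K_set n b) = 1" using assms by (simp add: uniform_on_K_def)
  then have "prob (K_set n b) = 1" by (simp add: emeasure_eq_measure)
  then show "AE x in \<mu>. x \<in> K_set n b" by (rule AE_prob_1)
qed

text \<open>One half of the portmanteau theorem, with a continuous ramp between the levels \<open>a\<close> and \<open>c\<close>.\<close>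

lemma uniform_on_K_tail_le:
  fixes h :: "(nat \<Rightarrow> real) \<Rightarrow> real"
  assumes \<mu>: "uniform_on_K n b \<mu>" and h: "continuous_on (Rn n) h" and ac: "a < c"
    and A: "A \<in> sets (borel_n n)" "\<And>x. x \<in> Rn n \<Longrightarrow> a < h x \<Longrightarrow> x \<in> A"
    and p: "\<And>\<epsilon>. 0 < \<epsilon> \<Longrightarrow> \<epsilon> \<le> 1 \<Longrightarrow> measure (shell_law n b \<epsilon>) A \<le> p"
  shows "measure \<mu> {x \<in> space \<mu>. c \<le> h x} \<le> p"
proof -
  note D = uniform_on_K_D[OF \<mu>]
  interpret \<mu>: prob_space \<mu> by (rule D)
  define f where "f x = max 0 (min 1 ((h x - a) / (c - a)))" for x
  have f01: "0 \<le> f x" "f x \<le> 1" for x by (auto simp: f_def)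
  have contf: "continuous_on (Rn n) f"
    unfolding f_def using ac by (intro continuous_intros h) auto
  have meas[measurable]: "h \<in> borel_measurable (borel_n n)" "f \<in> borel_measurable (borel_n n)"
    using continuous_on_Rn_measurable h contf by auto
  have meas'[measurable]: "h \<in> borel_measurable \<mu>" "f \<in> borel_measurable \<mu>"
    using meas by (simp_all add: measurable_cong_sets[OF D(2) refl])
  have lim: "((\<lambda>\<epsilon>. \<integral>x. f x \<partial>shell_law n b \<epsilon>) \<longlongrightarrow> (\<integral>x. f x \<partial>\<mu>)) (at_right 0)"
  proof -
    have "bounded (f ` Rn n)" using f01 by (intro boundedI[where B=1]) auto
    then show ?thesis using \<mu> contf by (simp add: uniform_on_K_def weak_conv_n_def)
  qed
  have "\<forall>\<^sub>F \<epsilon> in at_right (0::real). (\<integral>x. f x \<partial>shell_law n b \<epsilon>) \<le> p"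
  proof -
    have "\<forall>\<^sub>F \<epsilon> in at_right (0::real). \<epsilon> \<in> {0<..<1}"
      by (rule eventually_at_right_real) simp
    then show ?thesis
    proof eventually_elim
      case (elim \<epsilon>)
      let ?\<nu> = "shell_law n b \<epsilon>"
      have sK: "K_shell n b \<epsilon> \<in> sets (lborel_n n)" unfolding sets_PiM_lborel_borel by (rule K_shell_measurable)
      have s\<nu>: "sets ?\<nu> = sets (borel_n n)" by (simp only: sets_uniform_measure sets_PiM_lborel_borel)
      have A\<nu>: "A \<in> sets ?\<nu>" using A s\<nu> by simp
      have fin: "emeasure ?\<nu> A \<le> 1"
        by (rule emeasure_uniform_measure_le_1[OF sK]) (use A in \<open>simp only: sets_PiM_lborel_borel\<close>)
      have "(\<integral>x. f x \<partial>?\<nu>) \<le> (\<integral>x. indicator A x \<partial>?\<nu>)"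
      proof (rule integral_mono')
        show "integrable ?\<nu> (indicator A :: _ \<Rightarrow> real)"
          using A\<nu> fin by (intro integrable_real_indicator) (auto intro: le_less_trans)
        fix x assume "x \<in> space ?\<nu>"
        then have x: "x \<in> Rn n" by simp
        show "f x \<le> indicator A x"
        proof (cases "a < h x")
          case True
          then show ?thesis using A(2)[OF x] f01 by simp
        next
          case False
          then have "f x = 0" using ac by (auto simp: f_def divide_le_0_iff)
          then show ?thesis by simp
        qed
      qed simp
      also have "\<dots> = measure ?\<nu> A" using A\<nu> sets.sets_into_space[OF A\<nu>] by (simp add: Int_absorb2)
      also have "\<dots> \<le> p" using elim by (intro p) auto
      finally show ?case .
    qed
  qed
  then have le: "(\<integral>x. f x \<partial>\<mu>) \<le> p" by (intro tendsto_upperbound[OF lim]) auto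
  have "measure \<mu> {x \<in> space \<mu>. c \<le> h x} = (\<integral>x. indicator {x \<in> space \<mu>. c \<le> h x} x \<partial>\<mu>)"
    by simp
  also have "\<dots> \<le> (\<integral>x. f x \<partial>\<mu>)"
  proof (rule integral_mono)
    show "integrable \<mu> f" by (rule \<mu>.integrable_const_bound[where B=1]) (use f01 in auto)
    show "integrable \<mu> (indicator {x \<in> space \<mu>. c \<le> h x} :: _ \<Rightarrow> real)"
      by (intro integrable_real_indicator) (auto simp: \<mu>.emeasure_eq_measure)
    show "indicator {x \<in> space \<mu>. c \<le> h x} x \<le> f x" for x
      using f01[of x] ac by (auto simp: f_def field_simps split: split_indicator)
  qed
  finally show ?thesis using le by simp
qed

lemma lborel_n_permute:
  assumes \<sigma>: "bij_betw \<sigma> {1..n} {1..n}"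
  shows "distr (lborel_n n) (lborel_n n) (\<lambda>x. \<lambda>i\<in>{1..n}. x (\<sigma> i)) = lborel_n n"
proof -
  interpret pl: product_sigma_finite "\<lambda>_::nat. lborel :: real measure" by unfold_locales
  define \<tau> where "\<tau> = the_inv_into {1..n} \<sigma>"
  have inj: "inj_on \<sigma> {1..n}" and img: "\<sigma> ` {1..n} = {1..n}" using \<sigma> by (auto simp: bij_betw_def)
  have \<sigma>in: "\<sigma> i \<in> {1..n}" if "i \<in> {1..n}" for i using img that by blast
  have \<tau>: "\<tau> (\<sigma> i) = i" if "i \<in> {1..n}" for i unfolding \<tau>_def by (rule the_inv_into_f_f[OF inj that])
  have meas: "(\<lambda>x. \<lambda>i\<in>{1..n}. x (\<sigma> i)) \<in> measurable (lborel_n n) (lborel_n n)"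
    using \<sigma>in by (intro measurable_restrict measurable_component_singleton) auto
  show ?thesis
  proof (rule pl.PiM_eqI)
    fix A :: "nat \<Rightarrow> real set" assume A: "\<And>i. i \<in> {1..n} \<Longrightarrow> A i \<in> sets lborel"
    have \<tau>in: "\<tau> i \<in> {1..n}" if i: "i \<in> {1..n}" for i
    proof -
      obtain l where "l \<in> {1..n}" "i = \<sigma> l" using img i by blast
      then show ?thesis using \<tau> by simp
    qed
    have pre: "(\<lambda>x. \<lambda>i\<in>{1..n}. x (\<sigma> i)) -` (Pi\<^sub>E {1..n} A) \<inter> space (lborel_n n) = Pi\<^sub>E {1..n} (\<lambda>i. A (\<tau> i))"
    proof (intro equalityI subsetI)
      fix x assume "x \<in> (\<lambda>x. \<lambda>i\<in>{1..n}. x (\<sigma> i)) -` (Pi\<^sub>E {1..n} A) \<inter> space (lborel_n n)"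
      then have x: "x \<in> extensional {1..n}" "\<And>i. i \<in> {1..n} \<Longrightarrow> x (\<sigma> i) \<in> A i"
        by (auto simp: PiE_iff)
      show "x \<in> Pi\<^sub>E {1..n} (\<lambda>i. A (\<tau> i))"
      proof (rule PiE_I)
        fix i assume "i \<in> {1..n}"
        then obtain l where "l \<in> {1..n}" "i = \<sigma> l" using img by blast
        then show "x i \<in> A (\<tau> i)" using x(2)[of l] \<tau>[of l] by simp
      qed (use x(1) in \<open>auto simp: extensional_def\<close>)
    next
      fix x assume x: "x \<in> Pi\<^sub>E {1..n} (\<lambda>i. A (\<tau> i))"
      have "x (\<sigma> i) \<in> A i" if "i \<in> {1..n}" for i
        using PiE_mem[OF x \<sigma>in[OF that]] \<tau>[OF that] by simp
      then show "x \<in> (\<lambda>x. \<lambda>i\<in>{1..n}. x (\<sigma> i)) -` (Pi\<^sub>E {1..n} A) \<inter> space (lborel_n n)"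
        using x by (auto simp: PiE_iff)
    qed
    have "emeasure (distr (lborel_n n) (lborel_n n) (\<lambda>x. \<lambda>i\<in>{1..n}. x (\<sigma> i))) (Pi\<^sub>E {1..n} A) =
        emeasure (lborel_n n) (Pi\<^sub>E {1..n} (\<lambda>i. A (\<tau> i)))"
      using A by (subst emeasure_distr[OF meas]) (auto simp only: pre intro!: sets_PiM_I_finite)
    also have "\<dots> = (\<Prod>i\<in>{1..n}. emeasure lborel (A (\<tau> i)))"
      using A \<tau>in by (intro pl.emeasure_PiM) auto
    also have "\<dots> = (\<Prod>i\<in>{1..n}. emeasure lborel (A i))"
      using prod.reindex_bij_betw[OF \<sigma>, of "\<lambda>i. emeasure lborel (A (\<tau> i))"] \<tau> by simp
    finally show "emeasure (distr (lborel_n n) (lborel_n n) (\<lambda>x. \<lambda>i\<in>{1..n}. x (\<sigma> i))) (Pi\<^sub>E {1..n} A) =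
      (\<Prod>i\<in>{1..n}. emeasure lborel (A i))" .
  qed simp_all
qed

text \<open>The coordinates of a uniform point are exchangeable, because the shells are invariant under
  permutations of the coordinates.\<close>

lemma uniform_on_K_permute:
  fixes f :: "(nat \<Rightarrow> real) \<Rightarrow> real"
  assumes \<mu>: "uniform_on_K n b \<mu>" and \<sigma>: "bij_betw \<sigma> {1..n} {1..n}"
    and f: "continuous_on (Rn n) f" "bounded (f ` Rn n)"
  shows "(\<integral>x. f (\<lambda>i\<in>{1..n}. x (\<sigma> i)) \<partial>\<mu>) = (\<integral>x. f x \<partial>\<mu>)"
proof -
  let ?\<phi> = "\<lambda>x :: nat \<Rightarrow> real. \<lambda>i\<in>{1..n}. x (\<sigma> i)"
  have \<sigma>in: "\<sigma> i \<in> {1..n}" if "i \<in> {1..n}" for i using \<sigma> that by (auto simp: bij_betw_def)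
  have \<phi>Rn: "?\<phi> x \<in> Rn n" for x by auto
  have \<phi>m: "?\<phi> \<in> measurable (lborel_n n) (lborel_n n)"
    using \<sigma>in by (intro measurable_restrict measurable_component_singleton) auto
  have f': "continuous_on (Rn n) (\<lambda>x. f (?\<phi> x))" "bounded ((\<lambda>x. f (?\<phi> x)) ` Rn n)"
    by (rule continuous_on_compose2[OF f(1) continuous_on_restrict_indices], force)
       (rule bounded_subset[OF f(2)], force)
  have eq: "(\<integral>x. f (?\<phi> x) \<partial>shell_law n b \<epsilon>) =
     (\<integral>x. f x \<partial>shell_law n b \<epsilon>)" for \<epsilon>
  proof -
    let ?\<nu> = "shell_law n b \<epsilon>"
    have sK: "K_shell n b \<epsilon> \<in> sets (lborel_n n)" unfolding sets_PiM_lborel_borel by (rule K_shell_measurable)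
    have \<phi>m': "?\<phi> \<in> measurable ?\<nu> (lborel_n n)" using \<phi>m by (simp add: measurable_cong_sets[OF sets_uniform_measure refl])
    have inv: "?\<phi> x \<in> K_shell n b \<epsilon> \<longleftrightarrow> x \<in> K_shell n b \<epsilon>" if x: "x \<in> Rn n" for x
    proof -
      have s: "(\<Sum>i=1..n. g (?\<phi> x i)) = (\<Sum>i=1..n. g (x i))" for g :: "real \<Rightarrow> real"
        using sum.reindex_bij_betw[OF \<sigma>, of "\<lambda>i. g (x i)"] by simp
      have "(\<forall>i\<in>{1..n}. x (\<sigma> i) > 0) \<longleftrightarrow> (\<forall>i\<in>{1..n}. x i > 0)"
        using \<sigma> by (metis bij_betw_imp_surj_on imageE imageI)
      then show ?thesis using x s[of "\<lambda>v. v"] s[of "\<lambda>v. v\<^sup>2"] by (auto simp: K_shell_def PiE_iff)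
    qed
    have d: "distr ?\<nu> (lborel_n n) ?\<phi> = ?\<nu>"
    proof (rule measure_eqI)
      fix B assume "B \<in> sets (distr ?\<nu> (lborel_n n) ?\<phi>)"
      then have B: "B \<in> sets (lborel_n n)" by simp
      have preB: "?\<phi> -` B \<inter> space (lborel_n n) \<in> sets (lborel_n n)" by (rule measurable_sets[OF \<phi>m B])
      have "emeasure (distr ?\<nu> (lborel_n n) ?\<phi>) B = emeasure ?\<nu> (?\<phi> -` B \<inter> space (lborel_n n))"
        by (subst emeasure_distr[OF \<phi>m' B]) simp
      also have "\<dots> = emeasure (lborel_n n) (K_shell n b \<epsilon> \<inter> (?\<phi> -` B \<inter> space (lborel_n n))) / emeasure (lborel_n n) (K_shell n b \<epsilon>)"
        by (rule emeasure_uniform_measure[OF sK preB])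
      also have "K_shell n b \<epsilon> \<inter> (?\<phi> -` B \<inter> space (lborel_n n)) = ?\<phi> -` (K_shell n b \<epsilon> \<inter> B) \<inter> space (lborel_n n)"
        using inv by auto
      also have "emeasure (lborel_n n) \<dots> = emeasure (distr (lborel_n n) (lborel_n n) ?\<phi>) (K_shell n b \<epsilon> \<inter> B)"
        by (rule emeasure_distr[OF \<phi>m, symmetric]) (use sK B in auto)
      also have "\<dots> = emeasure (lborel_n n) (K_shell n b \<epsilon> \<inter> B)" by (simp only: lborel_n_permute[OF \<sigma>])
      also have "\<dots> / emeasure (lborel_n n) (K_shell n b \<epsilon>) = emeasure ?\<nu> B"
        by (rule emeasure_uniform_measure[OF sK B, symmetric])
      finally show "emeasure (distr ?\<nu> (lborel_n n) ?\<phi>) B = emeasure ?\<nu> B" .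
    qed simp
    have fm: "f \<in> borel_measurable (lborel_n n)"
      using continuous_on_Rn_measurable[OF f(1)] by (simp add: measurable_cong_sets[OF sets_PiM_lborel_borel refl])
    show ?thesis using integral_distr[OF \<phi>m' fm] unfolding d by simp
  qed
  have "((\<lambda>\<epsilon>. \<integral>x. f x \<partial>shell_law n b \<epsilon>) \<longlongrightarrow> (\<integral>x. f (?\<phi> x) \<partial>\<mu>)) (at_right 0)"
    using \<mu> f' unfolding uniform_on_K_def weak_conv_n_def eq[symmetric] by blast
  moreover have "((\<lambda>\<epsilon>. \<integral>x. f x \<partial>shell_law n b \<epsilon>) \<longlongrightarrow> (\<integral>x. f x \<partial>\<mu>)) (at_right 0)"
    using \<mu> f unfolding uniform_on_K_def weak_conv_n_def by blast
  ultimately show ?thesis by (rule tendsto_unique[rotated]) simp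
qed

section \<open>The two largest coordinates as continuous functions\<close>

lemma max_coord_altdef: "max_coord n x = Max ((\<lambda>i. x i) ` {1..n})"
  by (simp add: max_coord_def)

text \<open>The second largest coordinate, counted with multiplicity, is the largest minimum of two coordinates
  with different indices. This form shows continuity and measurability.\<close>

lemma second_max_coord_eq_Max:
  assumes n: "n \<ge> 2"
  shows "second_max_coord n x =
    Max ((\<lambda>p. min (x (fst p)) (x (snd p))) ` {p \<in> {1..n} \<times> {1..n}. fst p \<noteq> snd p})" (is "_ = Max (?g ` ?P)")
proof -
  define ys where "ys = map x [1..<Suc n]"
  define l where "l = sort ys"
  have len: "length ys = n" "length l = n" by (auto simp: ys_def l_def)
  have ysn: "ys ! i = x (Suc i)" if "i < n" for i using that by (simp add: ys_def del: upt_Suc)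
  have "mset l = mset ys" by (simp add: l_def)
  then obtain p where p: "p permutes {..<length ys}" "permute_list p ys = l" by (rule mset_eq_permutation)
  have ln: "l ! i = x (Suc (p i))" if "i < n" for i
  proof -
    have "p i < n" using permutes_in_image[OF p(1), of i] that len by simp
    then show ?thesis using permute_list_nth[OF p(1), of i] that p(2) len ysn by simp
  qed
  have M2: "second_max_coord n x = l ! (n - 2)"
  proof -
    have "second_max_coord n x = rev l ! 1" unfolding second_max_coord_def l_def ys_def ..
    then show ?thesis using n len by (simp add: rev_nth numeral_2_eq_2)
  qed
  have sorted: "l ! i \<le> l ! j" if "i \<le> j" "j < n" for i j
    using that len by (simp add: l_def sorted_nth_mono)
  have fin: "finite ?P" by (rule finite_subset[of _ "{1..n} \<times> {1..n}"]) auto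
  show ?thesis
  proof (rule Max_eqI[symmetric])
    show "finite (?g ` ?P)" using fin by simp
    let ?i = "Suc (p (n - 2))" and ?j = "Suc (p (n - 1))"
    have "p (n - 2) < n" "p (n - 1) < n" using permutes_in_image[OF p(1)] n len by auto
    moreover have "p (n - 2) \<noteq> p (n - 1)" using permutes_inj[OF p(1)] n by (auto simp: inj_eq)
    ultimately have "(?i, ?j) \<in> ?P" by auto
    moreover have "?g (?i, ?j) = l ! (n - 2)"
      using ln[of "n - 2"] ln[of "n - 1"] sorted[of "n - 2" "n - 1"] n by simp
    ultimately show "second_max_coord n x \<in> ?g ` ?P" unfolding M2 by (metis (no_types, lifting) imageI)
    fix v assume "v \<in> ?g ` ?P"
    then obtain i j where ij: "i \<in> {1..n}" "j \<in> {1..n}" "i \<noteq> j" "v = min (x i) (x j)" by auto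
    have ex: "\<exists>a<n. p a = i - 1" if "i \<in> {1..n}" for i
    proof -
      have "i - 1 \<in> p ` {..<length ys}" using permutes_image[OF p(1)] that len by auto
      then show ?thesis using len by auto
    qed
    from ex[OF ij(1)] obtain a where a: "a < n" "p a = i - 1" by blast
    from ex[OF ij(2)] obtain c where c: "c < n" "p c = j - 1" by blast
    have "a \<noteq> c" using a c ij by auto
    then have m: "min a c \<le> n - 2" using a c by auto
    have xa: "x i = l ! a" "x j = l ! c" using ln a c ij by auto
    have "v \<le> l ! min a c" unfolding ij(4) xa by (auto simp: min_def)
    also have "\<dots> \<le> l ! (n - 2)" using m n by (intro sorted) auto
    finally show "v \<le> second_max_coord n x" unfolding M2 .
  qed
qed

lemma continuous_on_max_coord: "n \<ge> 1 \<Longrightarrow> continuous_on S (max_coord n)"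
  unfolding max_coord_altdef[abs_def] by (intro continuous_on_Max continuous_on_coordinate) auto

lemma pairs_nonempty: "n \<ge> 2 \<Longrightarrow> {p \<in> {1..n} \<times> {1..n}. fst p \<noteq> snd p} \<noteq> {}" for n :: nat
proof -
  assume "n \<ge> 2"
  then have "(1, 2) \<in> {p \<in> {1..n} \<times> {1..n}. fst p \<noteq> snd p}" by auto
  then show ?thesis by blast
qed

lemma finite_pairs: "finite {p \<in> {1..n} \<times> {1..n}. fst p \<noteq> snd p}" for n :: nat
  by (rule finite_subset[of _ "{1..n} \<times> {1..n}"]) auto

lemma continuous_on_second_max_coord:
  assumes "n \<ge> 2" shows "continuous_on S (second_max_coord n)"
proof -
  have "second_max_coord n = (\<lambda>x. Max ((\<lambda>p. min (x (fst p)) (x (snd p))) ` {p \<in> {1..n} \<times> {1..n}. fst p \<noteq> snd p}))"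
    by (rule ext) (rule second_max_coord_eq_Max[OF assms])
  then show ?thesis
    using continuous_on_Max[OF finite_pairs pairs_nonempty[OF assms], of S "\<lambda>p x. min (x (fst p)) (x (snd p))"]
    by (simp add: continuous_on_min continuous_on_coordinate)
qed

lemma max_coord_measurable: "n \<ge> 1 \<Longrightarrow> max_coord n \<in> borel_measurable (borel_n n)"
  by (intro continuous_on_Rn_measurable continuous_on_max_coord)

lemma second_max_coord_measurable: "n \<ge> 2 \<Longrightarrow> second_max_coord n \<in> borel_measurable (borel_n n)"
  by (intro continuous_on_Rn_measurable continuous_on_second_max_coord)

lemma max_coord_ge: "i \<in> {1..n} \<Longrightarrow> x i \<le> max_coord n x"
  unfolding max_coord_altdef by (intro Max_ge) auto

lemma max_coord_attained:
  assumes "n \<ge> 1" shows "\<exists>i\<in>{1..n}. max_coord n x = x i"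
proof -
  have "Max (x ` {1..n}) \<in> x ` {1..n}" using assms by (intro Max_in) auto
  then show ?thesis unfolding max_coord_def by blast
qed

lemma second_max_coord_attained: "n \<ge> 2 \<Longrightarrow> \<exists>i\<in>{1..n}. \<exists>j\<in>{1..n}. i \<noteq> j \<and> second_max_coord n x = min (x i) (x j)"
proof -
  assume n: "n \<ge> 2"
  let ?P = "{p \<in> {1..n} \<times> {1..n}. fst p \<noteq> snd p}"
  have "Max ((\<lambda>p. min (x (fst p)) (x (snd p))) ` ?P) \<in> (\<lambda>p. min (x (fst p)) (x (snd p))) ` ?P"
    using finite_pairs pairs_nonempty[OF n] by (intro Max_in) auto
  then obtain p where "p \<in> ?P" "second_max_coord n x = min (x (fst p)) (x (snd p))"
    unfolding second_max_coord_eq_Max[OF n] by blast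
  then show ?thesis by (intro bexI[of _ "fst p"] bexI[of _ "snd p"]) auto
qed

section \<open>Limits under the uniform distribution\<close>

text \<open>By exchangeability all coordinates have the same second moment, and the squares add up to \<open>nb\<close>.\<close>

lemma uniform_on_K_second_moment:
  assumes \<mu>: "uniform_on_K n b \<mu>" and n: "n \<ge> 1" and b: "b \<ge> 0"
  shows "(\<integral>x. (x 1)\<^sup>2 \<partial>\<mu>) = b"
proof -
  note D = uniform_on_K_D[OF \<mu>]
  interpret \<mu>: prob_space \<mu> by (rule D)
  have coord[measurable]: "(\<lambda>x. x i) \<in> borel_measurable \<mu>" if "i \<in> {1..n}" for i
    using that by (simp add: measurable_cong_sets[OF D(2) refl])
  \<comment> \<open>Truncation at \<open>nb\<close> makes the test function bounded and does not change it on \<open>K_set n b\<close>.\<close>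
  let ?f = "\<lambda>i x. min ((x i)\<^sup>2) (real n * b)"
  have nb: "real n * b \<ge> 0" using b by simp
  have int: "integrable \<mu> (?f i)" if "i \<in> {1..n}" for i
    by (rule \<mu>.integrable_const_bound[where B="real n * b"]) (use that nb in auto)
  have eq: "(\<integral>x. ?f i x \<partial>\<mu>) = (\<integral>x. ?f 1 x \<partial>\<mu>)" if i: "i \<in> {1..n}" for i
  proof -
    let ?\<sigma> = "\<lambda>l. if l = 1 then i else if l = i then 1 else l"
    have "bij_betw ?\<sigma> {1..n} {1..n}"
      by (rule bij_betw_byWitness[where f'="?\<sigma>"]) (use i n in auto)
    then have "(\<integral>x. ?f 1 (\<lambda>l\<in>{1..n}. x (?\<sigma> l)) \<partial>\<mu>) = (\<integral>x. ?f 1 x \<partial>\<mu>)"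
    proof (rule uniform_on_K_permute[OF \<mu>])
      show "continuous_on (Rn n) (?f 1)" by (intro continuous_intros continuous_on_coordinate)
      show "bounded (?f 1 ` Rn n)" by (rule boundedI[where B="real n * b"]) (use nb in auto)
    qed
    then show ?thesis using n by simp
  qed
  have K: "AE x in \<mu>. \<forall>i\<in>{1..n}. ?f i x = (x i)\<^sup>2"
    using D(4)
  proof (rule AE_mp, intro AE_I2 impI ballI)
    fix x i assume x: "x \<in> K_set n b" and i: "i \<in> {1..n}"
    have "(x i)\<^sup>2 \<le> (\<Sum>i=1..n. (x i)\<^sup>2)" using i by (intro member_le_sum) auto
    then show "?f i x = (x i)\<^sup>2" using x by (simp add: K_set_def)
  qed
  have "real n * (\<integral>x. ?f 1 x \<partial>\<mu>) = (\<Sum>i=1..n. \<integral>x. ?f i x \<partial>\<mu>)"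
  proof -
    have "(\<Sum>i=1..n. \<integral>x. ?f i x \<partial>\<mu>) = (\<Sum>i=1..n. \<integral>x. ?f 1 x \<partial>\<mu>)" by (intro sum.cong refl eq)
    then show ?thesis by simp
  qed
  also have "\<dots> = (\<integral>x. (\<Sum>i=1..n. ?f i x) \<partial>\<mu>)" using int by (intro Bochner_Integration.integral_sum[symmetric]) auto
  also have "\<dots> = (\<integral>x. real n * b \<partial>\<mu>)"
  proof (rule integral_cong_AE)
    show "AE x in \<mu>. (\<Sum>i=1..n. ?f i x) = real n * b"
      using K D(4)
    proof eventually_elim
      case (elim x)
      then have "(\<Sum>i=1..n. ?f i x) = (\<Sum>i=1..n. (x i)\<^sup>2)" by (intro sum.cong) auto
      then show ?case using elim by (simp add: K_set_def)
    qed
  qed measurable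
  also have "\<dots> = real n * b" by (simp add: \<mu>.prob_space)
  finally have "(\<integral>x. ?f 1 x \<partial>\<mu>) = b" using n by simp
  moreover have "(\<integral>x. ?f 1 x \<partial>\<mu>) = (\<integral>x. (x 1)\<^sup>2 \<partial>\<mu>)"
  proof (rule integral_cong_AE)
    have [measurable]: "(\<lambda>x. x 1) \<in> borel_measurable \<mu>" using n by simp
    show "(\<lambda>x. ?f 1 x) \<in> borel_measurable \<mu>" "(\<lambda>x. (x 1)\<^sup>2) \<in> borel_measurable \<mu>" by measurable
    show "AE x in \<mu>. ?f 1 x = (x 1)\<^sup>2" using K by eventually_elim (use n in auto)
  qed
  ultimately show ?thesis by simp
qed

text \<open>The permutation exchanges the first block with the \<open>j\<close>-th one and fixes everything else.\<close>

lemma uniform_on_K_block: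
  fixes f :: "(nat \<Rightarrow> real) \<Rightarrow> real"
  assumes \<mu>: "uniform_on_K n b \<mu>" and f: "continuous_on (Rn k) f" "bounded (f ` Rn k)" and j: "j < n div Suc k"
  shows "(\<integral>x. f (block k j x) \<partial>\<mu>) = (\<integral>x. f (block k 0 x) \<partial>\<mu>)"
proof -
  let ?\<sigma> = "\<lambda>l. if l \<in> {1..k} then j * Suc k + l
    else if l \<in> {j * Suc k + 1..j * Suc k + k} then l - j * Suc k else l"
  have r: "{j * Suc k + 1..j * Suc k + k} \<subseteq> {1..n}" "{1..k} \<subseteq> {1..n}"
    using block_range[OF j] block_range[of 0 n k] j by auto
  have invol: "?\<sigma> (?\<sigma> l) = l" for l by (cases j) auto
  have maps: "?\<sigma> l \<in> {1..n}" if "l \<in> {1..n}" for l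
  proof -
    consider "l \<in> {1..k}" | "l \<notin> {1..k}" "l \<in> {j * Suc k + 1..j * Suc k + k}"
      | "l \<notin> {1..k}" "l \<notin> {j * Suc k + 1..j * Suc k + k}" by blast
    then show ?thesis
    proof cases
      case 1
      then have "j * Suc k + l \<in> {j * Suc k + 1..j * Suc k + k}" by auto
      then show ?thesis using 1 r(1) by auto
    next
      case 2
      then have "l - j * Suc k \<in> {1..k}" by auto
      then show ?thesis using 2 r(2) by auto
    next
      case 3
      then show ?thesis using that by auto
    qed
  qed
  have "bij_betw ?\<sigma> {1..n} {1..n}"
    by (rule bij_betw_byWitness[where f'="?\<sigma>"]) (use invol maps in blast)+
  then have "(\<integral>x. f (block k 0 (\<lambda>l\<in>{1..n}. x (?\<sigma> l))) \<partial>\<mu>) = (\<integral>x. f (block k 0 x) \<partial>\<mu>)"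
  proof (rule uniform_on_K_permute[OF \<mu>])
    show "continuous_on (Rn n) (\<lambda>x. f (block k 0 x))"
      unfolding block_def by (rule continuous_on_compose2[OF f(1) continuous_on_restrict_indices]) auto
    show "bounded ((\<lambda>x. f (block k 0 x)) ` Rn n)"
      by (rule bounded_subset[OF f(2)]) (use block_in_Rn in blast)
  qed
  moreover have "block k 0 (\<lambda>l\<in>{1..n}. x (?\<sigma> l)) = block k j x" for x :: "nat \<Rightarrow> real"
    using r(2) by (auto simp: block_def fun_eq_iff)
  ultimately show ?thesis by simp
qed

text \<open>Uniform distributions \<open>\<mu> n\<close> on the sets \<open>K_set n b\<close> for all \<open>n > b\<close>, together with the exponential
  sequence to which they are compared.\<close>

locale uniform_sequence = exp_sequence Q Z for Q :: "'q measure" and Z +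
  fixes b :: real and \<mu> :: "nat \<Rightarrow> (nat \<Rightarrow> real) measure"
  assumes b: "b > 2" and unif: "\<And>n. real n > b \<Longrightarrow> uniform_on_K n b (\<mu> n)"
begin

abbreviation s where "s \<equiv> sqrt (b - 2)"

lemma s_pos: "s > 0" using b by simp

lemma eventually_n: "\<forall>\<^sub>F n in sequentially. real n > b \<and> n \<ge> 2"
proof -
  have "\<forall>\<^sub>F n in sequentially. real n > b" by real_asymp
  with eventually_ge_at_top[of "2::nat"] show ?thesis by eventually_elim auto
qed

lemma negligible_uniform:
  fixes h :: "nat \<Rightarrow> (nat \<Rightarrow> real) \<Rightarrow> real"
  assumes neg: "negligible b A" and ac: "a < c"
    and h: "\<forall>\<^sub>F n in sequentially. continuous_on (Rn n) (h n) \<and> (\<forall>x \<in> Rn n. a < h n x \<longrightarrow> x \<in> A n)"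
  shows "(\<lambda>n. \<P>(x in \<mu> n. c \<le> h n x)) \<longlonglongrightarrow> 0"
proof -
  obtain p where p: "p \<longlonglongrightarrow> (0::real)" and ev: "\<forall>\<^sub>F n in sequentially. \<forall>\<epsilon>. 0 < \<epsilon> \<longrightarrow> \<epsilon> \<le> 1 \<longrightarrow>
      measure (shell_law n b \<epsilon>) (A n) \<le> p n"
    using negligible_shell[OF b neg] by blast
  have A: "\<forall>\<^sub>F n in sequentially. A n \<in> sets (borel_n n)"
    using neg unfolding negligible_def controlled_def by (auto elim: eventually_mono)
  have "\<forall>\<^sub>F n in sequentially. \<P>(x in \<mu> n. c \<le> h n x) \<le> p n"
    using ev A h eventually_n
  proof eventually_elim
    case (elim n)
    then show ?case by (intro uniform_on_K_tail_le[OF unif _ ac, where A="A n"]) auto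
  qed
  then show ?thesis by (intro tendsto_sandwich[OF _ _ tendsto_const p]) auto
qed

text \<open>The inequality is written with minus signs so that the event is an upper level set of a
  continuous function, as \<open>negligible_uniform\<close> requires.\<close>

lemma max_coord_not_small:
  assumes l: "0 \<le> l" "l < s"
  shows "(\<lambda>n. \<P>(x in \<mu> n. - l \<le> - (max_coord n x / sqrt n))) \<longlonglongrightarrow> 0"
proof -
  define L where "L = (l + s) / 2"
  have L: "0 < L" "L < s" "l < L" using l by (auto simp: L_def)
  show ?thesis
  proof (rule negligible_uniform[OF negligible_no_large[OF L(1,2) b], of "- L"])
    show "\<forall>\<^sub>F n in sequentially. continuous_on (Rn n) (\<lambda>x. - (max_coord n x / sqrt n)) \<and>
      (\<forall>x\<in>Rn n. - L < - (max_coord n x / sqrt n) \<longrightarrow> x \<in> {x \<in> space (borel_n n). \<forall>i\<in>{1..n}. x i \<le> L * sqrt n})"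
      using eventually_n
    proof eventually_elim
      case (elim n)
      then have n: "n \<ge> 1" "sqrt n > 0" by auto
      have "x i \<le> L * sqrt n" if "- L < - (max_coord n x / sqrt n)" "i \<in> {1..n}" for x i
        using that max_coord_ge[of i n x] n by (simp add: field_simps)
      moreover have "continuous_on (Rn n) (\<lambda>x. - (max_coord n x / sqrt n))"
        using n by (intro continuous_intros continuous_on_max_coord) auto
      ultimately show ?case by (auto simp: space_PiM)
    qed
  qed (use L in auto)
qed

lemma max_coord_not_large:
  assumes u: "s < u"
  shows "(\<lambda>n. \<P>(x in \<mu> n. u \<le> max_coord n x / sqrt n)) \<longlonglongrightarrow> 0"
proof -
  define L where "L = (u + s) / 2"
  have L: "s < L" "L < u" using u by (auto simp: L_def)
  show ?thesis
  proof (rule negligible_uniform[OF negligible_some_large[OF L(1) b] L(2)])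
    show "\<forall>\<^sub>F n in sequentially. continuous_on (Rn n) (\<lambda>x. max_coord n x / sqrt n) \<and>
      (\<forall>x\<in>Rn n. L < max_coord n x / sqrt n \<longrightarrow> x \<in> {x \<in> space (borel_n n). \<exists>i\<in>{1..n}. L * sqrt n < x i})"
      using eventually_n
    proof eventually_elim
      case (elim n)
      then have n: "n \<ge> 1" "sqrt n > 0" by auto
      have "\<exists>i\<in>{1..n}. L * sqrt n < x i" if "L < max_coord n x / sqrt n" for x
        using that max_coord_attained[OF n(1), of x] n by (auto simp: field_simps)
      moreover have "continuous_on (Rn n) (\<lambda>x. max_coord n x / sqrt n)"
        using n by (intro continuous_intros continuous_on_max_coord) auto
      ultimately show ?case by (auto simp: space_PiM)
    qed
  qed
qed

text \<open>Since the largest coordinate is close to \<open>\<surd>((b - 2) n)\<close>, a second one of size \<open>c\<surd>n\<close> would cost too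
  much.\<close>

lemma second_max_coord_not_large:
  assumes c: "c > 0"
  shows "(\<lambda>n. \<P>(x in \<mu> n. c \<le> second_max_coord n x / sqrt n)) \<longlonglongrightarrow> 0"
proof -
  define c' where "c' = min c s"
  have c': "0 < c'" "c' \<le> c" "c' \<le> s" using c s_pos by (auto simp: c'_def)
  \<comment> \<open>The levels leave a gap \<open>c' / 4\<close> for the passage to the limit, and still \<open>L + E > s\<close>.\<close>
  define l where "l = s - c' / 4"
  define L E where "L = l - c' / 4" and "E = c - c' / 4"
  have l: "0 \<le> l" "l < s" using c' by (auto simp: l_def)
  have LE: "L > 0" "E > 0" "L + E > s" using c' by (auto simp: l_def L_def E_def)
  let ?h = "\<lambda>n x. min (max_coord n x / sqrt n - l) (second_max_coord n x / sqrt n - c)"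
  have 1: "(\<lambda>n. \<P>(x in \<mu> n. 0 \<le> ?h n x)) \<longlonglongrightarrow> 0"
  proof (rule negligible_uniform[OF negligible_two_large[OF LE b], of "- (c' / 4)"])
    show "\<forall>\<^sub>F n in sequentially. continuous_on (Rn n) (?h n) \<and>
      (\<forall>x\<in>Rn n. - (c' / 4) < ?h n x \<longrightarrow> x \<in> {x \<in> space (borel_n n).
         \<exists>i\<in>{1..n}. \<exists>j\<in>{1..n}. i \<noteq> j \<and> L * sqrt n < x i \<and> E * sqrt n < x j})"
      using eventually_n
    proof eventually_elim
      case (elim n)
      then have n: "n \<ge> 1" "n \<ge> 2" "sqrt n > 0" by auto
      have "\<exists>i\<in>{1..n}. \<exists>j\<in>{1..n}. i \<noteq> j \<and> L * sqrt n < x i \<and> E * sqrt n < x j"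
        if "- (c' / 4) < ?h n x" for x
      proof -
        have M: "L < max_coord n x / sqrt n" "E < second_max_coord n x / sqrt n"
          using that by (auto simp: L_def E_def)
        from max_coord_attained[OF n(1), of x] obtain k where k: "k \<in> {1..n}" "max_coord n x = x k" by blast
        from second_max_coord_attained[OF n(2), of x] obtain i j where
          ij: "i \<in> {1..n}" "j \<in> {1..n}" "i \<noteq> j" "second_max_coord n x = min (x i) (x j)" by blast
        have "L * sqrt n < x k" "E * sqrt n < x i" "E * sqrt n < x j"
          using M n k ij by (auto simp: field_simps)
        then show ?thesis using k ij by (cases "k = i") blast+
      qed
      moreover have "continuous_on (Rn n) (?h n)"
        using n by (intro continuous_intros continuous_on_max_coord continuous_on_second_max_coord) auto
      ultimately show ?case by (auto simp: space_PiM)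
    qed
  qed (use c' in auto)
  note 2 = max_coord_not_small[OF l]
  show ?thesis
  proof (rule tendsto_sandwich[OF _ _ tendsto_const])
    show "(\<lambda>n. \<P>(x in \<mu> n. 0 \<le> ?h n x) +
      \<P>(x in \<mu> n. - l \<le> - (max_coord n x / sqrt n))) \<longlonglongrightarrow> 0"
      using tendsto_add[OF 1 2] by simp
    show "\<forall>\<^sub>F n in sequentially. \<P>(x in \<mu> n. c \<le> second_max_coord n x / sqrt n) \<le>
      \<P>(x in \<mu> n. 0 \<le> ?h n x) + \<P>(x in \<mu> n. - l \<le> - (max_coord n x / sqrt n))"
      using eventually_n
    proof eventually_elim
      case (elim n)
      then have n: "n \<ge> 1" "n \<ge> 2" by auto
      note D = uniform_on_K_D[OF unif[OF conjunct1[OF elim]]]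
      interpret \<mu>: prob_space "\<mu> n" by (rule D)
      have [measurable]: "max_coord n \<in> borel_measurable (\<mu> n)" "second_max_coord n \<in> borel_measurable (\<mu> n)"
        unfolding measurable_cong_sets[OF D(2) refl]
        by (rule max_coord_measurable second_max_coord_measurable, fact)+
      have "\<P>(x in \<mu> n. c \<le> second_max_coord n x / sqrt n) \<le>
        measure (\<mu> n) ({x \<in> space (\<mu> n). 0 \<le> ?h n x} \<union> {x \<in> space (\<mu> n). - l \<le> - (max_coord n x / sqrt n)})"
        by (rule \<mu>.finite_measure_mono) (auto simp: min_def)
      also have "\<dots> \<le> \<P>(x in \<mu> n. 0 \<le> ?h n x) + \<P>(x in \<mu> n. - l \<le> - (max_coord n x / sqrt n))"
        by (rule measure_Un_le) auto
      finally show ?case .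
    qed
  qed auto
qed

lemma max_coord_concentration:
  assumes \<epsilon>: "\<epsilon> > 0"
  shows "(\<lambda>n. \<P>(x in \<mu> n. \<bar>(max_coord n x)\<^sup>2 / ((b - 2) * real n) - 1\<bar> > \<epsilon>)) \<longlonglongrightarrow> 0"
proof -
  \<comment> \<open>For \<open>\<epsilon> \<ge> 1\<close> a lower deviation is impossible; the maximum then gives \<open>l = 0\<close>.\<close>
  define u l where "u = s * sqrt (1 + \<epsilon>)" and "l = s * sqrt (max 0 (1 - \<epsilon>))"
  have u: "s < u" using s_pos \<epsilon> by (simp add: u_def)
  have l: "0 \<le> l" "l < s" using s_pos \<epsilon> by (auto simp: l_def)
  have u2: "u\<^sup>2 = (b - 2) * (1 + \<epsilon>)" using b \<epsilon> by (simp add: u_def power_mult_distrib)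
  have l2: "l\<^sup>2 = (b - 2) * max 0 (1 - \<epsilon>)" using b by (simp add: l_def power_mult_distrib)
  show ?thesis
  proof (rule tendsto_sandwich[OF _ _ tendsto_const])
    show "(\<lambda>n. \<P>(x in \<mu> n. u \<le> max_coord n x / sqrt n) +
      \<P>(x in \<mu> n. - l \<le> - (max_coord n x / sqrt n))) \<longlonglongrightarrow> 0"
      using tendsto_add[OF max_coord_not_large[OF u] max_coord_not_small[OF l]] by simp
    show "\<forall>\<^sub>F n in sequentially. \<P>(x in \<mu> n. \<bar>(max_coord n x)\<^sup>2 / ((b - 2) * real n) - 1\<bar> > \<epsilon>) \<le>
      \<P>(x in \<mu> n. u \<le> max_coord n x / sqrt n) + \<P>(x in \<mu> n. - l \<le> - (max_coord n x / sqrt n))"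
      using eventually_n
    proof eventually_elim
      case (elim n)
      then have n: "n \<ge> 1" "sqrt n > 0" by auto
      note D = uniform_on_K_D[OF unif[OF conjunct1[OF elim]]]
      interpret \<mu>: prob_space "\<mu> n" by (rule D)
      have [measurable]: "max_coord n \<in> borel_measurable (\<mu> n)"
        unfolding measurable_cong_sets[OF D(2) refl]
        by (rule max_coord_measurable second_max_coord_measurable, fact)+
      have "\<P>(x in \<mu> n. \<bar>(max_coord n x)\<^sup>2 / ((b - 2) * real n) - 1\<bar> > \<epsilon>) \<le>
        measure (\<mu> n) ({x \<in> space (\<mu> n). u \<le> max_coord n x / sqrt n} \<union> {x \<in> space (\<mu> n). - l \<le> - (max_coord n x / sqrt n)})"
      proof (rule \<mu>.finite_measure_mono_AE)
        show "AE x in \<mu> n. x \<in> {x \<in> space (\<mu> n). \<bar>(max_coord n x)\<^sup>2 / ((b - 2) * real n) - 1\<bar> > \<epsilon>} \<longrightarrow>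
          x \<in> {x \<in> space (\<mu> n). u \<le> max_coord n x / sqrt n} \<union> {x \<in> space (\<mu> n). - l \<le> - (max_coord n x / sqrt n)}"
          using D(4)
        proof (rule AE_mp, intro AE_I2 impI)
          fix x assume x: "x \<in> space (\<mu> n)" "x \<in> K_set n b"
            and bad: "x \<in> {x \<in> space (\<mu> n). \<bar>(max_coord n x)\<^sup>2 / ((b - 2) * real n) - 1\<bar> > \<epsilon>}"
          define y where "y = max_coord n x / sqrt n"
          have "max_coord n x > 0"
            using max_coord_attained[OF n(1), of x] x(2) by (auto simp: K_set_def PiE_iff)
          then have y: "y \<ge> 0" using n by (simp add: y_def)
          have y2: "(max_coord n x)\<^sup>2 / ((b - 2) * real n) = y\<^sup>2 / (b - 2)"
            using n b by (simp add: y_def power_divide)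
          have "u \<le> y \<or> y \<le> l"
          proof (rule ccontr)
            assume "\<not> (u \<le> y \<or> y \<le> l)"
            then have "y < u" "l < y" by auto
            then have "y\<^sup>2 < u\<^sup>2" "l\<^sup>2 < y\<^sup>2" using y l by (auto intro!: power_strict_mono)
            moreover have "(b - 2) * (1 - \<epsilon>) \<le> (b - 2) * max 0 (1 - \<epsilon>)"
              using b by (intro mult_left_mono) auto
            ultimately have "y\<^sup>2 < (b - 2) * (1 + \<epsilon>)" "(b - 2) * (1 - \<epsilon>) < y\<^sup>2"
              unfolding u2 l2 by linarith+
            then have "y\<^sup>2 / (b - 2) < 1 + \<epsilon>" "1 - \<epsilon> < y\<^sup>2 / (b - 2)"
              using b by (simp_all add: pos_divide_less_eq pos_less_divide_eq mult.commute)
            then show False using bad unfolding mem_Collect_eq y2 by auto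
          qed
          then show "x \<in> {x \<in> space (\<mu> n). u \<le> max_coord n x / sqrt n} \<union> {x \<in> space (\<mu> n). - l \<le> - (max_coord n x / sqrt n)}"
            using x by (auto simp: y_def)
        qed
      qed measurable
      also have "\<dots> \<le> \<P>(x in \<mu> n. u \<le> max_coord n x / sqrt n) + \<P>(x in \<mu> n. - l \<le> - (max_coord n x / sqrt n))"
        by (rule measure_Un_le) auto
      finally show ?case .
    qed
  qed auto
qed

text \<open>On \<open>K_set n b\<close> the square sum is constant, so this is a restatement of \<open>max_coord_concentration\<close>.\<close>

lemma rest_concentration:
  assumes \<epsilon>: "\<epsilon> > 0"
  shows "(\<lambda>n. \<P>(x in \<mu> n. \<bar>(1 / real n) * ((\<Sum>i=1..n. (x i)\<^sup>2) - (max_coord n x)\<^sup>2) - 2\<bar> > \<epsilon>)) \<longlonglongrightarrow> 0"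
proof (rule tendsto_sandwich[OF _ _ tendsto_const])
  show "(\<lambda>n. \<P>(x in \<mu> n. \<bar>(max_coord n x)\<^sup>2 / ((b - 2) * real n) - 1\<bar> > \<epsilon> / (b - 2))) \<longlonglongrightarrow> 0"
    by (rule max_coord_concentration) (use \<epsilon> b in simp)
  show "\<forall>\<^sub>F n in sequentially. \<P>(x in \<mu> n. \<bar>(1 / real n) * ((\<Sum>i=1..n. (x i)\<^sup>2) - (max_coord n x)\<^sup>2) - 2\<bar> > \<epsilon>) \<le>
    \<P>(x in \<mu> n. \<bar>(max_coord n x)\<^sup>2 / ((b - 2) * real n) - 1\<bar> > \<epsilon> / (b - 2))"
    using eventually_n
  proof eventually_elim
    case (elim n)
    then have n: "n \<ge> 1" "real n > 0" by auto
    note D = uniform_on_K_D[OF unif[OF conjunct1[OF elim]]]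
    interpret \<mu>: prob_space "\<mu> n" by (rule D)
    have [measurable]: "max_coord n \<in> borel_measurable (\<mu> n)"
      unfolding measurable_cong_sets[OF D(2) refl]
      by (rule max_coord_measurable second_max_coord_measurable, fact)+
    show ?case
    proof (rule \<mu>.finite_measure_mono_AE)
      show "AE x in \<mu> n. x \<in> {x \<in> space (\<mu> n). \<bar>(1 / real n) * ((\<Sum>i=1..n. (x i)\<^sup>2) - (max_coord n x)\<^sup>2) - 2\<bar> > \<epsilon>} \<longrightarrow>
        x \<in> {x \<in> space (\<mu> n). \<bar>(max_coord n x)\<^sup>2 / ((b - 2) * real n) - 1\<bar> > \<epsilon> / (b - 2)}"
        using D(4)
      proof (rule AE_mp, intro AE_I2 impI)
        fix x assume x: "x \<in> space (\<mu> n)" "x \<in> K_set n b"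
          and bad: "x \<in> {x \<in> space (\<mu> n). \<bar>(1 / real n) * ((\<Sum>i=1..n. (x i)\<^sup>2) - (max_coord n x)\<^sup>2) - 2\<bar> > \<epsilon>}"
        have "(\<Sum>i=1..n. (x i)\<^sup>2) = real n * b" using x by (simp add: K_set_def)
        then have "(1 / real n) * ((\<Sum>i=1..n. (x i)\<^sup>2) - (max_coord n x)\<^sup>2) - 2 =
            - (b - 2) * ((max_coord n x)\<^sup>2 / ((b - 2) * real n) - 1)"
          using n b by (simp add: field_simps)
        then have "\<epsilon> < (b - 2) * \<bar>(max_coord n x)\<^sup>2 / ((b - 2) * real n) - 1\<bar>"
          using bad b by (simp add: abs_mult)
        then show "x \<in> {x \<in> space (\<mu> n). \<bar>(max_coord n x)\<^sup>2 / ((b - 2) * real n) - 1\<bar> > \<epsilon> / (b - 2)}"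
          using x b by (simp add: pos_divide_less_eq mult.commute)
      qed
    qed measurable
  qed
qed auto

lemma second_max_coord_concentration:
  assumes \<epsilon>: "\<epsilon> > 0"
  shows "(\<lambda>n. \<P>(x in \<mu> n. \<bar>(second_max_coord n x)\<^sup>2 / real n - 0\<bar> > \<epsilon>)) \<longlonglongrightarrow> 0"
proof (rule tendsto_sandwich[OF _ _ tendsto_const])
  show "(\<lambda>n. \<P>(x in \<mu> n. sqrt \<epsilon> \<le> second_max_coord n x / sqrt n)) \<longlonglongrightarrow> 0"
    by (rule second_max_coord_not_large) (use \<epsilon> in simp)
  show "\<forall>\<^sub>F n in sequentially. \<P>(x in \<mu> n. \<bar>(second_max_coord n x)\<^sup>2 / real n - 0\<bar> > \<epsilon>) \<le>
    \<P>(x in \<mu> n. sqrt \<epsilon> \<le> second_max_coord n x / sqrt n)"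
    using eventually_n
  proof eventually_elim
    case (elim n)
    then have n: "n \<ge> 2" "sqrt n > 0" by auto
    note D = uniform_on_K_D[OF unif[OF conjunct1[OF elim]]]
    interpret \<mu>: prob_space "\<mu> n" by (rule D)
    have [measurable]: "second_max_coord n \<in> borel_measurable (\<mu> n)"
      unfolding measurable_cong_sets[OF D(2) refl]
      by (rule max_coord_measurable second_max_coord_measurable, fact)+
    show ?case
    proof (rule \<mu>.finite_measure_mono_AE)
      show "AE x in \<mu> n. x \<in> {x \<in> space (\<mu> n). \<bar>(second_max_coord n x)\<^sup>2 / real n - 0\<bar> > \<epsilon>} \<longrightarrow>
        x \<in> {x \<in> space (\<mu> n). sqrt \<epsilon> \<le> second_max_coord n x / sqrt n}"
        using D(4)
      proof (rule AE_mp, intro AE_I2 impI)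
        fix x assume x: "x \<in> space (\<mu> n)" "x \<in> K_set n b"
          and bad: "x \<in> {x \<in> space (\<mu> n). \<bar>(second_max_coord n x)\<^sup>2 / real n - 0\<bar> > \<epsilon>}"
        have "second_max_coord n x > 0"
          using second_max_coord_attained[OF n(1), of x] x(2) by (auto simp: K_set_def PiE_iff)
        moreover have "\<epsilon> < (second_max_coord n x / sqrt n)\<^sup>2" using bad by (simp add: power_divide)
        ultimately have "sqrt \<epsilon> \<le> second_max_coord n x / sqrt n"
          using n by (intro real_le_lsqrt) auto
        then show "x \<in> {x \<in> space (\<mu> n). sqrt \<epsilon> \<le> second_max_coord n x / sqrt n}" using x by simp
      qed
    qed measurable
  qed
qed auto

text \<open>By exchangeability the expectation of \<open>f\<close> under \<open>\<mu> n\<close> is the expectation of its average over disjoint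
  blocks, and this average is concentrated around its mean for exponential variables.\<close>

lemma finite_dimensional_limit:
  fixes f :: "(nat \<Rightarrow> real) \<Rightarrow> real"
  assumes f: "continuous_on (Rn k) f" "bounded (f ` Rn k)"
  shows "(\<lambda>n. \<integral>x. f (\<lambda>i\<in>{1..k}. x i) \<partial>\<mu> n) \<longlonglongrightarrow> expectation (\<lambda>\<omega>. f (\<lambda>i\<in>{1..k}. Z i \<omega>))"
proof -
  define m0 where "m0 = expectation (\<lambda>\<omega>. f (\<lambda>i\<in>{1..k}. Z i \<omega>))"
  from f(2) obtain C where C: "C > 0" "\<And>x. x \<in> Rn k \<Longrightarrow> \<bar>f x\<bar> \<le> C"
    unfolding bounded_pos by (metis imageI real_norm_def)
  have fm: "f \<in> borel_measurable (borel_n k)" by (rule continuous_on_Rn_measurable[OF f(1)])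
  have f': "\<bar>f (block k j x)\<bar> \<le> C" for j x by (rule C(2)[OF block_in_Rn])
  let ?m = "\<lambda>n. n div Suc k"
  let ?g = "\<lambda>n x. \<Sum>j<?m n. f (block k j x) - m0"
  let ?h = "\<lambda>n x. \<bar>?g n x\<bar> / real (?m n)"
  have contg: "continuous_on S (\<lambda>x. f (block k j x))" for S j
    unfolding block_def by (rule continuous_on_compose2[OF f(1) continuous_on_restrict_indices]) auto
  have m0: "\<bar>m0\<bar> \<le> C" unfolding m0_def by (rule abs_expectation_Z_le[OF C])
  have evm: "\<forall>\<^sub>F n in sequentially. ?m n \<ge> 1"
    using eventually_ge_at_top[of "Suc k"] by eventually_elim (simp add: Suc_le_eq div_greater_zero_iff)
  have dev: "(\<lambda>n. \<P>(x in \<mu> n. \<delta> \<le> ?h n x)) \<longlonglongrightarrow> 0" if \<delta>: "\<delta> > 0" for \<delta>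
  proof (rule negligible_uniform[OF negligible_block_deviation[OF fm C, of "\<delta> / 2"], of "\<delta> / 2"])
    show "\<forall>\<^sub>F n in sequentially. continuous_on (Rn n) (?h n) \<and> (\<forall>x\<in>Rn n. \<delta> / 2 < ?h n x \<longrightarrow>
      x \<in> {x \<in> space (borel_n n). \<delta> / 2 * real (?m n) \<le> \<bar>\<Sum>j<?m n. f (block k j x) - expectation (\<lambda>\<omega>. f (\<lambda>i\<in>{1..k}. Z i \<omega>))\<bar>})"
      using evm
    proof eventually_elim
      case (elim n)
      then have "real (?m n) > 0" by linarith
      then have "\<delta> / 2 * real (?m n) \<le> \<bar>?g n x\<bar>" if "\<delta> / 2 < ?h n x" for x
        using that by (simp add: pos_less_divide_eq)
      moreover have "continuous_on (Rn n) (?h n)"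
        using \<open>real (?m n) > 0\<close> by (intro continuous_intros contg) auto
      ultimately show ?case unfolding m0_def by (auto simp: space_PiM)
    qed
  qed (use \<delta> in auto)
  show ?thesis unfolding m0_def[symmetric]
  proof (rule LIMSEQ_I)
    fix e :: real assume e: "e > 0"
    have "\<forall>\<^sub>F n in sequentially. \<P>(x in \<mu> n. e / 2 \<le> ?h n x) < e / (4 * C)"
      using dev[of "e / 2"] e C by (intro order_tendstoD) auto
    then have "\<forall>\<^sub>F n in sequentially. norm ((\<integral>x. f (\<lambda>i\<in>{1..k}. x i) \<partial>\<mu> n) - m0) < e"
      using evm eventually_n
    proof eventually_elim
      case (elim n)
      have un: "uniform_on_K n b (\<mu> n)" using elim unif by blast
      note D = uniform_on_K_D[OF un]
      interpret \<mu>: prob_space "\<mu> n" by (rule D)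
      have m: "real (?m n) > 0" using elim(2) by linarith
      have meas[measurable]: "(\<lambda>x. f (block k j x)) \<in> borel_measurable (\<mu> n)" for j
        unfolding measurable_cong_sets[OF D(2) refl] by (rule continuous_on_Rn_measurable[OF contg])
      have int: "integrable (\<mu> n) (\<lambda>x. f (block k j x))" for j
        by (rule \<mu>.integrable_const_bound[where B=C]) (use f' in auto)
      let ?B = "{x \<in> space (\<mu> n). e / 2 \<le> ?h n x}"
      have hC: "?h n x \<le> 2 * C" for x
      proof -
        have "\<bar>?g n x\<bar> \<le> (\<Sum>j<?m n. 2 * C)"
        proof (rule order_trans[OF sum_abs], rule sum_mono)
          fix j show "\<bar>f (block k j x) - m0\<bar> \<le> 2 * C" using f'[of j x] m0 by linarith
        qed
        then show ?thesis using m by (simp add: pos_divide_le_eq mult.commute)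
      qed
      have "real (?m n) * ((\<integral>x. f (block k 0 x) \<partial>\<mu> n) - m0) = (\<Sum>j<?m n. (\<integral>x. f (block k j x) \<partial>\<mu> n) - m0)"
      proof -
        have "(\<Sum>j<?m n. (\<integral>x. f (block k j x) \<partial>\<mu> n) - m0) = (\<Sum>j<?m n. (\<integral>x. f (block k 0 x) \<partial>\<mu> n) - m0)"
          by (intro sum.cong refl arg_cong2[where f="(-)"] uniform_on_K_block[OF un f]) auto
        then show ?thesis by simp
      qed
      also have "\<dots> = (\<integral>x. ?g n x \<partial>\<mu> n)"
        using int by (simp add: Bochner_Integration.integral_sum \<mu>.prob_space)
      finally have "(\<integral>x. f (block k 0 x) \<partial>\<mu> n) - m0 = (\<integral>x. ?g n x / real (?m n) \<partial>\<mu> n)"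
        using m by (simp add: field_simps)
      then have "\<bar>(\<integral>x. f (block k 0 x) \<partial>\<mu> n) - m0\<bar> \<le> (\<integral>x. \<bar>?g n x / real (?m n)\<bar> \<partial>\<mu> n)"
        by (simp only: integral_abs_bound)
      also have "\<dots> \<le> (\<integral>x. e / 2 + 2 * C * indicator ?B x \<partial>\<mu> n)"
      proof (rule integral_mono)
        show "integrable (\<mu> n) (\<lambda>x. \<bar>?g n x / real (?m n)\<bar>)" using int by (intro integrable_abs) auto
        show "integrable (\<mu> n) (\<lambda>x. e / 2 + 2 * C * indicator ?B x)"
          by (intro Bochner_Integration.integrable_add integrable_mult_right integrable_real_indicator)
             (auto simp: \<mu>.emeasure_eq_measure)
        fix x assume "x \<in> space (\<mu> n)"
        then show "\<bar>?g n x / real (?m n)\<bar> \<le> e / 2 + 2 * C * indicator ?B x"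
          using hC[of x] e C m by (auto split: split_indicator)
      qed
      also have "\<dots> = e / 2 + 2 * C * measure (\<mu> n) ?B"
        by (subst Bochner_Integration.integral_add)
           (auto simp: \<mu>.prob_space \<mu>.emeasure_eq_measure intro!: integrable_mult_right integrable_real_indicator)
      also have "\<dots> < e / 2 + 2 * C * (e / (4 * C))"
        using elim(1) C by (intro add_strict_left_mono mult_strict_left_mono) auto
      also have "\<dots> = e" using C by simp
      finally show ?case by (simp add: block_def)
    qed
    then show "\<exists>no. \<forall>n\<ge>no. norm ((\<integral>x. f (\<lambda>i\<in>{1..k}. x i) \<partial>\<mu> n) - m0) < e"
      by (simp add: eventually_sequentially)
  qed
qed

end

lemma conv_in_prob_distrI:
  fixes g :: "nat \<Rightarrow> (nat \<Rightarrow> real) \<Rightarrow> real"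
  assumes X: "\<forall>\<^sub>F n in sequentially. X n \<in> measurable (P n) (borel_n n)"
    and g: "\<forall>\<^sub>F n in sequentially. g n \<in> borel_measurable (borel_n n)"
    and lim: "\<And>\<epsilon>. \<epsilon> > 0 \<Longrightarrow> (\<lambda>n. measure (distr (P n) (borel_n n) (X n))
      {x \<in> space (distr (P n) (borel_n n) (X n)). \<bar>g n x - c\<bar> > \<epsilon>}) \<longlonglongrightarrow> 0"
  shows "conv_in_prob P (\<lambda>n \<omega>. g n (X n \<omega>)) c"
  unfolding conv_in_prob_def
proof (intro conjI allI impI)
  show "\<forall>\<^sub>F n in sequentially. (\<lambda>\<omega>. g n (X n \<omega>)) \<in> borel_measurable (P n)"
    using X g proof eventually_elim
    case (elim n)
    then show ?case by (rule measurable_compose)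
  qed
  fix \<epsilon> :: real assume \<epsilon>: "\<epsilon> > 0"
  have "\<forall>\<^sub>F n in sequentially. measure (distr (P n) (borel_n n) (X n))
      {x \<in> space (distr (P n) (borel_n n) (X n)). \<bar>g n x - c\<bar> > \<epsilon>} =
      measure (P n) {\<omega> \<in> space (P n). \<bar>g n (X n \<omega>) - c\<bar> > \<epsilon>}"
    using X g
  proof eventually_elim
    case (elim n)
    note [measurable] = elim(2)
    have "X n -` {x \<in> space (borel_n n). \<bar>g n x - c\<bar> > \<epsilon>} \<inter> space (P n) = {\<omega> \<in> space (P n). \<bar>g n (X n \<omega>) - c\<bar> > \<epsilon>}"
      using measurable_space[OF elim(1)] by auto
    moreover have S: "{x \<in> space (borel_n n). \<bar>g n x - c\<bar> > \<epsilon>} \<in> sets (borel_n n)" by measurable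
    ultimately show ?case unfolding space_distr measure_distr[OF elim(1) S] by simp
  qed
  then show "(\<lambda>n. measure (P n) {\<omega> \<in> space (P n). \<bar>g n (X n \<omega>) - c\<bar> > \<epsilon>}) \<longlonglongrightarrow> 0"
    using lim[OF \<epsilon>] by (rule Lim_transform_eventually[rotated])
qed

theorem theorem1p2:
  fixes b :: real
    and Q :: "'q measure" and Z :: "nat \<Rightarrow> 'q \<Rightarrow> real"
    and P :: "nat \<Rightarrow> 'p measure" and X :: "nat \<Rightarrow> 'p \<Rightarrow> nat \<Rightarrow> real"
  assumes b: "b > 2"
    and Q: "prob_space Q"
    and Z_indep: "prob_space.indep_vars Q (\<lambda>_. borel) Z {1..}"
    and Z_exp: "\<And>i. i \<ge> 1 \<Longrightarrow> distributed Q lborel (Z i) (exponential_density 1)"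
    and P: "\<And>n. real n > b \<Longrightarrow> prob_space (P n)"
    and X: "\<And>n. real n > b \<Longrightarrow> X n \<in> measurable (P n) (borel_n n)"
    and X_unif: "\<And>n. real n > b \<Longrightarrow> uniform_on_K n b (distr (P n) (borel_n n) (X n))"
  shows
    "(\<forall>k. weak_conv_n k
            (\<lambda>n. distr (P n) (borel_n k) (\<lambda>\<omega>. \<lambda>i\<in>{1..k}. X n \<omega> i))
            (distr Q (borel_n k) (\<lambda>\<omega>. \<lambda>i\<in>{1..k}. Z i \<omega>))
            sequentially)
     \<and> ((\<forall>n. real n > b \<longrightarrow> (\<integral>\<omega>. (X n \<omega> 1)\<^sup>2 \<partial>P n) = b)
         \<and> (\<integral>\<omega>. (Z 1 \<omega>)\<^sup>2 \<partial>Q) = 2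
         \<and> \<not> (\<lambda>n. \<integral>\<omega>. (X n \<omega> 1)\<^sup>2 \<partial>P n) \<longlonglongrightarrow> (\<integral>\<omega>. (Z 1 \<omega>)\<^sup>2 \<partial>Q))
     \<and> (conv_in_prob P (\<lambda>n \<omega>. (max_coord n (X n \<omega>))\<^sup>2 / ((b - 2) * real n)) 1
         \<and> conv_in_prob P
              (\<lambda>n \<omega>. (1 / real n) * ((\<Sum>i=1..n. (X n \<omega> i)\<^sup>2) - (max_coord n (X n \<omega>))\<^sup>2)) 2)
     \<and> conv_in_prob P (\<lambda>n \<omega>. (second_max_coord n (X n \<omega>))\<^sup>2 / real n) 0"
proof -
  define \<mu> where "\<mu> n = distr (P n) (borel_n n) (X n)" for n
  interpret Q: prob_space Q by (rule Q)
  interpret U: uniform_sequence Q Z b \<mu>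
    by unfold_locales (use Z_indep Z_exp b X_unif in \<open>auto simp: \<mu>_def\<close>)
  have Xev: "\<forall>\<^sub>F n in sequentially. X n \<in> measurable (P n) (borel_n n)"
    using U.eventually_n by eventually_elim (use X in auto)
  have Mev: "\<forall>\<^sub>F n in sequentially. max_coord n \<in> borel_measurable (borel_n n) \<and> second_max_coord n \<in> borel_measurable (borel_n n)"
    using U.eventually_n
  proof eventually_elim
    case (elim n)
    then show ?case using max_coord_measurable[of n] second_max_coord_measurable[of n] by linarith
  qed
  have a: "weak_conv_n k (\<lambda>n. distr (P n) (borel_n k) (\<lambda>\<omega>. \<lambda>i\<in>{1..k}. X n \<omega> i))
      (distr Q (borel_n k) (\<lambda>\<omega>. \<lambda>i\<in>{1..k}. Z i \<omega>)) sequentially" for k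
    unfolding weak_conv_n_def
  proof (intro allI impI)
    fix f :: "(nat \<Rightarrow> real) \<Rightarrow> real" assume f: "continuous_on (Rn k) f \<and> bounded (f ` Rn k)"
    then have fm: "f \<in> borel_measurable (borel_n k)" by (intro continuous_on_Rn_measurable) auto
    have Zk: "(\<integral>x. f x \<partial>distr Q (borel_n k) (\<lambda>\<omega>. \<lambda>i\<in>{1..k}. Z i \<omega>)) = Q.expectation (\<lambda>\<omega>. f (\<lambda>i\<in>{1..k}. Z i \<omega>))"
      by (rule integral_distr[OF U.Z_restrict_measurable fm]) auto
    have "\<forall>\<^sub>F n in sequentially. (\<integral>x. f (\<lambda>i\<in>{1..k}. x i) \<partial>\<mu> n) =
        (\<integral>x. f x \<partial>distr (P n) (borel_n k) (\<lambda>\<omega>. \<lambda>i\<in>{1..k}. X n \<omega> i))"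
      using Xev eventually_ge_at_top[of k]
    proof eventually_elim
      case (elim n)
      have r: "(\<lambda>x. \<lambda>i\<in>{1..k}. x i) \<in> measurable (borel_n n) (borel_n k)"
        using elim(2) by (intro measurable_restrict_subset) auto
      show ?case unfolding \<mu>_def
        by (subst integral_distr[OF elim(1) measurable_compose[OF r fm]],
            subst integral_distr[OF measurable_compose[OF elim(1) r] fm]) simp
    qed
    then show "(\<lambda>n. \<integral>x. f x \<partial>distr (P n) (borel_n k) (\<lambda>\<omega>. \<lambda>i\<in>{1..k}. X n \<omega> i)) \<longlonglongrightarrow>
       (\<integral>x. f x \<partial>distr Q (borel_n k) (\<lambda>\<omega>. \<lambda>i\<in>{1..k}. Z i \<omega>))"
      unfolding Zk
      by (rule Lim_transform_eventually[OF U.finite_dimensional_limit[OF conjunct1[OF f] conjunct2[OF f]]])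
  qed
  have b1: "(\<integral>\<omega>. (X n \<omega> 1)\<^sup>2 \<partial>P n) = b" if n: "real n > b" for n
  proof -
    have "n \<ge> 1" using n b by linarith
    then have m: "(\<lambda>x. (x 1)\<^sup>2) \<in> borel_measurable (borel_n n)" by simp
    have "(\<integral>\<omega>. (X n \<omega> 1)\<^sup>2 \<partial>P n) = (\<integral>x. (x 1)\<^sup>2 \<partial>\<mu> n)"
      unfolding \<mu>_def by (rule integral_distr[OF X[OF n] m, symmetric])
    also have "\<dots> = b" using \<open>n \<ge> 1\<close> b by (intro uniform_on_K_second_moment[OF U.unif[OF n]]) auto
    finally show ?thesis .
  qed
  have b2: "(\<integral>\<omega>. (Z 1 \<omega>)\<^sup>2 \<partial>Q) = 2" using U.Z_moment[of 1 2] by simp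
  have b3: "\<not> (\<lambda>n. \<integral>\<omega>. (X n \<omega> 1)\<^sup>2 \<partial>P n) \<longlonglongrightarrow> (\<integral>\<omega>. (Z 1 \<omega>)\<^sup>2 \<partial>Q)"
  proof
    assume lim: "(\<lambda>n. \<integral>\<omega>. (X n \<omega> 1)\<^sup>2 \<partial>P n) \<longlonglongrightarrow> (\<integral>\<omega>. (Z 1 \<omega>)\<^sup>2 \<partial>Q)"
    have "\<forall>\<^sub>F n in sequentially. b = (\<integral>\<omega>. (X n \<omega> 1)\<^sup>2 \<partial>P n)"
      using U.eventually_n by eventually_elim (use b1 in auto)
    then have "(\<lambda>n. \<integral>\<omega>. (X n \<omega> 1)\<^sup>2 \<partial>P n) \<longlonglongrightarrow> b"
      by (rule Lim_transform_eventually[OF tendsto_const])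
    from LIMSEQ_unique[OF lim this] show False using b2 b by simp
  qed
  have c1: "conv_in_prob P (\<lambda>n \<omega>. (max_coord n (X n \<omega>))\<^sup>2 / ((b - 2) * real n)) 1"
    using Xev
  proof (rule conv_in_prob_distrI)
    show "\<forall>\<^sub>F n in sequentially. (\<lambda>x. (max_coord n x)\<^sup>2 / ((b - 2) * real n)) \<in> borel_measurable (borel_n n)"
      using Mev
    proof eventually_elim
      case (elim n)
      note [measurable] = conjunct1[OF elim] conjunct2[OF elim]
      show ?case by measurable
    qed
  qed (use U.max_coord_concentration in \<open>simp only: \<mu>_def\<close>)
  have c2: "conv_in_prob P (\<lambda>n \<omega>. (1 / real n) * ((\<Sum>i=1..n. (X n \<omega> i)\<^sup>2) - (max_coord n (X n \<omega>))\<^sup>2)) 2"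
    using Xev
  proof (rule conv_in_prob_distrI)
    show "\<forall>\<^sub>F n in sequentially. (\<lambda>x. (1 / real n) * ((\<Sum>i=1..n. (x i)\<^sup>2) - (max_coord n x)\<^sup>2)) \<in> borel_measurable (borel_n n)"
      using Mev
    proof eventually_elim
      case (elim n)
      note [measurable] = conjunct1[OF elim] conjunct2[OF elim]
      show ?case by measurable
    qed
  qed (use U.rest_concentration in \<open>simp only: \<mu>_def\<close>)
  have d: "conv_in_prob P (\<lambda>n \<omega>. (second_max_coord n (X n \<omega>))\<^sup>2 / real n) 0"
    using Xev
  proof (rule conv_in_prob_distrI)
    show "\<forall>\<^sub>F n in sequentially. (\<lambda>x. (second_max_coord n x)\<^sup>2 / real n) \<in> borel_measurable (borel_n n)"
      using Mev
    proof eventually_elim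
      case (elim n)
      note [measurable] = conjunct1[OF elim] conjunct2[OF elim]
      show ?case by measurable
    qed
  qed (use U.second_max_coord_concentration in \<open>simp only: \<mu>_def\<close>)
  show ?thesis using a b1 b2 b3 c1 c2 d by blast
qed

end
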